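(* The capacity region of the state-dependent injective deterministic Z-interference channel with unidirectional partial cribbing (defined in the context) is given by the convex closure of the rate pairs $(R_1,R_2)$ satisfying $$\begin{aligned} R_1 & \le H(Y_1|W,S),\\ R_2 & \le H(Y_2,Z_2|T_1,W),\\ R_2 & \le \min\big(H(Y_2),H(Y_2,Z_2|W)\big) - I(T_1;S|W),\\ R_1 + R_2 & \le H(Y_1|W,T_1,S) + \min\big(H(Y_2),H(Y_2,Z_2|W)\big) - I(T_1;S|W), \end{aligned}$$ for some pmf of the form $p(w)\,p(x_2|w)\,p(x_1|w,s)$ (with $W$ taking values in a finite alphabet), where the quantities are evaluated under the joint pmf $p(s)p(w)p(x_2|w)p(x_1|w,s)$ with $T_1=t_1(X_1,S)$, $Y_1=y_1(X_1,S)$, $Y_2=y_2(X_2,T_1)$, $Z_2=z_2(X_2)$.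
   Context: Channel: finite alphabets; the state $S^n$ is i.i.d. according to $p(s)$, independent of the messages, and known noncausally at encoder 1 only. Receiver 1 observes $Y_1=y_1(X_1,S)$, a deterministic function. The interference is $T_1=t_1(X_1,S)$, a deterministic function, and receiver 2 observes $Y_2=y_2(X_2,T_1)$, a deterministic function. Injectivity: for each fixed $x_2$, $t_1\mapsto y_2(x_2,t_1)$ is injective, i.e. there is a function $g$ with $t_1=g(y_2,x_2)$. The partial cribbing signal is $Z_2=z_2(X_2)\in\mathcal{Z}_2$, a deterministic function of $X_2$, observed strictly causally by encoder 1. All functions act letter by letter over $n$ channel uses. Codes: $[1:2^{nR}]$ denotes $\{1,\dots,\lceil 2^{nR}\rceil\}$. The messages $M_1,M_2$ are independent, uniform on $[1:2^{nR_1}]$ and $[1:2^{nR_2}]$; sender $j$ communicates $M_j$ to receiver $j$. A code of length $n$ consists of encoding functions $f_{1,i}:[1:2^{nR_1}]\times\mathcal{S}^n\times\mathcal{Z}_2^{i-1}\to\mathcal{X}_1$ (so $X_{1i}$ is a function of $(M_1,S^n,Z_2^{i-1})$) and $f_{2,i}:[1:2^{nR_2}]\to\mathcal{X}_2$, $1\le i\le n$, and decoding functions $g_j:\mathcal{Y}_j^n\to[1:2^{nR_j}]$, $j\in\{1,2\}$. A pair $(R_1,R_2)$ of nonnegative reals is achievable if for every $\epsilon>0$ there exists, for all sufficiently large $n$, a code with $\Pr\{g_j(Y_j^n)\ne M_j\}\le\epsilon$ for $j\in\{1,2\}$. The capacity region is the closure of the set of achievable rate pairs. "Convex closure" means closure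 of the convex hull; rate pairs are pairs of nonnegative reals. *)

theory Defs
  imports "HOL-Probability.Probability"
begin

text \<open>
  The information measures of \<^theory>\<open>HOL-Probability.Information\<close> for random variables on a
  discrete probability space, all taken with respect to counting measure on the full type, so that
  random variables with values in \<^typ>\<open>nat\<close> and finite support are covered.
\<close>

definition pmf_entropy :: "'a pmf \<Rightarrow> ('a \<Rightarrow> 'b) \<Rightarrow> real" where
  "pmf_entropy p X = prob_space.entropy (measure_pmf p) 2 (count_space UNIV) X"

definition pmf_cond_entropy :: "'a pmf \<Rightarrow> ('a \<Rightarrow> 'b) \<Rightarrow> ('a \<Rightarrow> 'c) \<Rightarrow> real" where
  "pmf_cond_entropy p X Y =
     prob_space.conditional_entropy (measure_pmf p) 2 (count_space UNIV) (count_space UNIV) X Y"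

definition pmf_cond_mutual_info ::
    "'a pmf \<Rightarrow> ('a \<Rightarrow> 'b) \<Rightarrow> ('a \<Rightarrow> 'c) \<Rightarrow> ('a \<Rightarrow> 'd) \<Rightarrow> real" where
  "pmf_cond_mutual_info p X Y Z =
     prob_space.conditional_mutual_information (measure_pmf p) 2
       (count_space UNIV) (count_space UNIV) (count_space UNIV) X Y Z"

lemma sigma_finite_count_space_countable:
  "sigma_finite_measure (count_space (UNIV :: 'a::countable set))"
  by (rule sigma_finite_measure_count_space)

lemma information_space_pmf: "information_space (measure_pmf p) 2"
  by (simp add: information_space_def information_space_axioms_def measure_pmf.prob_space_axioms)

lemma distributed_map_pmf:
  "distributed (measure_pmf p) (count_space UNIV) X (\<lambda>x. ennreal (pmf (map_pmf X p) x))"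
  unfolding distributed_def
  by (auto simp: measure_pmf_eq_density[symmetric] map_pmf_rep_eq[symmetric])

lemma pair_count_space_countable:
  "count_space (UNIV :: 'a::countable set) \<Otimes>\<^sub>M count_space (UNIV :: 'b::countable set) = count_space UNIV"
  by (subst pair_measure_countable) auto

lemma pmf_entropy_eq:
  fixes X :: "'a \<Rightarrow> 'b::countable"
  shows "pmf_entropy p X =
    - (\<integral>x. pmf (map_pmf X p) x * log 2 (pmf (map_pmf X p) x) \<partial>count_space UNIV)"
proof -
  interpret information_space "measure_pmf p" 2 by (rule information_space_pmf)
  show ?thesis unfolding pmf_entropy_def
    by (subst entropy_distr[OF distributed_map_pmf]) auto
qed

lemma pmf_cond_entropy_eq:
  fixes X :: "'a \<Rightarrow> 'b::countable" and Y :: "'a \<Rightarrow> 'c::countable"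
  shows "pmf_cond_entropy p X Y =
    - (\<integral>(x,y). pmf (map_pmf (\<lambda>w. (X w, Y w)) p) (x,y)
      * log 2 (pmf (map_pmf (\<lambda>w. (X w, Y w)) p) (x,y) / pmf (map_pmf Y p) y) \<partial>count_space UNIV)"
proof -
  interpret information_space "measure_pmf p" 2 by (rule information_space_pmf)
  show ?thesis unfolding pmf_cond_entropy_def
    by (subst conditional_entropy_generic_eq[OF sigma_finite_count_space_countable
      sigma_finite_count_space_countable distributed_map_pmf,
      where Pxy = "pmf (map_pmf (\<lambda>w. (X w, Y w)) p)"]) (auto simp: pair_count_space_countable distributed_map_pmf)
qed

lemma pmf_cond_mutual_info_eq:
  fixes X :: "'a \<Rightarrow> 'b::countable" and Y :: "'a \<Rightarrow> 'c::countable" and Z :: "'a \<Rightarrow> 'd::countable"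
  assumes "finite (X ` set_pmf p)" "finite (Y ` set_pmf p)" "finite (Z ` set_pmf p)"
  shows "pmf_cond_mutual_info p X Y Z =
    (\<integral>(x,y,z). pmf (map_pmf (\<lambda>w. (X w, Y w, Z w)) p) (x,y,z)
      * log 2 (pmf (map_pmf (\<lambda>w. (X w, Y w, Z w)) p) (x,y,z)
        / (pmf (map_pmf (\<lambda>w. (X w, Z w)) p) (x,z) * (pmf (map_pmf (\<lambda>w. (Y w, Z w)) p) (y,z) / pmf (map_pmf Z p) z))) \<partial>count_space UNIV)"
proof -
  interpret information_space "measure_pmf p" 2 by (rule information_space_pmf)
  let ?A = "(\<lambda>w. (X w, Y w, Z w)) ` set_pmf p"
  have f: "finite ?A" by (rule finite_subset[of _ "X ` set_pmf p \<times> Y ` set_pmf p \<times> Z ` set_pmf p"]) (use assms in auto)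
  have I: "integrable (count_space UNIV) (\<lambda>(x,y,z). pmf (map_pmf (\<lambda>w. (X w, Y w, Z w)) p) (x,y,z) * g (x,y,z))" for g :: "_ \<Rightarrow> real"
    apply (rule integrableI_bounded) apply simp
    apply (subst nn_integral_count_space'[OF f])
    by (auto simp: set_pmf_eq[symmetric] pmf_eq_0_set_pmf less_top[symmetric] split: prod.splits)
  show ?thesis unfolding pmf_cond_mutual_info_def
    apply (subst conditional_mutual_information_generic_eq[OF sigma_finite_count_space_countable
      sigma_finite_count_space_countable sigma_finite_count_space_countable,
      where Px = "pmf (map_pmf X p)" and Pz = "pmf (map_pmf Z p)" and Pyz="pmf (map_pmf (\<lambda>w. (Y w, Z w)) p)" and Pxz="pmf (map_pmf (\<lambda>w. (X w, Z w)) p)" and Pxyz="pmf (map_pmf (\<lambda>w. (X w, Y w, Z w)) p)"])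
    apply (simp_all add: pair_count_space_countable distributed_map_pmf)
    using I[of "\<lambda>(x, y, z). log 2 (pmf (map_pmf (\<lambda>w. (X w, Y w, Z w)) p) (x, y, z) / (pmf (map_pmf X p) x * pmf (map_pmf (\<lambda>w. (Y w, Z w)) p) (y, z)))"]
      I[of "\<lambda>(x, y, z). log 2 (pmf (map_pmf (\<lambda>w. (X w, Z w)) p) (x, z) / (pmf (map_pmf X p) x * pmf (map_pmf Z p) z))"]
    by (simp_all add: case_prod_unfold)
qed

record ('s, 'x1, 'x2, 't1, 'y1, 'y2, 'z2) zic =
  state_pmf :: "'s pmf"
  out1 :: "'x1 \<Rightarrow> 's \<Rightarrow> 'y1"
  interf :: "'x1 \<Rightarrow> 's \<Rightarrow> 't1"
  out2 :: "'x2 \<Rightarrow> 't1 \<Rightarrow> 'y2"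
  crib :: "'x2 \<Rightarrow> 'z2"

definition injective_zic :: "('s, 'x1, 'x2, 't1, 'y1, 'y2, 'z2) zic \<Rightarrow> bool" where
  "injective_zic C \<longleftrightarrow> (\<forall>x2. inj (out2 C x2))"

definition messages :: "nat \<Rightarrow> real \<Rightarrow> nat set" where
  "messages n R = {1..nat \<lceil>2 powr (real n * R)\<rceil>}"

text \<open>
  Sequences over a block of length \<open>n\<close> are lists of length \<open>n\<close>, and time is counted
  from \<open>0\<close>; so at time \<open>i\<close> the cribbing signals observed strictly before time \<open>i\<close> form the prefix
  of length \<open>i\<close>. The arguments of the encoders are the time, the message, and for
  encoder 1 the whole state sequence and the past cribbing signals.
\<close>

record ('s, 'x1, 'x2, 'y1, 'y2, 'z2) zic_code =
  enc1 :: "nat \<Rightarrow> nat \<Rightarrow> 's list \<Rightarrow> 'z2 list \<Rightarrow> 'x1"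
  enc2 :: "nat \<Rightarrow> nat \<Rightarrow> 'x2"
  dec1 :: "'y1 list \<Rightarrow> nat"
  dec2 :: "'y2 list \<Rightarrow> nat"

definition is_code ::
    "nat \<Rightarrow> real \<Rightarrow> real \<Rightarrow> ('s, 'x1, 'x2, 'y1, 'y2, 'z2) zic_code \<Rightarrow> bool" where
  "is_code n R1 R2 c \<longleftrightarrow>
     (\<forall>ys. length ys = n \<longrightarrow> dec1 c ys \<in> messages n R1) \<and>
     (\<forall>ys. length ys = n \<longrightarrow> dec2 c ys \<in> messages n R2)"

context
  fixes C :: "('s, 'x1, 'x2, 't1, 'y1, 'y2, 'z2) zic"
    and c :: "('s, 'x1, 'x2, 'y1, 'y2, 'z2) zic_code"
    and n :: nat
begin

definition seq_x2 :: "nat \<Rightarrow> 'x2 list" where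
  "seq_x2 m2 = map (\<lambda>i. enc2 c i m2) [0..<n]"

definition seq_z2 :: "nat \<Rightarrow> 'z2 list" where
  "seq_z2 m2 = map (crib C) (seq_x2 m2)"

definition seq_x1 :: "nat \<Rightarrow> nat \<Rightarrow> 's list \<Rightarrow> 'x1 list" where
  "seq_x1 m1 m2 ss = map (\<lambda>i. enc1 c i m1 ss (take i (seq_z2 m2))) [0..<n]"

definition seq_t1 :: "nat \<Rightarrow> nat \<Rightarrow> 's list \<Rightarrow> 't1 list" where
  "seq_t1 m1 m2 ss = map2 (interf C) (seq_x1 m1 m2 ss) ss"

definition seq_y1 :: "nat \<Rightarrow> nat \<Rightarrow> 's list \<Rightarrow> 'y1 list" where
  "seq_y1 m1 m2 ss = map2 (out1 C) (seq_x1 m1 m2 ss) ss"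

definition seq_y2 :: "nat \<Rightarrow> nat \<Rightarrow> 's list \<Rightarrow> 'y2 list" where
  "seq_y2 m1 m2 ss = map2 (out2 C) (seq_x2 m2) (seq_t1 m1 m2 ss)"

end

definition source_pmf ::
    "('s, 'x1, 'x2, 't1, 'y1, 'y2, 'z2) zic \<Rightarrow> nat \<Rightarrow> real \<Rightarrow> real \<Rightarrow> (nat \<times> nat \<times> 's list) pmf" where
  "source_pmf C n R1 R2 =
     pair_pmf (pmf_of_set (messages n R1))
       (pair_pmf (pmf_of_set (messages n R2)) (replicate_pmf n (state_pmf C)))"

definition error_prob1 ::
    "('s, 'x1, 'x2, 't1, 'y1, 'y2, 'z2) zic \<Rightarrow> nat \<Rightarrow> real \<Rightarrow> real \<Rightarrow>
     ('s, 'x1, 'x2, 'y1, 'y2, 'z2) zic_code \<Rightarrow> real" where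
  "error_prob1 C n R1 R2 c =
     measure_pmf.prob (source_pmf C n R1 R2)
       {(m1, m2, ss). dec1 c (seq_y1 C c n m1 m2 ss) \<noteq> m1}"

definition error_prob2 ::
    "('s, 'x1, 'x2, 't1, 'y1, 'y2, 'z2) zic \<Rightarrow> nat \<Rightarrow> real \<Rightarrow> real \<Rightarrow>
     ('s, 'x1, 'x2, 'y1, 'y2, 'z2) zic_code \<Rightarrow> real" where
  "error_prob2 C n R1 R2 c =
     measure_pmf.prob (source_pmf C n R1 R2)
       {(m1, m2, ss). dec2 c (seq_y2 C c n m1 m2 ss) \<noteq> m2}"

definition achievable :: "('s, 'x1, 'x2, 't1, 'y1, 'y2, 'z2) zic \<Rightarrow> real \<Rightarrow> real \<Rightarrow> bool" where
  "achievable C R1 R2 \<longleftrightarrow>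
     0 \<le> R1 \<and> 0 \<le> R2 \<and>
     (\<forall>\<epsilon>>0. \<forall>\<^sub>F n in sequentially.
        \<exists>c. is_code n R1 R2 c \<and> error_prob1 C n R1 R2 c \<le> \<epsilon> \<and> error_prob2 C n R1 R2 c \<le> \<epsilon>)"

definition capacity_region :: "('s, 'x1, 'x2, 't1, 'y1, 'y2, 'z2) zic \<Rightarrow> (real \<times> real) set" where
  "capacity_region C = closure {(R1, R2). achievable C R1 R2}"

text \<open>
  The auxiliary variable takes values in a finite subset of \<^typ>\<open>nat\<close>, which up to
  relabelling is an arbitrary finite alphabet.
\<close>

definition joint_pmf ::
    "'s pmf \<Rightarrow> nat pmf \<Rightarrow> (nat \<Rightarrow> 'x2 pmf) \<Rightarrow> (nat \<Rightarrow> 's \<Rightarrow> 'x1 pmf) \<Rightarrow>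
     (nat \<times> 's \<times> 'x1 \<times> 'x2) pmf" where
  "joint_pmf ps pw px2 px1 =
     do {
       s \<leftarrow> ps;
       w \<leftarrow> pw;
       x2 \<leftarrow> px2 w;
       x1 \<leftarrow> px1 w s;
       return_pmf (w, s, x1, x2)
     }"

definition in_rate_region ::
    "('s, 'x1, 'x2, 't1, 'y1, 'y2, 'z2) zic \<Rightarrow> (nat \<times> 's \<times> 'x1 \<times> 'x2) pmf \<Rightarrow>
     real \<Rightarrow> real \<Rightarrow> bool" where
  "in_rate_region C p R1 R2 \<longleftrightarrow>
    (let W = (\<lambda>(w, s, x1, x2). w);
         S = (\<lambda>(w, s, x1, x2). s);
         T1 = (\<lambda>(w, s, x1, x2). interf C x1 s);
         Y1 = (\<lambda>(w, s, x1, x2). out1 C x1 s);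
         Y2 = (\<lambda>(w, s, x1, x2). out2 C x2 (interf C x1 s));
         Z2 = (\<lambda>(w, s, x1, x2). crib C x2);
         H_Y1_WS = pmf_cond_entropy p Y1 (\<lambda>\<omega>. (W \<omega>, S \<omega>));
         H_Y1_WTS = pmf_cond_entropy p Y1 (\<lambda>\<omega>. (W \<omega>, T1 \<omega>, S \<omega>));
         H_YZ_TW = pmf_cond_entropy p (\<lambda>\<omega>. (Y2 \<omega>, Z2 \<omega>)) (\<lambda>\<omega>. (T1 \<omega>, W \<omega>));
         H_YZ_W = pmf_cond_entropy p (\<lambda>\<omega>. (Y2 \<omega>, Z2 \<omega>)) W;
         H_Y2 = pmf_entropy p Y2;
         I_TS_W = pmf_cond_mutual_info p T1 S W
     in 0 \<le> R1 \<and> 0 \<le> R2 \<and>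
        R1 \<le> H_Y1_WS \<and>
        R2 \<le> H_YZ_TW \<and>
        R2 \<le> min H_Y2 H_YZ_W - I_TS_W \<and>
        R1 + R2 \<le> H_Y1_WTS + min H_Y2 H_YZ_W - I_TS_W)"

definition rate_region :: "('s, 'x1, 'x2, 't1, 'y1, 'y2, 'z2) zic \<Rightarrow> (real \<times> real) set" where
  "rate_region C =
     {(R1, R2). \<exists>pw px2 px1. finite (set_pmf pw) \<and>
        in_rate_region C (joint_pmf (state_pmf C) pw px2 px1) R1 R2}"

end

theory Submission
  imports Defs
begin

text \<open>
  Direct part. Receiver 1 reads its message off a random hash of its output; encoder 1 steers the
  deterministic outputs so that the hash is right, while keeping the interference inside a sparse
  random set of sequences attached to the auxiliary codeword. The auxiliary codeword of a block is
  indexed by a hash of the cribbed sequence of the preceding block, so that both encoders know it.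
  Receiver 2 finds this index from its output alone, at a rate just below
  \<open>max (I(W;Y2)) (I(W,T1;Y2) - R)\<close>, where \<open>R\<close> is the rate of the set of interference sequences;
  the index of the following block then serves as a hash that makes the message unique. All outputs
  being deterministic, the code fails only if encoder 1 finds no admissible sequence (a second moment
  bound), or if a wrong index or message explains the output (a union bound).

  Converse. The auxiliary variable at time \<open>i\<close> is the sequence of cribbing signals before time \<open>i\<close>;
  given it, encoder 2 is independent of encoder 1 and the states. By injectivity,
  \<open>H(Y2 | M2) = H(T1 | M2)\<close> for the sequences, which splits into the information about the states and
  a remainder that is paid back in the bound on the sum rate.

  Time sharing can be absorbed into \<open>W\<close>, as \<open>H(Y2)\<close> is concave and the other terms are
  conditioned on \<open>W\<close>. So the single-letter region is already convex.
\<close>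

text \<open>Two free rates govern the direct part: \<open>RT\<close>, that of the admissible set,
  and \<open>Rl\<close>, that of the link. To hit the set and the hash at once, encoder 1 needs
  \<open>RT\<close> above I(T1;S|W) and above R1 + I(T1;S|W) - H(Y1|W,T1,S). Inserted into R2 + RT
  \<le> min(H(Y2), H(Y2,Z2|W)), these lower bounds become the third and the fourth inequality. The
  term H(Y2,Z2|W) comes from wrong messages with the right cribbed sequence, which no hash
  separates. Those with another cribbed sequence survive the hash with probability 2^(-n Rl); they
  ask for R2 + RT - Rl \<le> H(Y2|W) and, when they explain the output with the true interference,
  for R2 - Rl \<le> H(Y2|W,T1). A link of rate I(W;Y2) settles only the former. The second test for
  the link, by which the output must also fit some sequence of the sparse set, supports rate
  I(W,T1;Y2) - RT and settles the latter. The larger of the two rates settles both, since each then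
  follows from R2 + RT \<le> H(Y2).\<close>

lemma emeasure_of_bool: "emeasure (measure_pmf p) {x. P x} = (\<integral>\<^sup>+x. of_bool (P x) \<partial>measure_pmf p)"
proof -
  have "(\<integral>\<^sup>+x. of_bool (P x) \<partial>measure_pmf p) = (\<integral>\<^sup>+x. indicator {x. P x} x \<partial>measure_pmf p)"
    by (rule nn_integral_cong) (simp add: indicator_def)
  then show ?thesis by simp
qed

lemma nn_integral_pmf_mono:
  assumes "\<And>x. x \<in> set_pmf p \<Longrightarrow> F x \<le> G x"
  shows "(\<integral>\<^sup>+x. F x \<partial>measure_pmf p) \<le> (\<integral>\<^sup>+x. G x \<partial>measure_pmf p)"
  by (rule nn_integral_mono_AE) (use assms in \<open>auto simp: AE_measure_pmf_iff\<close>)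

lemma nn_integral_pmf_le:
  assumes "\<And>x. x \<in> set_pmf p \<Longrightarrow> F x \<le> c"
  shows "(\<integral>\<^sup>+x. F x \<partial>measure_pmf p) \<le> c"
proof -
  have "(\<integral>\<^sup>+x. F x \<partial>measure_pmf p) \<le> (\<integral>\<^sup>+x. c \<partial>measure_pmf p)"
    by (rule nn_integral_pmf_mono) (rule assms)
  then show ?thesis by simp
qed

lemma nn_integral_pmf_commute:
  "(\<integral>\<^sup>+x. \<integral>\<^sup>+y. F x y \<partial>measure_pmf q \<partial>measure_pmf p) =
   (\<integral>\<^sup>+y. \<integral>\<^sup>+x. F x y \<partial>measure_pmf p \<partial>measure_pmf q)"
proof -
  have "(\<integral>\<^sup>+z. (\<lambda>(x, y). F x y) z \<partial>measure_pmf (pair_pmf p q)) =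
        (\<integral>\<^sup>+z. (\<lambda>(x, y). F x y) z \<partial>measure_pmf (map_pmf (\<lambda>(x, y). (y, x)) (pair_pmf q p)))"
    by (subst pair_commute_pmf) simp
  then show ?thesis by (simp add: nn_integral_pair_pmf')
qed

lemma Pi_pmf_component2:
  assumes "finite A" "a \<in> A" "b \<in> A" "a \<noteq> b"
  shows "map_pmf (\<lambda>f. (f a, f b)) (Pi_pmf A d p) = pair_pmf (p a) (p b)"
proof -
  have "Pi_pmf A d p = map_pmf (\<lambda>(y, f). f(a := y)) (pair_pmf (p a) (Pi_pmf (A - {a}) d p))"
    using Pi_pmf_insert[of "A - {a}" a d p] assms by (simp add: insert_absorb)
  then have "map_pmf (\<lambda>f. (f a, f b)) (Pi_pmf A d p) =
    map_pmf (\<lambda>(y, f). (y, f b)) (pair_pmf (p a) (Pi_pmf (A - {a}) d p))"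
    using assms by (simp add: map_pmf_comp case_prod_unfold)
  also have "\<dots> = pair_pmf (p a) (map_pmf (\<lambda>f. f b) (Pi_pmf (A - {a}) d p))"
    using map_pair[of "\<lambda>x. x" "\<lambda>f. f b" "p a" "Pi_pmf (A - {a}) d p"] by simp
  also have "\<dots> = pair_pmf (p a) (p b)"
    using assms by (subst Pi_pmf_component) auto
  finally show ?thesis .
qed

lemma nn_integral_Pi_pmf_component:
  assumes "finite A" "a \<in> A"
  shows "(\<integral>\<^sup>+f. F (f a) \<partial>measure_pmf (Pi_pmf A d p)) = (\<integral>\<^sup>+x. F x \<partial>measure_pmf (p a))"
  using Pi_pmf_component[of A a d p] assms nn_integral_map_pmf[of "\<lambda>f. f a" "Pi_pmf A d p" F] by simp

lemma nn_integral_Pi_pmf_component2: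
  assumes "finite A" "a \<in> A" "b \<in> A" "a \<noteq> b"
  shows "(\<integral>\<^sup>+f. F (f a) (f b) \<partial>measure_pmf (Pi_pmf A d p)) =
    (\<integral>\<^sup>+x. \<integral>\<^sup>+y. F x y \<partial>measure_pmf (p b) \<partial>measure_pmf (p a))"
  using nn_integral_map_pmf[of "\<lambda>f. (f a, f b)" "Pi_pmf A d p" "\<lambda>(x, y). F x y"]
  by (simp add: Pi_pmf_component2[OF assms] nn_integral_pair_pmf')

lemma finite_set_Pi_pmf:
  assumes "finite A" "\<And>x. x \<in> A \<Longrightarrow> finite (set_pmf (p x))"
  shows "finite (set_pmf (Pi_pmf A d p))"
  by (subst set_Pi_pmf[OF assms(1)]) (use assms in \<open>auto intro!: finite_PiE_dflt\<close>)

lemma expectation_pmf_cong_map: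
  "map_pmf h p = q \<Longrightarrow> measure_pmf.expectation p (\<lambda>x. F (h x) :: real) = measure_pmf.expectation q F"
  by auto

section \<open>Covering by a second moment bound\<close>

lemma expectation_incl_incl:
  fixes q :: "'t \<Rightarrow> real"
  assumes "finite Ts" "t \<in> Ts" "t' \<in> Ts" "\<And>t. 0 \<le> q t" "\<And>t. q t \<le> 1"
  shows "measure_pmf.expectation (Pi_pmf Ts False (\<lambda>t. bernoulli_pmf (q t)))
           (\<lambda>Th. of_bool (Th t) * of_bool (Th t')) = (if t = t' then q t else q t * q t')"
proof (cases "t = t'")
  case True
  have "measure_pmf.expectation (Pi_pmf Ts False (\<lambda>t. bernoulli_pmf (q t))) (\<lambda>Th. (\<lambda>b. of_bool b :: real) (Th
      t)) =
    measure_pmf.expectation (bernoulli_pmf (q t)) (\<lambda>b. of_bool b)"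
    by (rule expectation_pmf_cong_map[where h = "\<lambda>Th. Th t"]) (simp add: Pi_pmf_component assms)
  then show ?thesis using True assms by (simp flip: of_bool_conj)
next
  case False
  have "measure_pmf.expectation (Pi_pmf Ts False (\<lambda>t. bernoulli_pmf (q t)))
      (\<lambda>Th. (\<lambda>(b, b'). of_bool b * of_bool b' :: real) (Th t, Th t')) =
    measure_pmf.expectation (pair_pmf (bernoulli_pmf (q t)) (bernoulli_pmf (q t'))) (\<lambda>(b, b'). of_bool b *
        of_bool b')"
    by (rule expectation_pmf_cong_map[where h = "\<lambda>Th. (Th t, Th t')"]) (simp add: Pi_pmf_component2 assms
        False)
  also have "\<dots> = (\<Sum>bb\<in>UNIV. (case bb of (b, b') \<Rightarrow> of_bool b * of_bool b') * pmf (pair_pmf (bernoulli_pmf (q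
      t)) (bernoulli_pmf (q t'))) bb)"
    by (subst integral_measure_pmf_real[where A = UNIV]) auto
  also have "\<dots> = q t * q t'"
    using assms by (simp add: UNIV_Times_UNIV[symmetric] sum.cartesian_product[symmetric] UNIV_bool pmf_pair
        del: UNIV_Times_UNIV)
  finally show ?thesis using False by simp
qed

lemma expectation_hash_hash:
  assumes "finite Ys" "y \<in> Ys" "y' \<in> Ys" "m < (M::nat)"
  shows "measure_pmf.expectation (Pi_pmf Ys d (\<lambda>_. pmf_of_set {..<M}))
           (\<lambda>\<beta>. of_bool (\<beta> y = m) * of_bool (\<beta> y' = m)) = (if y = y' then 1 / real M else 1 / real M * (1 /
               real M))"
proof (cases "y = y'")
  case True
  have "measure_pmf.expectation (Pi_pmf Ys d (\<lambda>_. pmf_of_set {..<M})) (\<lambda>\<beta>. (\<lambda>i. of_bool (i = m) :: real) (\<beta>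
      y)) =
    measure_pmf.expectation (pmf_of_set {..<M}) (\<lambda>i. of_bool (i = m))"
    by (rule expectation_pmf_cong_map[where h = "\<lambda>\<beta>. \<beta> y"]) (simp add: Pi_pmf_component assms)
  also have "\<dots> = 1 / real M"
    using assms by (subst integral_pmf_of_set) (auto simp: lessThan_empty_iff of_bool_def)
  finally show ?thesis using True by (simp flip: of_bool_conj)
next
  case False
  have "measure_pmf.expectation (Pi_pmf Ys d (\<lambda>_. pmf_of_set {..<M}))
      (\<lambda>\<beta>. (\<lambda>(i, j). of_bool (i = m) * of_bool (j = m) :: real) (\<beta> y, \<beta> y')) =
    measure_pmf.expectation (pair_pmf (pmf_of_set {..<M}) (pmf_of_set {..<M})) (\<lambda>(i, j). of_bool (i = m) *
        of_bool (j = m))"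
    by (rule expectation_pmf_cong_map[where h = "\<lambda>\<beta>. (\<beta> y, \<beta> y')"]) (simp add: Pi_pmf_component2 assms False)
  also have "\<dots> = (\<Sum>ij\<in>{..<M} \<times> {..<M}. (case ij of (i, j) \<Rightarrow> of_bool (i = m) * of_bool (j = m)) * pmf
      (pair_pmf (pmf_of_set {..<M}) (pmf_of_set {..<M})) ij)"
    using assms by (subst integral_measure_pmf_real[where A = "{..<M} \<times> {..<M}"]) (auto simp:
        lessThan_empty_iff)
  also have "\<dots> = (\<Sum>i<M. \<Sum>j<M. of_bool (i = m) * (of_bool (j = m) * (1 / (real M * real M))))"
    unfolding sum.cartesian_product using assms by (intro sum.cong) (auto simp: pmf_pair lessThan_empty_iff)
  also have "\<dots> = 1 / (real M * real M)"
  proof -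
    have "{..<M} \<inter> {i. i = m} = {m}" using assms by auto
    then have "(\<Sum>i<M. \<Sum>j<M. of_bool (i = m) * (of_bool (j = m) * c)) = c" for c :: real
      by (simp only: sum_of_bool_mult_eq finite_lessThan sum_distrib_left[symmetric]) simp
    then show ?thesis .
  qed
  finally show ?thesis using False by simp
qed

text \<open>Chebyshev's inequality for a weighted count of the surviving \<open>u\<close>. Each
  weight is divided by the survival probability \<open>q (tt u) / M\<close>, so the mean is the
  probability of \<open>A\<close>; if nothing survives, the count misses its mean by exactly that
  much. Two survivals are correlated only through a common \<open>tt\<close> or a common
  \<open>yy\<close>, which gives the terms with \<open>a2\<close> and \<open>a3\<close>; sharing
  both forces \<open>u = u'\<close>, which gives the term with \<open>a1\<close>.\<close>

lemma covering_second_moment: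
  fixes kk :: "'u pmf" and Q :: "'t pmf" and tt :: "'u \<Rightarrow> 't" and yy :: "'u \<Rightarrow> 'y"
  assumes fin: "finite Ts" "finite Ys" "finite (set_pmf kk)"
    and A: "A \<subseteq> set_pmf kk" "tt ` A \<subseteq> Ts" "yy ` A \<subseteq> Ys"
    and inj: "\<And>u u'. u \<in> A \<Longrightarrow> u' \<in> A \<Longrightarrow> tt u = tt u' \<Longrightarrow> yy u = yy u' \<Longrightarrow> u = u'"
    and K: "0 < K" and m: "m < M"
    and a1: "\<And>u. u \<in> A \<Longrightarrow> pmf kk u \<le> a1 * pmf Q (tt u)"
    and a2: "\<And>u. u \<in> A \<Longrightarrow> pmf (map_pmf tt kk) (tt u) \<le> a2 * pmf Q (tt u)"
    and a3: "\<And>u. u \<in> A \<Longrightarrow> pmf (map_pmf yy kk) (yy u) \<le> a3"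
    and nn: "0 \<le> a1" "0 \<le> a2" "0 \<le> a3"
  shows "(measure_pmf.prob kk A)\<^sup>2 * measure_pmf.prob (pair_pmf (Pi_pmf Ts False (\<lambda>t. bernoulli_pmf (min 1 (K
      * pmf Q t))))
     (Pi_pmf Ys d (\<lambda>_. pmf_of_set {..<M}))) {(Th, \<beta>). \<not> (\<exists>u\<in>A. Th (tt u) \<and> \<beta> (yy u) = m)}
     \<le> a2 / K + (real M - 1) * a3 + (real M - 1) * a1 / K"
proof -
  define q where "q t = min 1 (K * pmf Q t)" for t
  define DT where "DT = Pi_pmf Ts False (\<lambda>t. bernoulli_pmf (q t))"
  define DB where "DB = Pi_pmf Ys d (\<lambda>_. pmf_of_set {..<M})"
  define D where "D = pair_pmf DT DB"
  define p where "p u = pmf kk u" for u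
  define \<pi> where "\<pi> = measure_pmf.prob kk A"
  define c where "c u = p u * (real M / q (tt u))" for u
  define I where "I u x = (of_bool ((fst x) (tt u)) * of_bool ((snd x) (yy u) = m) :: real)" for u and x ::
      "('t \<Rightarrow> bool) \<times> ('y \<Rightarrow> nat)"
  define N where "N x = (\<Sum>u\<in>A. c u * I u x)" for x
  have finA: "finite A" using A fin finite_subset by auto
  have q01: "0 \<le> q t" "q t \<le> 1" for t using K by (auto simp: q_def)
  have finD: "finite (set_pmf D)"
    unfolding D_def DT_def DB_def using fin m
    by (auto intro!: finite_set_Pi_pmf simp: lessThan_empty_iff)
  have int: "integrable (measure_pmf D) F" for F :: "_ \<Rightarrow> real"
    by (rule integrable_measure_pmf_finite[OF finD])
  have Qpos: "pmf Q (tt u) > 0" if "u \<in> A" for u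
  proof -
    have "0 < pmf kk u" using that A by (auto simp: pmf_positive_iff)
    with a1[OF that] nn have "0 < a1 * pmf Q (tt u)" by linarith
    then show ?thesis using nn by (simp add: zero_less_mult_iff)
  qed
  have qpos: "q (tt u) > 0" if "u \<in> A" for u using Qpos[OF that] K by (auto simp: q_def)
  have M: "real M \<ge> 1" using m by simp
  have p0: "p u \<ge> 0" for u by (simp add: p_def)
  have \<pi>: "\<pi> = (\<Sum>u\<in>A. p u)" unfolding \<pi>_def p_def by (rule measure_measure_pmf_finite[OF finA])
  have EII: "measure_pmf.expectation D (\<lambda>x. I u x * I u' x) =
      (if tt u = tt u' then q (tt u) else q (tt u) * q (tt u')) *
      (if yy u = yy u' then 1 / real M else 1 / real M * (1 / real M))" if "u \<in> A" "u' \<in> A" for u u'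
  proof -
    have "measure_pmf.expectation D (\<lambda>x. I u x * I u' x) =
      measure_pmf.expectation D (\<lambda>x. (\<lambda>Th. of_bool (Th (tt u)) * of_bool (Th (tt u'))) (fst x) * (\<lambda>\<beta>. of_bool
          (\<beta> (yy u) = m) * of_bool (\<beta> (yy u') = m)) (snd x))"
      by (simp add: I_def mult_ac)
    also have "\<dots> = (\<Sum>x\<in>set_pmf DT. \<Sum>y\<in>set_pmf DB. (of_bool (x (tt u)) * of_bool (x (tt u'))) * (of_bool (y
        (yy u) = m) * of_bool (y (yy u') = m)) * (pmf DT x * pmf DB y))"
      by (subst integral_measure_pmf_real[OF finD]) (auto simp: D_def pmf_pair sum.cartesian_product
          case_prod_unfold intro!: sum.cong)
    also have "\<dots> = (\<Sum>x\<in>set_pmf DT. (of_bool (x (tt u)) * of_bool (x (tt u'))) * pmf DT x) * (\<Sum>y\<in>set_pmf DB.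
        (of_bool (y (yy u) = m) * of_bool (y (yy u') = m)) * pmf DB y)"
      unfolding sum_product by (intro sum.cong refl) (simp add: mult_ac)
    also have "\<dots> = measure_pmf.expectation DT (\<lambda>Th. of_bool (Th (tt u)) * of_bool (Th (tt u'))) *
        measure_pmf.expectation DB (\<lambda>\<beta>. of_bool (\<beta> (yy u) = m) * of_bool (\<beta> (yy u') = m))"
    proof -
      have "finite (set_pmf DT)" "finite (set_pmf DB)"
        using finD unfolding D_def by (auto simp: finite_cartesian_product_iff set_pmf_not_empty)
      then show ?thesis
        by (simp add: integral_measure_pmf_real[where A = "set_pmf DT"] integral_measure_pmf_real[where A =
            "set_pmf DB"])
    qed
    also have "\<dots> = (if tt u = tt u' then q (tt u) else q (tt u) * q (tt u')) *
      (if yy u = yy u' then 1 / real M else 1 / real M * (1 / real M))"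
    proof -
      have mem: "tt u \<in> Ts" "tt u' \<in> Ts" "yy u \<in> Ys" "yy u' \<in> Ys" using that A by auto
      show ?thesis unfolding DT_def DB_def
        using expectation_incl_incl[OF fin(1) mem(1,2), of q, OF q01]
          expectation_hash_hash[OF fin(2) mem(3,4) m, of d] by simp
    qed
    finally show ?thesis .
  qed
  have EI: "measure_pmf.expectation D (I u) = q (tt u) / real M" if "u \<in> A" for u
  proof -
    have "(\<lambda>x. I u x * I u x) = I u" by (rule ext) (simp add: I_def)
    then show ?thesis using EII[OF that that] by simp
  qed
  have EN: "measure_pmf.expectation D N = \<pi>"
  proof -
    have "measure_pmf.expectation D N = (\<Sum>u\<in>A. c u * measure_pmf.expectation D (I u))"
      unfolding N_def by (subst Bochner_Integration.integral_sum) (auto intro: int)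
    also have "\<dots> = (\<Sum>u\<in>A. p u)"
    proof (intro sum.cong refl)
      fix u assume "u \<in> A"
      then show "c u * measure_pmf.expectation D (I u) = p u"
        using qpos[of u] M by (simp add: EI c_def)
    qed
    finally show ?thesis using \<pi> by simp
  qed
  define r where "r t = 1 / (K * pmf Q t)" for t
  have EN2: "measure_pmf.expectation D (\<lambda>x. (N x)\<^sup>2) = (\<Sum>u\<in>A. \<Sum>u'\<in>A. c u * c u' * measure_pmf.expectation D
      (\<lambda>x. I u x * I u' x))"
  proof -
    have "(\<lambda>x. (N x)\<^sup>2) = (\<lambda>x. \<Sum>u\<in>A. \<Sum>u'\<in>A. c u * c u' * (I u x * I u' x))"
      by (rule ext) (simp add: N_def power2_eq_square sum_product mult_ac)
    then show ?thesis
      by (simp add: Bochner_Integration.integral_sum int)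
  qed
  have tm: "c u * c u' * measure_pmf.expectation D (\<lambda>x. I u x * I u' x) \<le>
     p u * p u' + (if tt u = tt u' then p u * p u' * r (tt u) else 0) +
     (real M - 1) * (if yy u = yy u' then p u * p u' else 0) +
     (real M - 1) * (if u' = u then p u * p u * r (tt u) else 0)" if "u \<in> A" "u' \<in> A" for u u'
  proof -
    have q: "q (tt u) > 0" "q (tt u') > 0" using qpos that by auto
    have r0: "r (tt u) \<ge> 0" using K by (simp add: r_def)
    have eq: "c u * c u' * measure_pmf.expectation D (\<lambda>x. I u x * I u' x) =
       p u * p u' * ((if tt u = tt u' then 1 / q (tt u) else 1) * (if yy u = yy u' then real M else 1))"
      unfolding EII[OF that] c_def using q M by (simp add: field_simps)
    \<comment> \<open>The cap at 1 in the inclusion probability costs only an additive 1.\<close>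
    have qr: "1 / q (tt u) \<le> 1 + r (tt u)"
      using Qpos[OF that(1)] K by (auto simp: q_def r_def min_def)
    \<comment> \<open>Expanding the right-hand product gives the four summands of the claim; the
      last needs both coincidences at once, hence \<open>u' = u\<close> by
      \<open>inj\<close>.\<close>
    have "(if tt u = tt u' then 1 / q (tt u) else 1) * (if yy u = yy u' then real M else 1) \<le>
      (1 + (if tt u = tt u' then r (tt u) else 0)) * (1 + (if yy u = yy u' then real M - 1 else 0))"
      using qr M r0 by (intro mult_mono) auto
    then have "p u * p u' * ((if tt u = tt u' then 1 / q (tt u) else 1) * (if yy u = yy u' then real M else
        1)) \<le>
      p u * p u' * ((1 + (if tt u = tt u' then r (tt u) else 0)) * (1 + (if yy u = yy u' then real M - 1 else
          0)))"
      by (rule mult_left_mono) (simp add: p0)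
    also have "\<dots> = p u * p u' + (if tt u = tt u' then p u * p u' * r (tt u) else 0) +
     (real M - 1) * (if yy u = yy u' then p u * p u' else 0) +
     (real M - 1) * (if u' = u then p u * p u * r (tt u) else 0)"
    proof (cases "tt u = tt u'")
      case t: True
      show ?thesis
      proof (cases "yy u = yy u'")
        case True
        then have "u' = u" using t inj[OF that] by simp
        then show ?thesis by (simp add: algebra_simps)
      next
        case False
        then have "u' \<noteq> u" by auto
        with False t show ?thesis by (simp add: algebra_simps)
      qed
    next
      case t: False
      then have "u' \<noteq> u" by auto
      with t show ?thesis by (cases "yy u = yy u'") (simp_all add: algebra_simps)
    qed
    finally show ?thesis unfolding eq .
  qed
  have S1: "(\<Sum>u\<in>A. \<Sum>u'\<in>A. if tt u = tt u' then p u * p u' * r (tt u) else 0) \<le> a2 / K"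
  proof -
    have "(\<Sum>u\<in>A. \<Sum>u'\<in>A. if tt u = tt u' then p u * p u' * r (tt u) else 0) \<le> (\<Sum>u\<in>A. p u * (a2 / K))"
    proof (rule sum_mono)
      fix u assume u: "u \<in> A"
      have "(\<Sum>u'\<in>A. if tt u = tt u' then p u * p u' * r (tt u) else 0) = p u * r (tt u) * (\<Sum>u'\<in>{u'\<in>A. tt u' =
          tt u}. p u')"
        by (subst sum.inter_filter[OF finA], subst sum_distrib_left, intro sum.cong) auto
      also have "\<dots> \<le> p u * r (tt u) * (a2 * pmf Q (tt u))"
      proof (rule mult_left_mono)
        have "(\<Sum>u'\<in>{u'\<in>A. tt u' = tt u}. p u') = measure_pmf.prob kk {u'\<in>A. tt u' = tt u}"
          unfolding p_def using finA by (simp add: measure_measure_pmf_finite)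
        also have "\<dots> \<le> pmf (map_pmf tt kk) (tt u)"
          unfolding pmf_map by (rule measure_pmf.finite_measure_mono) auto
        also have "\<dots> \<le> a2 * pmf Q (tt u)" by (rule a2[OF u])
        finally show "(\<Sum>u'\<in>{u'\<in>A. tt u' = tt u}. p u') \<le> a2 * pmf Q (tt u)" .
      qed (use K p0 in \<open>simp add: r_def\<close>)
      also have "\<dots> = p u * (a2 / K)"
        using Qpos[OF u] K by (simp add: r_def)
      finally show "(\<Sum>u'\<in>A. if tt u = tt u' then p u * p u' * r (tt u) else 0) \<le> p u * (a2 / K)" .
    qed
    also have "\<dots> = \<pi> * (a2 / K)" by (simp only: \<pi> sum_distrib_right)
    also have "\<dots> \<le> 1 * (a2 / K)"
      using nn K by (intro mult_right_mono) (auto simp: \<pi>_def)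
    finally show ?thesis by simp
  qed
  have S2: "(\<Sum>u\<in>A. \<Sum>u'\<in>A. if yy u = yy u' then p u * p u' else 0) \<le> a3"
  proof -
    have "(\<Sum>u\<in>A. \<Sum>u'\<in>A. if yy u = yy u' then p u * p u' else 0) \<le> (\<Sum>u\<in>A. p u * a3)"
    proof (rule sum_mono)
      fix u assume u: "u \<in> A"
      have "(\<Sum>u'\<in>A. if yy u = yy u' then p u * p u' else 0) = p u * (\<Sum>u'\<in>{u'\<in>A. yy u' = yy u}. p u')"
        by (subst sum.inter_filter[OF finA], subst sum_distrib_left, intro sum.cong) auto
      also have "\<dots> \<le> p u * a3"
      proof (rule mult_left_mono)
        have "(\<Sum>u'\<in>{u'\<in>A. yy u' = yy u}. p u') = measure_pmf.prob kk {u'\<in>A. yy u' = yy u}"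
          unfolding p_def using finA by (simp add: measure_measure_pmf_finite)
        also have "\<dots> \<le> pmf (map_pmf yy kk) (yy u)"
          unfolding pmf_map by (rule measure_pmf.finite_measure_mono) auto
        also have "\<dots> \<le> a3" by (rule a3[OF u])
        finally show "(\<Sum>u'\<in>{u'\<in>A. yy u' = yy u}. p u') \<le> a3" .
      qed (simp add: p0)
      finally show "(\<Sum>u'\<in>A. if yy u = yy u' then p u * p u' else 0) \<le> p u * a3" .
    qed
    also have "\<dots> = \<pi> * a3" by (simp only: \<pi> sum_distrib_right)
    also have "\<dots> \<le> 1 * a3"
      using nn by (intro mult_right_mono) (auto simp: \<pi>_def)
    finally show ?thesis by simp
  qed
  have S3: "(\<Sum>u\<in>A. \<Sum>u'\<in>A. if u' = u then p u * p u * r (tt u) else 0) \<le> a1 / K"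
  proof -
    have "(\<Sum>u\<in>A. \<Sum>u'\<in>A. if u' = u then p u * p u * r (tt u) else 0) = (\<Sum>u\<in>A. p u * (p u * r (tt u)))"
      using finA by (simp add: mult.assoc)
    also have "\<dots> \<le> (\<Sum>u\<in>A. p u * (a1 / K))"
    proof (intro sum_mono mult_left_mono p0)
      fix u assume u: "u \<in> A"
      show "p u * r (tt u) \<le> a1 / K"
        using a1[OF u] Qpos[OF u] K by (simp add: r_def p_def field_simps)
    qed
    also have "\<dots> = \<pi> * (a1 / K)" by (simp only: \<pi> sum_distrib_right)
    also have "\<dots> \<le> 1 * (a1 / K)"
      using nn K by (intro mult_right_mono) (auto simp: \<pi>_def)
    finally show ?thesis by simp
  qed
  have var: "measure_pmf.expectation D (\<lambda>x. (N x)\<^sup>2) \<le> \<pi>\<^sup>2 + a2 / K + (real M - 1) * a3 + (real M - 1) * a1 /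
      K"
  proof -
    have "measure_pmf.expectation D (\<lambda>x. (N x)\<^sup>2) \<le> (\<Sum>u\<in>A. \<Sum>u'\<in>A. p u * p u' + (if tt u = tt u' then p u * p
        u' * r (tt u) else 0) +
     (real M - 1) * (if yy u = yy u' then p u * p u' else 0) +
     (real M - 1) * (if u' = u then p u * p u * r (tt u) else 0))"
      unfolding EN2 by (intro sum_mono tm)
    also have "\<dots> = \<pi>\<^sup>2 + (\<Sum>u\<in>A. \<Sum>u'\<in>A. if tt u = tt u' then p u * p u' * r (tt u) else 0)
      + (real M - 1) * (\<Sum>u\<in>A. \<Sum>u'\<in>A. if yy u = yy u' then p u * p u' else 0)
      + (real M - 1) * (\<Sum>u\<in>A. \<Sum>u'\<in>A. if u' = u then p u * p u * r (tt u) else 0)"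
      by (simp add: sum.distrib \<pi> power2_eq_square sum_product flip: sum_distrib_left)
    also have "\<dots> \<le> \<pi>\<^sup>2 + a2 / K + (real M - 1) * a3 + (real M - 1) * (a1 / K)"
      using S1 S2 S3 M by (intro add_mono mult_left_mono) auto
    finally show ?thesis by simp
  qed
  define E where "E = {(Th, \<beta>). \<not> (\<exists>u\<in>A. Th (tt u) \<and> \<beta> (yy u) = m)}"
  have "\<pi>\<^sup>2 * measure_pmf.prob D E = measure_pmf.expectation D (\<lambda>x. \<pi>\<^sup>2 * indicator E x)"
    by simp
  also have "\<dots> \<le> measure_pmf.expectation D (\<lambda>x. (N x - \<pi>)\<^sup>2)"
  proof (rule integral_mono[OF int int])
    fix x
    show "\<pi>\<^sup>2 * indicator E x \<le> (N x - \<pi>)\<^sup>2"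
    proof (cases "x \<in> E")
      case True
      then have "N x = 0" unfolding N_def E_def I_def by (auto intro!: sum.neutral)
      with True show ?thesis by simp
    qed simp
  qed
  also have "\<dots> = measure_pmf.expectation D (\<lambda>x. (N x)\<^sup>2 - 2 * \<pi> * N x + \<pi>\<^sup>2)"
    by (simp add: power2_diff algebra_simps)
  also have "\<dots> = measure_pmf.expectation D (\<lambda>x. (N x)\<^sup>2) - 2 * \<pi> * \<pi> + \<pi>\<^sup>2"
    by (simp add: int EN)
  also have "\<dots> \<le> a2 / K + (real M - 1) * a3 + (real M - 1) * a1 / K"
    using var by (simp add: power2_eq_square)
  finally show ?thesis
    unfolding \<pi>_def D_def DT_def DB_def E_def q_def .
qed

section \<open>The one-shot random code\<close>

text \<open>The least element of a fixed enumeration rather than an arbitrary choice: removing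
  candidates that were not chosen must leave the choice unchanged.\<close>

definition pick :: "'a::countable set \<Rightarrow> 'a" where
  "pick C = from_nat (LEAST n. n \<in> to_nat ` C)"

lemma pick_in:
  assumes "C \<noteq> {}"
  shows "pick C \<in> C"
proof -
  have "(LEAST n. n \<in> to_nat ` C) \<in> to_nat ` C"
    by (rule LeastI_ex) (use assms in auto)
  then show ?thesis unfolding pick_def by auto
qed

lemma pick_subset:
  assumes "C' \<subseteq> C" "pick C \<in> C'"
  shows "pick C' = pick C"
proof -
  let ?n = "LEAST n. n \<in> to_nat ` C"
  have "?n \<in> to_nat ` C"
    by (rule LeastI_ex) (use assms in auto)
  then obtain c :: 'a where c: "?n = to_nat c" by blast
  then have n: "?n = to_nat (pick C)" unfolding pick_def c by simp
  have "(LEAST n. n \<in> to_nat ` C') = ?n"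
  proof (rule Least_equality)
    show "?n \<in> to_nat ` C'" unfolding n using assms(2) by (rule imageI)
    show "?n \<le> m" if "m \<in> to_nat ` C'" for m
      by (rule Least_le) (use that assms(1) in auto)
  qed
  then show ?thesis unfolding pick_def by simp
qed

lemma ennreal_convex_split:
  assumes "0 \<le> r" "r \<le> 1"
  shows "x * ennreal r + x * ennreal (1 - r) = x"
proof -
  have "ennreal r + ennreal (1 - r) = ennreal (r + (1 - r))"
    by (rule ennreal_plus[symmetric]) (use assms in auto)
  then have eq: "ennreal r + ennreal (1 - r) = 1" by simp
  have "x * ennreal r + x * ennreal (1 - r) = x * (ennreal r + ennreal (1 - r))"
    by (rule distrib_left[symmetric])
  then show ?thesis unfolding eq by simp
qed

text \<open>
  All symbols stand for whole blocks. The pair of interference and output of receiver 1 is \<open>u\<close>, with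
  components \<open>tt u\<close> and \<open>yy u\<close>; \<open>f\<close> is the output map of receiver 2 and \<open>z\<close> the cribbing map. The set of
  admissible interference sequences, given \<open>w\<close>, has about \<open>K\<close> elements; there are \<open>L\<close> auxiliary codewords.
  The numbers \<open>a\<^sub>i\<close> and \<open>b\<^sub>i\<close> are the likelihood thresholds of the typical sets.
\<close>

locale one_shot =
  fixes pW :: "'w pmf" and pS :: "'s pmf" and k :: "'w \<Rightarrow> 's \<Rightarrow> ('u::countable) pmf"
    and p2 :: "'w \<Rightarrow> 'x pmf" and tt :: "'u \<Rightarrow> 't" and yy :: "'u \<Rightarrow> 'y"
    and f :: "'x \<Rightarrow> 't \<Rightarrow> 'v" and z :: "'x \<Rightarrow> 'z"
    and Ts :: "'t set" and Ys :: "'y set" and Zs :: "'z set"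
    and K a1 a2 a3 a5 a6 a7 a8 b0 b1 \<eta> :: real and L M1 M2 :: nat
  assumes fin: "finite Ts" "finite Ys" "finite Zs" "\<And>w s. finite (set_pmf (k w s))"
    and Ts: "\<And>w s u. w \<in> set_pmf pW \<Longrightarrow> s \<in> set_pmf pS \<Longrightarrow> u \<in> set_pmf (k w s) \<Longrightarrow> tt u \<in> Ts"
    and Ys: "\<And>w s u. w \<in> set_pmf pW \<Longrightarrow> s \<in> set_pmf pS \<Longrightarrow> u \<in> set_pmf (k w s) \<Longrightarrow> yy u \<in> Ys"
    and Zs: "\<And>w x. w \<in> set_pmf pW \<Longrightarrow> x \<in> set_pmf (p2 w) \<Longrightarrow> z x \<in> Zs"
    and inj: "\<And>w s u u'. w \<in> set_pmf pW \<Longrightarrow> s \<in> set_pmf pS \<Longrightarrow> u \<in> set_pmf (k w s) \<Longrightarrow> u' \<in> set_pmf (k w s)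
      \<Longrightarrow> tt u = tt u' \<Longrightarrow> yy u = yy u' \<Longrightarrow> u = u'"
    and pos: "0 < K" "0 < b0" "0 < b1" "0 < \<eta>"
    and nn: "0 \<le> a1" "0 \<le> a2" "0 \<le> a3" "0 \<le> a5" "0 \<le> a6" "0 \<le> a7" "0 \<le> a8"
    and Lpos: "0 < L"
begin

definition Q :: "'w \<Rightarrow> 't pmf" where
  "Q w = bind_pmf pS (\<lambda>s. map_pmf tt (k w s))"
definition PYt :: "'w \<Rightarrow> 't \<Rightarrow> 'v pmf" where
  "PYt w t = map_pmf (\<lambda>x. f x t) (p2 w)"
definition PYZt :: "'w \<Rightarrow> 't \<Rightarrow> ('v \<times> 'z) pmf" where
  "PYZt w t = map_pmf (\<lambda>x. (f x t, z x)) (p2 w)"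
definition PY :: "'w \<Rightarrow> 'v pmf" where
  "PY w = bind_pmf (Q w) (PYt w)"
definition PYZ :: "'w \<Rightarrow> ('v \<times> 'z) pmf" where
  "PYZ w = bind_pmf (Q w) (PYZt w)"
definition PV :: "'v pmf" where
  "PV = bind_pmf pW PY"

text \<open>Three one-sided likelihood bounds, exactly those that the second moment bound consumes,
  in place of a notion of typical sequence.\<close>

definition typ1 :: "'w \<Rightarrow> 's \<Rightarrow> 'u \<Rightarrow> bool" where
  "typ1 w s u \<longleftrightarrow> pmf (k w s) u \<le> a1 * pmf (Q w) (tt u) \<and>
     pmf (map_pmf tt (k w s)) (tt u) \<le> a2 * pmf (Q w) (tt u) \<and>
     pmf (map_pmf yy (k w s)) (yy u) \<le> a3"

text \<open>The lower bounds let the true index pass both link tests; the upper bounds limit how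
  likely a wrong message is to explain the output. Positivity allows division by \<open>PV\<close>
  in the bound for a wrong index.\<close>

definition typ2 :: "'w \<Rightarrow> 't \<Rightarrow> 'x \<Rightarrow> bool" where
  "typ2 w t x \<longleftrightarrow> 0 < pmf PV (f x t) \<and> b0 * pmf PV (f x t) \<le> pmf (PY w) (f x t) \<and>
     b1 * pmf PV (f x t) \<le> pmf (PYt w t) (f x t) \<and>
     pmf (PY w) (f x t) \<le> a5 \<and> pmf (PYZ w) (f x t, z x) \<le> a6 \<and>
     pmf (PYZt w t) (f x t, z x) \<le> a7 \<and> pmf (PYt w t) (f x t) \<le> a8"

text \<open>Encoder 1 does not know \<open>x\<close> when it selects \<open>u\<close>. So the second
  condition asks that the interference be typical with all inputs of encoder 2 up to probability
  \<eta>.\<close>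

definition A :: "'w \<Rightarrow> 's \<Rightarrow> 'u set" where
  "A w s = {u \<in> set_pmf (k w s). typ1 w s u \<and> measure_pmf.prob (p2 w) {x. \<not> typ2 w (tt u) x} \<le> \<eta>}"

definition q :: "'w \<Rightarrow> 't \<Rightarrow> real" where
  "q w t = min 1 (K * pmf (Q w) t)"

definition cand :: "'w \<Rightarrow> 's \<Rightarrow> ('y \<Rightarrow> nat) \<Rightarrow> ('t \<Rightarrow> bool) \<Rightarrow> nat \<Rightarrow> 'u set" where
  "cand w s \<beta> Th m1 = {u \<in> A w s. Th (tt u) \<and> \<beta> (yy u) = m1}"

text \<open>Each half limits a wrong index by its own mechanism: the first by the likelihood ratio
  of \<open>w\<close> alone, the second by that of some included \<open>t\<close>, of which there
  are about \<open>K\<close>. Demanding both yields the smaller of the two bounds.\<close>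

definition pass :: "'w \<Rightarrow> ('t \<Rightarrow> bool) \<Rightarrow> 'v \<Rightarrow> bool" where
  "pass w Th v \<longleftrightarrow> b0 * pmf PV v \<le> pmf (PY w) v \<and> (\<exists>t. Th t \<and> b1 * pmf PV v \<le> pmf (PYt w t) v)"

definition incl_pmf :: "'w \<Rightarrow> ('t \<Rightarrow> bool) pmf" where
  "incl_pmf w = Pi_pmf Ts False (\<lambda>t. bernoulli_pmf (q w t))"

definition book_pmf :: "('w \<times> ('t \<Rightarrow> bool) \<times> (nat \<Rightarrow> 'x)) pmf" where
  "book_pmf = bind_pmf pW (\<lambda>w. bind_pmf (incl_pmf w) (\<lambda>Th.
     map_pmf (\<lambda>X. (w, Th, X)) (Pi_pmf {..<M2} undefined (\<lambda>_. p2 w))))"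

definition ybin_pmf :: "('y \<Rightarrow> nat) pmf" where
  "ybin_pmf = Pi_pmf Ys 0 (\<lambda>_. pmf_of_set {..<M1})"

definition zbin_pmf :: "('z \<Rightarrow> nat) pmf" where
  "zbin_pmf = Pi_pmf Zs 0 (\<lambda>_. pmf_of_set {..<L})"

definition code_pmf :: "(('y \<Rightarrow> nat) \<times> ('z \<Rightarrow> nat) \<times> (nat \<Rightarrow> 'w \<times> ('t \<Rightarrow> bool) \<times> (nat \<Rightarrow> 'x))) pmf" where
  "code_pmf = pair_pmf ybin_pmf (pair_pmf zbin_pmf (Pi_pmf {..<L} undefined (\<lambda>_. book_pmf)))"

text \<open>Sufficient conditions for all decoders to be right, stated as uniqueness so that the
  probabilistic analysis never has to name a decoder.\<close>

fun good :: "(('y \<Rightarrow> nat) \<times> ('z \<Rightarrow> nat) \<times> (nat \<Rightarrow> 'w \<times> ('t \<Rightarrow> bool) \<times> (nat \<Rightarrow> 'x))) \<Rightarrow>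
    nat \<Rightarrow> nat \<Rightarrow> nat \<Rightarrow> 's \<Rightarrow> bool" where
  "good (\<beta>, \<gamma>, cb) l m1 m2 s \<longleftrightarrow> (case cb l of (w, Th, X) \<Rightarrow>
     let C = cand w s \<beta> Th m1; t = tt (pick C); v = f (X m2) t in
     C \<noteq> {} \<and> typ2 w t (X m2) \<and>
     (\<forall>l'<L. l' \<noteq> l \<longrightarrow> \<not> (case cb l' of (w', Th', X') \<Rightarrow> pass w' Th' v)) \<and>
     (\<forall>m2'<M2. m2' \<noteq> m2 \<longrightarrow> \<not> (\<gamma> (z (X m2')) = \<gamma> (z (X m2)) \<and> (\<exists>t'. Th t' \<and> f (X m2') t' = v))))"

lemma q01: "0 \<le> q w t" "q w t \<le> 1"
  using pos by (auto simp: q_def)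

lemma set_Q: "w \<in> set_pmf pW \<Longrightarrow> set_pmf (Q w) \<subseteq> Ts"
  unfolding Q_def using Ts by auto

lemma A_subset: "A w s \<subseteq> set_pmf (k w s)"
  by (auto simp: A_def)

lemma finite_A: "finite (A w s)"
  by (rule finite_subset[OF A_subset fin(4)])

lemma incl_in_Ts: "Th \<in> set_pmf (incl_pmf w) \<Longrightarrow> Th t \<Longrightarrow> t \<in> Ts"
  using set_Pi_pmf_subset[OF fin(1)] unfolding incl_pmf_def by fastforce

lemma nn_integral_incl:
  assumes "t \<in> Ts"
  shows "(\<integral>\<^sup>+Th. of_bool (Th t) \<partial>measure_pmf (incl_pmf w)) = ennreal (q w t)"
  unfolding incl_pmf_def
  by (subst nn_integral_Pi_pmf_component[OF fin(1) assms, where F = of_bool]) (simp add: q01)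

text \<open>Inclusion probabilities are at most \<open>K\<close> times \<open>Q\<close>. So a union
  bound over the random set costs \<open>K\<close> times an average under the true law of the
  interference.\<close>

lemma sum_q_le:
  assumes "w \<in> set_pmf pW"
  shows "(\<Sum>t\<in>Ts. ennreal (q w t) * F t) \<le> ennreal K * (\<integral>\<^sup>+t. F t \<partial>measure_pmf (Q w))"
proof -
  have "(\<Sum>t\<in>Ts. ennreal (q w t) * F t) \<le> (\<Sum>t\<in>Ts. ennreal K * (F t * ennreal (pmf (Q w) t)))"
  proof (rule sum_mono)
    fix t
    have "ennreal (q w t) \<le> ennreal K * ennreal (pmf (Q w) t)"
    proof -
      have "ennreal (q w t) \<le> ennreal (K * pmf (Q w) t)" by (rule ennreal_leI) (simp add: q_def)
      then show ?thesis using pos by (simp add: ennreal_mult)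
    qed
    then have "ennreal (q w t) * F t \<le> (ennreal K * ennreal (pmf (Q w) t)) * F t"
      by (rule mult_right_mono) simp
    then show "ennreal (q w t) * F t \<le> ennreal K * (F t * ennreal (pmf (Q w) t))"
      by (simp add: mult_ac)
  qed
  also have "\<dots> = ennreal K * (\<integral>\<^sup>+t. F t \<partial>measure_pmf (Q w))"
    by (subst nn_integral_measure_pmf_support[OF fin(1)])
      (use set_Q[OF assms] in \<open>auto simp: sum_distrib_left set_pmf_iff\<close>)
  finally show ?thesis .
qed

lemma nn_integral_book:
  "(\<integral>\<^sup>+c. F c \<partial>measure_pmf book_pmf) =
   (\<integral>\<^sup>+w. \<integral>\<^sup>+Th. \<integral>\<^sup>+X. F (w, Th, X) \<partial>measure_pmf (Pi_pmf {..<M2} undefined (\<lambda>_. p2 w)) \<partial>measure_pmf (incl_pmf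
       w) \<partial>measure_pmf pW)"
  unfolding book_pmf_def by simp

text \<open>Markov's inequality for a likelihood ratio: averaging \<open>PY\<close> over
  \<open>w\<close> gives \<open>PV\<close>, so the ratio has mean 1. For the second bound a union
  over the included \<open>t\<close> precedes the averaging and costs the factor
  \<open>K\<close>.\<close>

lemma pass_bound:
  assumes v: "0 < pmf PV v"
  shows "(\<integral>\<^sup>+c. of_bool (case c of (w, Th, X) \<Rightarrow> pass w Th v) \<partial>measure_pmf book_pmf) \<le> ennreal (min (1 / b0)
      (K / b1))"
proof -
  have le: "of_bool (b * r \<le> (x::real)) \<le> ennreal (1 / (b * r)) * ennreal x" if "0 < b" "0 < r" "0 \<le> x" for b
      r x
  proof (cases "b * r \<le> x")
    case True
    then have "1 \<le> 1 / (b * r) * x" using that by (simp add: field_simps)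
    then have "ennreal 1 \<le> ennreal (1 / (b * r) * x)" by (rule ennreal_leI)
    also have "\<dots> = ennreal (1 / (b * r)) * ennreal x"
      by (rule ennreal_mult) (use that in auto)
    finally show ?thesis using True by simp
  qed simp
  have hPV: "(\<integral>\<^sup>+w. ennreal (pmf (PY w) v) \<partial>measure_pmf pW) = ennreal (pmf PV v)"
    unfolding PV_def by (rule ennreal_pmf_bind[symmetric])
  have hPY: "(\<integral>\<^sup>+t. ennreal (pmf (PYt w t) v) \<partial>measure_pmf (Q w)) = ennreal (pmf (PY w) v)" for w
    unfolding PY_def by (rule ennreal_pmf_bind[symmetric])
  let ?I = "\<integral>\<^sup>+w. \<integral>\<^sup>+Th. of_bool (pass w Th v) \<partial>measure_pmf (incl_pmf w) \<partial>measure_pmf pW"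
  have eq: "(\<integral>\<^sup>+c. of_bool (case c of (w, Th, X) \<Rightarrow> pass w Th v) \<partial>measure_pmf book_pmf) = ?I"
    by (simp add: nn_integral_book)
  have "?I \<le> (\<integral>\<^sup>+w. ennreal (1 / (b0 * pmf PV v)) * ennreal (pmf (PY w) v) \<partial>measure_pmf pW)"
  proof (intro nn_integral_pmf_mono nn_integral_pmf_le)
    fix w Th
    have "(of_bool (pass w Th v) :: ennreal) \<le> of_bool (b0 * pmf PV v \<le> pmf (PY w) v)"
      by (simp add: pass_def of_bool_def)
    also have "\<dots> \<le> ennreal (1 / (b0 * pmf PV v)) * ennreal (pmf (PY w) v)"
      by (rule le) (use v pos in auto)
    finally show "(of_bool (pass w Th v) :: ennreal) \<le> \<dots>" .
  qed
  also have "\<dots> = ennreal (1 / (b0 * pmf PV v)) * ennreal (pmf PV v)"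
    by (simp add: nn_integral_cmult hPV)
  also have "\<dots> = ennreal (1 / b0)"
    using v pos by (subst ennreal_mult[symmetric]) auto
  finally have 1: "?I \<le> ennreal (1 / b0)" .
  have "?I \<le> (\<integral>\<^sup>+w. ennreal (K * (1 / (b1 * pmf PV v))) * ennreal (pmf (PY w) v) \<partial>measure_pmf pW)"
  proof (intro nn_integral_pmf_mono)
    fix w assume w: "w \<in> set_pmf pW"
    let ?g = "\<lambda>t. ennreal (1 / (b1 * pmf PV v)) * ennreal (pmf (PYt w t) v)"
    have "(\<integral>\<^sup>+Th. of_bool (pass w Th v) \<partial>measure_pmf (incl_pmf w)) \<le>
      (\<integral>\<^sup>+Th. (\<Sum>t\<in>Ts. of_bool (Th t) * ?g t) \<partial>measure_pmf (incl_pmf w))"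
    proof (intro nn_integral_pmf_mono)
      fix Th assume Th: "Th \<in> set_pmf (incl_pmf w)"
      show "of_bool (pass w Th v) \<le> (\<Sum>t\<in>Ts. of_bool (Th t) * ?g t)"
      proof (cases "pass w Th v")
        case True
        then obtain t where t: "Th t" "b1 * pmf PV v \<le> pmf (PYt w t) v" by (auto simp: pass_def)
        have "of_bool (pass w Th v) \<le> of_bool (Th t) * ?g t"
          using le[of b1 "pmf PV v" "pmf (PYt w t) v"] t pos v by simp
        also have "\<dots> \<le> (\<Sum>t\<in>Ts. of_bool (Th t) * ?g t)"
          by (rule member_le_sum) (use incl_in_Ts[OF Th t(1)] fin in auto)
        finally show ?thesis .
      qed simp
    qed
    also have "\<dots> = (\<Sum>t\<in>Ts. ennreal (q w t) * ?g t)"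
      by (simp add: nn_integral_sum nn_integral_multc nn_integral_incl)
    also have "\<dots> \<le> ennreal K * (\<integral>\<^sup>+t. ?g t \<partial>measure_pmf (Q w))"
      by (rule sum_q_le[OF w])
    also have "\<dots> = ennreal K * (ennreal (1 / (b1 * pmf PV v)) * ennreal (pmf (PY w) v))"
      by (simp add: nn_integral_cmult hPY)
    also have "\<dots> = ennreal (K * (1 / (b1 * pmf PV v))) * ennreal (pmf (PY w) v)"
      using pos by (subst ennreal_mult'[of K]) (auto simp: mult.assoc)
    finally show "(\<integral>\<^sup>+Th. of_bool (pass w Th v) \<partial>measure_pmf (incl_pmf w)) \<le> \<dots>" .
  qed
  also have "\<dots> = ennreal (K * (1 / (b1 * pmf PV v))) * ennreal (pmf PV v)"
    by (simp add: nn_integral_cmult hPV)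
  also have "\<dots> = ennreal (K / b1)"
    using v pos by (subst ennreal_mult[symmetric]) auto
  finally have 2: "?I \<le> ennreal (K / b1)" .
  show ?thesis unfolding eq using 1 2 by (simp add: min_def)
qed

definition selects :: "'w \<Rightarrow> 's \<Rightarrow> ('y \<Rightarrow> nat) \<Rightarrow> nat \<Rightarrow> 'u \<Rightarrow> ('t \<Rightarrow> bool) \<Rightarrow> bool" where
  "selects w s \<beta> m1 u Th \<longleftrightarrow> cand w s \<beta> Th m1 \<noteq> {} \<and> pick (cand w s \<beta> Th m1) = u"

lemma selects_in_A: "selects w s \<beta> m1 u Th \<Longrightarrow> u \<in> A w s"
  using pick_in[of "cand w s \<beta> Th m1"] by (auto simp: selects_def cand_def)

text \<open>
  Choosing the first candidate in a fixed order makes the inclusion of any other \<open>t'\<close> negatively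
  correlated with the choice, since removing an unchosen candidate does not change the choice.
\<close>

lemma selects_negative_correlation:
  assumes t': "t' \<in> Ts" "t' \<noteq> tt u"
  shows "(\<integral>\<^sup>+Th. of_bool (selects w s \<beta> m1 u Th) * of_bool (Th t') \<partial>measure_pmf (incl_pmf w)) \<le>
    ennreal (q w t') * (\<integral>\<^sup>+Th. of_bool (selects w s \<beta> m1 u Th) \<partial>measure_pmf (incl_pmf w))"
proof -
  let ?D = "Pi_pmf (Ts - {t'}) False (\<lambda>t. bernoulli_pmf (q w t))"
  have D: "incl_pmf w = map_pmf (\<lambda>(b, g). g(t' := b)) (pair_pmf (bernoulli_pmf (q w t')) ?D)"
    unfolding incl_pmf_def
    using Pi_pmf_insert[of "Ts - {t'}" t' False] fin t' by (simp add: insert_absorb)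
  let ?e = "\<lambda>Th. of_bool (selects w s \<beta> m1 u Th) :: ennreal"
  let ?T = "\<integral>\<^sup>+g. ?e (g(t' := True)) \<partial>measure_pmf ?D"
  let ?F = "\<integral>\<^sup>+g. ?e (g(t' := False)) \<partial>measure_pmf ?D"
  have mono: "selects w s \<beta> m1 u (g(t' := False))" if "selects w s \<beta> m1 u (g(t' := True))" for g
  proof -
    let ?C = "\<lambda>b. cand w s \<beta> (g(t' := b)) m1"
    have C: "?C True \<noteq> {}" "pick (?C True) = u" using that by (auto simp: selects_def)
    then have "u \<in> ?C True" using pick_in by blast
    then have u: "u \<in> ?C False" using t' by (auto simp: cand_def)
    have "?C False \<subseteq> ?C True" by (auto simp: cand_def split: if_splits)
    then have "pick (?C False) = u" using pick_subset[of "?C False" "?C True"] u C by simp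
    with u show ?thesis by (auto simp: selects_def)
  qed
  have TF: "?T \<le> ?F"
    by (intro nn_integral_pmf_mono) (use mono in \<open>simp add: of_bool_def\<close>)
  have "(\<integral>\<^sup>+Th. ?e Th * of_bool (Th t') \<partial>measure_pmf (incl_pmf w)) = ?T * ennreal (q w t')"
    unfolding D by (simp add: nn_integral_pair_pmf' case_prod_unfold q01)
  also have "\<dots> = ennreal (q w t') * (?T * ennreal (q w t') + ?T * ennreal (1 - q w t'))"
    unfolding ennreal_convex_split[OF q01] by (rule mult.commute)
  also have "\<dots> \<le> ennreal (q w t') * (?T * ennreal (q w t') + ?F * ennreal (1 - q w t'))"
    by (intro mult_left_mono add_mono mult_right_mono TF) auto
  also have "\<dots> = ennreal (q w t') * (\<integral>\<^sup>+Th. ?e Th \<partial>measure_pmf (incl_pmf w))"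
    unfolding D by (simp add: nn_integral_pair_pmf' case_prod_unfold q01)
  finally show ?thesis .
qed

lemma zbin_collision:
  assumes "a \<in> Zs" "b \<in> Zs"
  shows "(\<integral>\<^sup>+\<gamma>. of_bool (\<gamma> a = \<gamma> b) \<partial>measure_pmf zbin_pmf) \<le> of_bool (a = b) + ennreal (1 / real L)"
proof (cases "a = b")
  case False
  have "(\<integral>\<^sup>+\<gamma>. of_bool (\<gamma> a = \<gamma> b) \<partial>measure_pmf zbin_pmf) =
    (\<integral>\<^sup>+i. \<integral>\<^sup>+j. of_bool (i = j) \<partial>measure_pmf (pmf_of_set {..<L}) \<partial>measure_pmf (pmf_of_set {..<L}))"
    unfolding zbin_pmf_def
    by (rule nn_integral_Pi_pmf_component2[OF fin(3) assms False, where F = "\<lambda>i j. of_bool (i = j)"])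
  also have "\<dots> \<le> ennreal (1 / real L)"
  proof (rule nn_integral_pmf_le)
    fix i assume "i \<in> set_pmf (pmf_of_set {..<L})"
    then have i: "{j. i = j} = {i}" "i < L" using Lpos by (auto simp: lessThan_empty_iff)
    have "(\<integral>\<^sup>+j. of_bool (i = j) \<partial>measure_pmf (pmf_of_set {..<L})) = emeasure (measure_pmf (pmf_of_set
        {..<L})) {j. i = j}"
      by (rule emeasure_of_bool[symmetric])
    also have "\<dots> = ennreal (1 / real L)"
      unfolding i(1) emeasure_pmf_single using Lpos i by (simp add: lessThan_empty_iff)
    finally show "(\<integral>\<^sup>+j. of_bool (i = j) \<partial>measure_pmf (pmf_of_set {..<L})) \<le> ennreal (1 / real L)" by simp
  qed
  finally show ?thesis using False by simp
qed simp

end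

section \<open>The error events of the random code\<close>

context one_shot
begin

text \<open>The second moment bound divides by the squared probability of \<open>A\<close>. If that
  probability is at least one half, this is the factor 4; otherwise \<open>A\<close> is missed with
  probability above one half, and twice that already exceeds 1.\<close>

lemma no_cand_bound:
  assumes w: "w \<in> set_pmf pW" and s: "s \<in> set_pmf pS" and m1: "m1 < M1"
  shows "(\<integral>\<^sup>+\<beta>. \<integral>\<^sup>+Th. of_bool (cand w s \<beta> Th m1 = {}) \<partial>measure_pmf (incl_pmf w) \<partial>measure_pmf ybin_pmf) \<le>
    ennreal (4 * (a2 / K + (real M1 - 1) * a3 + (real M1 - 1) * a1 / K)) +
    2 * (\<integral>\<^sup>+u. of_bool (u \<notin> A w s) \<partial>measure_pmf (k w s))"
    (is "?lhs \<le> ennreal (4 * ?V) + 2 * ?R")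
proof -
  let ?E = "{(Th, \<beta>). \<not> (\<exists>u\<in>A w s. Th (tt u) \<and> \<beta> (yy u) = m1)}"
  let ?\<pi> = "measure_pmf.prob (k w s) (A w s)"
  have "?lhs = (\<integral>\<^sup>+Th. \<integral>\<^sup>+\<beta>. of_bool (cand w s \<beta> Th m1 = {}) \<partial>measure_pmf ybin_pmf \<partial>measure_pmf (incl_pmf w))"
    by (rule nn_integral_pmf_commute)
  also have "\<dots> = (\<integral>\<^sup>+x. of_bool (x \<in> ?E) \<partial>measure_pmf (pair_pmf (incl_pmf w) ybin_pmf))"
    unfolding nn_integral_pair_pmf' by (intro nn_integral_cong) (auto simp: cand_def)
  also have "\<dots> = emeasure (measure_pmf (pair_pmf (incl_pmf w) ybin_pmf)) {x. x \<in> ?E}"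
    by (rule emeasure_of_bool[symmetric])
  also have "\<dots> = ennreal (measure_pmf.prob (pair_pmf (incl_pmf w) ybin_pmf) ?E)"
    by (simp add: measure_pmf.emeasure_eq_measure)
  finally have eq: "?lhs = ennreal (measure_pmf.prob (pair_pmf (incl_pmf w) ybin_pmf) ?E)" .
  have V: "?\<pi>\<^sup>2 * measure_pmf.prob (pair_pmf (incl_pmf w) ybin_pmf) ?E \<le> ?V"
    unfolding incl_pmf_def ybin_pmf_def q_def
  proof (rule covering_second_moment[OF fin(1,2) fin(4) A_subset])
    show "tt ` A w s \<subseteq> Ts" "yy ` A w s \<subseteq> Ys" using A_subset[of w s] Ts[OF w s] Ys[OF w s] by blast+
    show "u = u'" if "u \<in> A w s" "u' \<in> A w s" "tt u = tt u'" "yy u = yy u'" for u u'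
      using inj[OF w s, of u u'] that A_subset by blast
  qed (use pos nn m1 in \<open>auto simp: A_def typ1_def\<close>)
  show ?thesis
  proof (cases "?\<pi> \<ge> 1 / 2")
    case True
    then have "(1 / 2)\<^sup>2 \<le> ?\<pi>\<^sup>2" by (intro power_mono) auto
    then have "1 / 4 * measure_pmf.prob (pair_pmf (incl_pmf w) ybin_pmf) ?E \<le> ?\<pi>\<^sup>2 * measure_pmf.prob
        (pair_pmf (incl_pmf w) ybin_pmf) ?E"
      by (intro mult_right_mono) (auto simp: power2_eq_square)
    from order_trans[OF this V] have "measure_pmf.prob (pair_pmf (incl_pmf w) ybin_pmf) ?E \<le> 4 * ?V"
    proof -
      have "p \<le> 4 * v" if "1 / 4 * p \<le> v" for p v :: real using that by simp
      then show ?thesis using \<open>1 / 4 * _ \<le> ?V\<close> by blast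
    qed
    then have "?lhs \<le> ennreal (4 * ?V)" unfolding eq by (rule ennreal_leI)
    then show ?thesis by (rule order_trans) simp
  next
    case False
    have "?R = emeasure (measure_pmf (k w s)) {u. u \<notin> A w s}"
      by (rule emeasure_of_bool[symmetric])
    also have "\<dots> = ennreal (measure_pmf.prob (k w s) (- A w s))"
      by (simp add: measure_pmf.emeasure_eq_measure Compl_eq)
    also have "measure_pmf.prob (k w s) (- A w s) = 1 - ?\<pi>"
      using measure_pmf.prob_compl[of "A w s" "k w s"] by (simp add: Compl_eq_Diff_UNIV)
    finally have R: "?R = ennreal (1 - ?\<pi>)" .
    have "?lhs \<le> ennreal 1" unfolding eq by (rule ennreal_leI) simp
    also have "\<dots> \<le> ennreal (2 * (1 - ?\<pi>))" using False by (intro ennreal_leI) simp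
    also have "\<dots> = 2 * ?R" unfolding R by (subst ennreal_mult) auto
    finally show ?thesis by (rule order_trans) simp
  qed
qed

text \<open>Markov's inequality at level \<eta> for the conditional probability of an untypical
  \<open>x\<close>.\<close>

lemma not_A_bound:
  "(\<integral>\<^sup>+u. of_bool (u \<notin> A w s) \<partial>measure_pmf (k w s)) \<le>
   (\<integral>\<^sup>+u. of_bool (\<not> typ1 w s u) \<partial>measure_pmf (k w s)) +
   ennreal (1 / \<eta>) * (\<integral>\<^sup>+u. \<integral>\<^sup>+x. of_bool (\<not> typ2 w (tt u) x) \<partial>measure_pmf (p2 w) \<partial>measure_pmf (k w s))"
proof -
  have "(\<integral>\<^sup>+u. of_bool (u \<notin> A w s) \<partial>measure_pmf (k w s)) \<le>
    (\<integral>\<^sup>+u. of_bool (\<not> typ1 w s u) + ennreal (1 / \<eta>) * (\<integral>\<^sup>+x. of_bool (\<not> typ2 w (tt u) x) \<partial>measure_pmf (p2 w))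
        \<partial>measure_pmf (k w s))"
  proof (rule nn_integral_pmf_mono)
    fix u assume u: "u \<in> set_pmf (k w s)"
    let ?p = "measure_pmf.prob (p2 w) {x. \<not> typ2 w (tt u) x}"
    have I: "(\<integral>\<^sup>+x. of_bool (\<not> typ2 w (tt u) x) \<partial>measure_pmf (p2 w)) = ennreal ?p"
      unfolding emeasure_of_bool[symmetric] by (simp add: measure_pmf.emeasure_eq_measure)
    have M: "(of_bool (\<not> ?p \<le> \<eta>) :: ennreal) \<le> ennreal (1 / \<eta>) * ennreal ?p"
    proof (cases "?p \<le> \<eta>")
      case False
      then have "ennreal 1 \<le> ennreal (1 / \<eta> * ?p)" using pos by (intro ennreal_leI) (simp add: field_simps)
      also have "\<dots> = ennreal (1 / \<eta>) * ennreal ?p" by (rule ennreal_mult) (use pos in auto)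
      finally show ?thesis using False by simp
    qed simp
    have "(of_bool (u \<notin> A w s) :: ennreal) \<le> of_bool (\<not> typ1 w s u) + of_bool (\<not> ?p \<le> \<eta>)"
      using u by (auto simp: A_def of_bool_def)
    also have "\<dots> \<le> of_bool (\<not> typ1 w s u) + ennreal (1 / \<eta>) * ennreal ?p"
      by (rule add_left_mono[OF M])
    finally show "of_bool (u \<notin> A w s) \<le> of_bool (\<not> typ1 w s u) + ennreal (1 / \<eta>) * (\<integral>\<^sup>+x. of_bool (\<not> typ2 w
        (tt u) x) \<partial>measure_pmf (p2 w))"
      unfolding I .
  qed
  also have "\<dots> = (\<integral>\<^sup>+u. of_bool (\<not> typ1 w s u) \<partial>measure_pmf (k w s)) +
   ennreal (1 / \<eta>) * (\<integral>\<^sup>+u. \<integral>\<^sup>+x. of_bool (\<not> typ2 w (tt u) x) \<partial>measure_pmf (p2 w) \<partial>measure_pmf (k w s))"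
    by (subst nn_integral_add) (simp_all add: nn_integral_cmult)
  finally show ?thesis .
qed

text \<open>Four ways for one wrong message to survive: through the chosen interference
  (\<open>a7\<close>, \<open>a8\<close>) or through another included one (\<open>a6\<close>,
  \<open>a5\<close>), and with the same cribbed sequence or with a different one of equal hash, the
  latter at the price \<open>1 / L\<close>.\<close>

definition c4 :: real where
  "c4 = (a7 + a8 / real L) + K * (a6 + a5 / real L)"

lemma c4_nonneg: "0 \<le> c4"
  using nn pos by (simp add: c4_def)

lemma nn_integral_Pair_map:
  "(\<integral>\<^sup>+x. of_bool (g x = v) \<partial>measure_pmf p) = ennreal (pmf (map_pmf g p) v)"
  unfolding emeasure_of_bool[symmetric] pmf_map measure_pmf.emeasure_eq_measure[symmetric]
  by (simp add: vimage_def)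

text \<open>The interference \<open>t\<close> counts with weight 1, being the chosen and hence an
  included one; all others count with their inclusion probability only. Averaging those over
  \<open>Q\<close> turns the kernels into \<open>PYZ\<close> and \<open>PY\<close>.\<close>

lemma fresh_match_bound:
  assumes w: "w \<in> set_pmf pW" and ty: "typ2 w t x"
  shows "(\<integral>\<^sup>+x'. (of_bool (z x' = z x) + ennreal (1 / real L)) *
      (of_bool (f x' t = f x t) + (\<Sum>t'\<in>Ts. ennreal (q w t') * of_bool (f x' t' = f x t))) \<partial>measure_pmf (p2
          w)) \<le> ennreal c4"
proof -
  let ?v = "f x t" and ?l = "ennreal (1 / real L)"
  let ?m = "\<lambda>x'. of_bool (z x' = z x) + ?l"
  have one: "(\<integral>\<^sup>+x'. ?m x' * of_bool (f x' t' = ?v) \<partial>measure_pmf (p2 w)) =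
    ennreal (pmf (PYZt w t') (?v, z x)) + ?l * ennreal (pmf (PYt w t') ?v)" for t'
  proof -
    have "(\<integral>\<^sup>+x'. ?m x' * of_bool (f x' t' = ?v) \<partial>measure_pmf (p2 w)) =
      (\<integral>\<^sup>+x'. of_bool ((f x' t', z x') = (?v, z x)) + ?l * of_bool (f x' t' = ?v) \<partial>measure_pmf (p2 w))"
      by (intro nn_integral_cong) (auto simp: of_bool_def)
    also have "\<dots> = (\<integral>\<^sup>+x'. of_bool ((f x' t', z x') = (?v, z x)) \<partial>measure_pmf (p2 w)) +
      ?l * (\<integral>\<^sup>+x'. of_bool (f x' t' = ?v) \<partial>measure_pmf (p2 w))"
      by (subst nn_integral_add) (simp_all add: nn_integral_cmult)
    finally show ?thesis unfolding nn_integral_Pair_map PYZt_def PYt_def .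
  qed
  have A: "(\<integral>\<^sup>+x'. ?m x' * of_bool (f x' t = ?v) \<partial>measure_pmf (p2 w)) \<le> ennreal (a7 + a8 / real L)"
  proof -
    have "ennreal (pmf (PYZt w t) (?v, z x)) + ?l * ennreal (pmf (PYt w t) ?v) \<le> ennreal a7 + ?l * ennreal a8"
      using ty by (intro add_mono mult_left_mono ennreal_leI) (auto simp: typ2_def)
    also have "\<dots> = ennreal (a7 + a8 / real L)"
      using nn by (simp add: ennreal_mult[symmetric])
    finally show ?thesis unfolding one .
  qed
  have B: "(\<integral>\<^sup>+x'. ?m x' * (\<Sum>t'\<in>Ts. ennreal (q w t') * of_bool (f x' t' = ?v)) \<partial>measure_pmf (p2 w)) \<le> ennreal
      (K * (a6 + a5 / real L))"
  proof -
    have "(\<integral>\<^sup>+x'. ?m x' * (\<Sum>t'\<in>Ts. ennreal (q w t') * of_bool (f x' t' = ?v)) \<partial>measure_pmf (p2 w)) =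
      (\<integral>\<^sup>+x'. (\<Sum>t'\<in>Ts. ennreal (q w t') * (?m x' * of_bool (f x' t' = ?v))) \<partial>measure_pmf (p2 w))"
      unfolding sum_distrib_left by (simp only: mult_ac)
    also have "\<dots> = (\<Sum>t'\<in>Ts. ennreal (q w t') * (\<integral>\<^sup>+x'. ?m x' * of_bool (f x' t' = ?v) \<partial>measure_pmf (p2 w)))"
      by (simp add: nn_integral_sum nn_integral_cmult)
    also have "\<dots> \<le> ennreal K * (\<integral>\<^sup>+t'. (\<integral>\<^sup>+x'. ?m x' * of_bool (f x' t' = ?v) \<partial>measure_pmf (p2 w))
        \<partial>measure_pmf (Q w))"
      by (rule sum_q_le[OF w])
    also have "(\<integral>\<^sup>+t'. (\<integral>\<^sup>+x'. ?m x' * of_bool (f x' t' = ?v) \<partial>measure_pmf (p2 w)) \<partial>measure_pmf (Q w)) =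
      (\<integral>\<^sup>+t'. ennreal (pmf (PYZt w t') (?v, z x)) \<partial>measure_pmf (Q w)) + ?l * (\<integral>\<^sup>+t'. ennreal (pmf (PYt w t')
          ?v) \<partial>measure_pmf (Q w))"
      unfolding one by (subst nn_integral_add) (simp_all add: nn_integral_cmult)
    also have "\<dots> = ennreal (pmf (PYZ w) (?v, z x)) + ?l * ennreal (pmf (PY w) ?v)"
      unfolding PYZ_def PY_def ennreal_pmf_bind ..
    also have "ennreal K * \<dots> \<le> ennreal K * (ennreal a6 + ?l * ennreal a5)"
      using ty by (intro add_mono mult_left_mono ennreal_leI) (auto simp: typ2_def)
    also have "ennreal a6 + ?l * ennreal a5 = ennreal (a6 + a5 / real L)"
      using nn by (simp add: ennreal_mult[symmetric])
    also have "ennreal K * \<dots> = ennreal (K * (a6 + a5 / real L))"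
      using nn pos by (subst ennreal_mult[of K]) auto
    finally show ?thesis by (simp add: mult_left_mono)
  qed
  have "(\<integral>\<^sup>+x'. ?m x' * (of_bool (f x' t = ?v) + (\<Sum>t'\<in>Ts. ennreal (q w t') * of_bool (f x' t' = ?v)))
      \<partial>measure_pmf (p2 w)) =
    (\<integral>\<^sup>+x'. ?m x' * of_bool (f x' t = ?v) \<partial>measure_pmf (p2 w)) +
    (\<integral>\<^sup>+x'. ?m x' * (\<Sum>t'\<in>Ts. ennreal (q w t') * of_bool (f x' t' = ?v)) \<partial>measure_pmf (p2 w))"
    unfolding distrib_left by (rule nn_integral_add) simp_all
  also have "\<dots> \<le> ennreal (a7 + a8 / real L) + ennreal (K * (a6 + a5 / real L))"
    by (rule add_mono[OF A B])
  also have "\<dots> = ennreal c4" unfolding c4_def using nn pos by simp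
  finally show ?thesis .
qed

definition collides :: "'w \<Rightarrow> 's \<Rightarrow> ('y \<Rightarrow> nat) \<Rightarrow> ('t \<Rightarrow> bool) \<Rightarrow> nat \<Rightarrow> 'x \<Rightarrow> 'x \<Rightarrow> bool" where
  "collides w s \<beta> Th m1 x x' \<longleftrightarrow> cand w s \<beta> Th m1 \<noteq> {} \<and>
     typ2 w (tt (pick (cand w s \<beta> Th m1))) x \<and>
     (\<exists>t'. Th t' \<and> f x' t' = f x (tt (pick (cand w s \<beta> Th m1))))"

text \<open>The set and the output are dependent, because the choice is made from the set. After
  splitting by the chosen \<open>u\<close>, negative correlation replaces the inclusion of any other
  \<open>t'\<close> by its unconditional probability, and \<open>x'\<close> is a fresh draw. The
  factor with \<open>1 / L\<close> is the bound on the hash collision, already averaged over the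
  hash.\<close>

lemma collision_bound:
  assumes w: "w \<in> set_pmf pW"
  shows "(\<integral>\<^sup>+x. \<integral>\<^sup>+x'. \<integral>\<^sup>+Th. of_bool (collides w s \<beta> Th m1 x x') *
       (of_bool (z x' = z x) + ennreal (1 / real L)) \<partial>measure_pmf (incl_pmf w) \<partial>measure_pmf (p2 w)
           \<partial>measure_pmf (p2 w)) \<le> ennreal c4"
proof (rule nn_integral_pmf_le)
  fix x
  let ?m = "\<lambda>x'. of_bool (z x' = z x) + ennreal (1 / real L)"
  let ?e = "\<lambda>u Th. of_bool (selects w s \<beta> m1 u Th) :: ennreal"
  let ?P = "\<lambda>u. \<integral>\<^sup>+Th. ?e u Th \<partial>measure_pmf (incl_pmf w)"
  let ?h = "\<lambda>u x'. of_bool (f x' (tt u) = f x (tt u)) + (\<Sum>t'\<in>Ts. ennreal (q w t') * of_bool (f x' t' = f x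
      (tt u)))"
  have step: "(\<integral>\<^sup>+Th. of_bool (collides w s \<beta> Th m1 x x') * ?m x' \<partial>measure_pmf (incl_pmf w)) \<le>
    (\<Sum>u\<in>A w s. ?P u * of_bool (typ2 w (tt u) x) * (?m x' * ?h u x'))" for x'
  proof -
    have "(\<integral>\<^sup>+Th. of_bool (collides w s \<beta> Th m1 x x') * ?m x' \<partial>measure_pmf (incl_pmf w)) \<le>
      (\<integral>\<^sup>+Th. (\<Sum>u\<in>A w s. of_bool (typ2 w (tt u) x) * ?m x' * (?e u Th * of_bool (f x' (tt u) = f x (tt u)) +
         (\<Sum>t'\<in>Ts - {tt u}. of_bool (f x' t' = f x (tt u)) * (?e u Th * of_bool (Th t'))))) \<partial>measure_pmf
             (incl_pmf w))"
    proof (rule nn_integral_pmf_mono)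
      fix Th assume Th: "Th \<in> set_pmf (incl_pmf w)"
      let ?F = "\<lambda>u. of_bool (typ2 w (tt u) x) * ?m x' * (?e u Th * of_bool (f x' (tt u) = f x (tt u)) +
         (\<Sum>t'\<in>Ts - {tt u}. of_bool (f x' t' = f x (tt u)) * (?e u Th * of_bool (Th t'))))"
      show "of_bool (collides w s \<beta> Th m1 x x') * ?m x' \<le> (\<Sum>u\<in>A w s. ?F u)"
      proof (cases "collides w s \<beta> Th m1 x x'")
        case True
        define u where "u = pick (cand w s \<beta> Th m1)"
        have sel: "selects w s \<beta> m1 u Th" using True by (simp add: selects_def u_def collides_def)
        obtain t' where t': "Th t'" "f x' t' = f x (tt u)" using True by (auto simp: collides_def u_def)
        have ty: "typ2 w (tt u) x" using True by (simp add: collides_def u_def)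
        have "1 \<le> ?e u Th * of_bool (f x' (tt u) = f x (tt u)) +
         (\<Sum>t'\<in>Ts - {tt u}. of_bool (f x' t' = f x (tt u)) * (?e u Th * of_bool (Th t')))"
        proof (cases "t' = tt u")
          case False
          have "(1::ennreal) = of_bool (f x' t' = f x (tt u)) * (?e u Th * of_bool (Th t'))"
            using t' sel by simp
          also have "\<dots> \<le> (\<Sum>t'\<in>Ts - {tt u}. of_bool (f x' t' = f x (tt u)) * (?e u Th * of_bool (Th t')))"
            by (rule member_le_sum) (use False incl_in_Ts[OF Th t'(1)] fin in auto)
          finally show ?thesis by (rule order_trans) simp
        qed (use t' sel in auto)
        then have "1 * ?m x' \<le> (?e u Th * of_bool (f x' (tt u) = f x (tt u)) +
         (\<Sum>t'\<in>Ts - {tt u}. of_bool (f x' t' = f x (tt u)) * (?e u Th * of_bool (Th t')))) * ?m x'"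
          by (rule mult_right_mono) simp
        then have "of_bool (collides w s \<beta> Th m1 x x') * ?m x' \<le> ?F u"
          using True ty by (simp add: mult_ac)
        also have "\<dots> \<le> (\<Sum>u\<in>A w s. ?F u)"
          by (rule member_le_sum) (use selects_in_A[OF sel] finite_A in auto)
        finally show ?thesis .
      qed simp
    qed
    also have "\<dots> = (\<Sum>u\<in>A w s. of_bool (typ2 w (tt u) x) * ?m x' * (?P u * of_bool (f x' (tt u) = f x (tt u)) +
         (\<Sum>t'\<in>Ts - {tt u}. of_bool (f x' t' = f x (tt u)) * (\<integral>\<^sup>+Th. ?e u Th * of_bool (Th t') \<partial>measure_pmf
             (incl_pmf w)))))"
      by (simp add: nn_integral_sum nn_integral_cmult nn_integral_add nn_integral_multc)
    also have "\<dots> \<le> (\<Sum>u\<in>A w s. of_bool (typ2 w (tt u) x) * ?m x' * (?P u * of_bool (f x' (tt u) = f x (tt u)) +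
         (\<Sum>t'\<in>Ts. of_bool (f x' t' = f x (tt u)) * (ennreal (q w t') * ?P u))))"
    proof (intro sum_mono mult_left_mono add_left_mono)
      fix u
      have "(\<Sum>t'\<in>Ts - {tt u}. of_bool (f x' t' = f x (tt u)) * (\<integral>\<^sup>+Th. ?e u Th * of_bool (Th t') \<partial>measure_pmf
          (incl_pmf w))) \<le>
        (\<Sum>t'\<in>Ts - {tt u}. of_bool (f x' t' = f x (tt u)) * (ennreal (q w t') * ?P u))"
        by (intro sum_mono mult_left_mono selects_negative_correlation) auto
      also have "\<dots> \<le> (\<Sum>t'\<in>Ts. of_bool (f x' t' = f x (tt u)) * (ennreal (q w t') * ?P u))"
        by (rule sum_mono2) (use fin in auto)
      finally show "(\<Sum>t'\<in>Ts - {tt u}. of_bool (f x' t' = f x (tt u)) * (\<integral>\<^sup>+Th. ?e u Th * of_bool (Th t')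
          \<partial>measure_pmf (incl_pmf w))) \<le> \<dots>" .
    qed simp_all
    also have "\<dots> = (\<Sum>u\<in>A w s. ?P u * of_bool (typ2 w (tt u) x) * (?m x' * ?h u x'))"
    proof (rule sum.cong[OF refl])
      fix u
      have "(\<Sum>t'\<in>Ts. of_bool (f x' t' = f x (tt u)) * (ennreal (q w t') * ?P u)) =
        ?P u * (\<Sum>t'\<in>Ts. ennreal (q w t') * of_bool (f x' t' = f x (tt u)))"
        unfolding sum_distrib_left by (simp only: mult_ac)
      then show "of_bool (typ2 w (tt u) x) * ?m x' * (?P u * of_bool (f x' (tt u) = f x (tt u)) +
         (\<Sum>t'\<in>Ts. of_bool (f x' t' = f x (tt u)) * (ennreal (q w t') * ?P u))) =
        ?P u * of_bool (typ2 w (tt u) x) * (?m x' * ?h u x')"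
        by (simp only: distrib_left distrib_right mult_ac add_ac)
    qed
    finally show ?thesis .
  qed
  have "(\<integral>\<^sup>+x'. \<integral>\<^sup>+Th. of_bool (collides w s \<beta> Th m1 x x') * ?m x' \<partial>measure_pmf (incl_pmf w) \<partial>measure_pmf (p2
      w)) \<le>
    (\<integral>\<^sup>+x'. (\<Sum>u\<in>A w s. ?P u * of_bool (typ2 w (tt u) x) * (?m x' * ?h u x')) \<partial>measure_pmf (p2 w))"
    by (intro nn_integral_pmf_mono step)
  also have "\<dots> = (\<Sum>u\<in>A w s. ?P u * of_bool (typ2 w (tt u) x) * (\<integral>\<^sup>+x'. ?m x' * ?h u x' \<partial>measure_pmf (p2 w)))"
    by (simp add: nn_integral_sum nn_integral_cmult)
  also have "\<dots> \<le> (\<Sum>u\<in>A w s. ?P u * ennreal c4)"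
  proof (rule sum_mono)
    fix u
    show "?P u * of_bool (typ2 w (tt u) x) * (\<integral>\<^sup>+x'. ?m x' * ?h u x' \<partial>measure_pmf (p2 w)) \<le> ?P u * ennreal c4"
    proof (cases "typ2 w (tt u) x")
      case True
      then show ?thesis using mult_left_mono[OF fresh_match_bound[OF w True], of "?P u"] by simp
    qed simp
  qed
  also have "\<dots> = (\<Sum>u\<in>A w s. ?P u) * ennreal c4" by (rule sum_distrib_right[symmetric])
  \<comment> \<open>At most one \<open>u\<close> is selected from each set, so the selection
    probabilities add up to at most 1.\<close>
  also have "\<dots> \<le> 1 * ennreal c4"
  proof (rule mult_right_mono)
    have "(\<Sum>u\<in>A w s. ?P u) = (\<integral>\<^sup>+Th. (\<Sum>u\<in>A w s. ?e u Th) \<partial>measure_pmf (incl_pmf w))"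
      by (simp add: nn_integral_sum)
    also have "\<dots> \<le> 1"
    proof (rule nn_integral_pmf_le)
      fix Th
      have "(\<Sum>u\<in>A w s. ?e u Th) \<le> (\<Sum>u\<in>A w s. if u = pick (cand w s \<beta> Th m1) then 1 else 0)"
        by (rule sum_mono) (auto simp: selects_def)
      also have "\<dots> \<le> 1" using finite_A by (simp add: sum.delta)
      finally show "(\<Sum>u\<in>A w s. ?e u Th) \<le> 1" .
    qed
    finally show "(\<Sum>u\<in>A w s. ?P u) \<le> 1" .
  qed simp
  finally show "(\<integral>\<^sup>+x'. \<integral>\<^sup>+Th. of_bool (collides w s \<beta> Th m1 x x') * ?m x' \<partial>measure_pmf (incl_pmf w)
      \<partial>measure_pmf (p2 w)) \<le> ennreal c4"
    by simp
qed

end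

lemma nn_integral_pmf_rotate:
  "(\<integral>\<^sup>+\<gamma>. \<integral>\<^sup>+T. \<integral>\<^sup>+x. \<integral>\<^sup>+y. F \<gamma> T x y \<partial>measure_pmf r \<partial>measure_pmf r' \<partial>measure_pmf q \<partial>measure_pmf p) =
   (\<integral>\<^sup>+x. \<integral>\<^sup>+y. \<integral>\<^sup>+T. \<integral>\<^sup>+\<gamma>. F \<gamma> T x y \<partial>measure_pmf p \<partial>measure_pmf q \<partial>measure_pmf r \<partial>measure_pmf r')"
proof -
  have "(\<integral>\<^sup>+\<gamma>. \<integral>\<^sup>+T. \<integral>\<^sup>+x. \<integral>\<^sup>+y. F \<gamma> T x y \<partial>measure_pmf r \<partial>measure_pmf r' \<partial>measure_pmf q \<partial>measure_pmf p) =
    (\<integral>\<^sup>+\<gamma>. \<integral>\<^sup>+x. \<integral>\<^sup>+T. \<integral>\<^sup>+y. F \<gamma> T x y \<partial>measure_pmf r \<partial>measure_pmf q \<partial>measure_pmf r' \<partial>measure_pmf p)"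
    by (rule nn_integral_cong) (rule nn_integral_pmf_commute)
  also have "\<dots> = (\<integral>\<^sup>+\<gamma>. \<integral>\<^sup>+x. \<integral>\<^sup>+y. \<integral>\<^sup>+T. F \<gamma> T x y \<partial>measure_pmf q \<partial>measure_pmf r \<partial>measure_pmf r'
      \<partial>measure_pmf p)"
    by (rule nn_integral_cong, rule nn_integral_cong) (rule nn_integral_pmf_commute)
  also have "\<dots> = (\<integral>\<^sup>+x. \<integral>\<^sup>+\<gamma>. \<integral>\<^sup>+y. \<integral>\<^sup>+T. F \<gamma> T x y \<partial>measure_pmf q \<partial>measure_pmf r \<partial>measure_pmf p \<partial>measure_pmf
      r')"
    by (rule nn_integral_pmf_commute)
  also have "\<dots> = (\<integral>\<^sup>+x. \<integral>\<^sup>+y. \<integral>\<^sup>+\<gamma>. \<integral>\<^sup>+T. F \<gamma> T x y \<partial>measure_pmf q \<partial>measure_pmf p \<partial>measure_pmf r \<partial>measure_pmf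
      r')"
    by (rule nn_integral_cong) (rule nn_integral_pmf_commute)
  also have "\<dots> = (\<integral>\<^sup>+x. \<integral>\<^sup>+y. \<integral>\<^sup>+T. \<integral>\<^sup>+\<gamma>. F \<gamma> T x y \<partial>measure_pmf p \<partial>measure_pmf q \<partial>measure_pmf r \<partial>measure_pmf
      r')"
    by (rule nn_integral_cong, rule nn_integral_cong) (rule nn_integral_pmf_commute)
  finally show ?thesis .
qed

lemma nn_integral_pmf4_add:
  fixes F1 F2 :: "'a \<Rightarrow> 'b \<Rightarrow> 'c \<Rightarrow> 'd \<Rightarrow> ennreal"
  shows "(\<integral>\<^sup>+a. \<integral>\<^sup>+b. \<integral>\<^sup>+c. \<integral>\<^sup>+d. F1 a b c d + F2 a b c d + (\<Sum>i\<in>I. F3 i a b c d) + (\<Sum>j\<in>J. F4 j a b c d)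
      \<partial>measure_pmf r' \<partial>measure_pmf r \<partial>measure_pmf q \<partial>measure_pmf p) =
    (\<integral>\<^sup>+a. \<integral>\<^sup>+b. \<integral>\<^sup>+c. \<integral>\<^sup>+d. F1 a b c d \<partial>measure_pmf r' \<partial>measure_pmf r \<partial>measure_pmf q \<partial>measure_pmf p) +
    (\<integral>\<^sup>+a. \<integral>\<^sup>+b. \<integral>\<^sup>+c. \<integral>\<^sup>+d. F2 a b c d \<partial>measure_pmf r' \<partial>measure_pmf r \<partial>measure_pmf q \<partial>measure_pmf p) +
    (\<Sum>i\<in>I. \<integral>\<^sup>+a. \<integral>\<^sup>+b. \<integral>\<^sup>+c. \<integral>\<^sup>+d. F3 i a b c d \<partial>measure_pmf r' \<partial>measure_pmf r \<partial>measure_pmf q \<partial>measure_pmf p)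
        +
    (\<Sum>j\<in>J. \<integral>\<^sup>+a. \<integral>\<^sup>+b. \<integral>\<^sup>+c. \<integral>\<^sup>+d. F4 j a b c d \<partial>measure_pmf r' \<partial>measure_pmf r \<partial>measure_pmf q \<partial>measure_pmf p)"
  by (simp add: nn_integral_add nn_integral_sum)

context one_shot
begin

lemma nn_integral_code:
  "(\<integral>\<^sup>+c. F c \<partial>measure_pmf code_pmf) =
   (\<integral>\<^sup>+\<beta>. \<integral>\<^sup>+\<gamma>. \<integral>\<^sup>+cb. F (\<beta>, \<gamma>, cb) \<partial>measure_pmf (Pi_pmf {..<L} undefined (\<lambda>_. book_pmf)) \<partial>measure_pmf
       zbin_pmf \<partial>measure_pmf ybin_pmf)"
  unfolding code_pmf_def nn_integral_pair_pmf' ..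

definition chosen :: "'s \<Rightarrow> nat \<Rightarrow> ('y \<Rightarrow> nat) \<Rightarrow> 'w \<times> ('t \<Rightarrow> bool) \<times> (nat \<Rightarrow> 'x) \<Rightarrow> 't" where
  "chosen s m1 \<beta> c = tt (pick (cand (fst c) s \<beta> (fst (snd c)) m1))"

definition has_cand :: "'s \<Rightarrow> nat \<Rightarrow> ('y \<Rightarrow> nat) \<Rightarrow> 'w \<times> ('t \<Rightarrow> bool) \<times> (nat \<Rightarrow> 'x) \<Rightarrow> bool" where
  "has_cand s m1 \<beta> c \<longleftrightarrow> cand (fst c) s \<beta> (fst (snd c)) m1 \<noteq> {}"

definition typc :: "'s \<Rightarrow> nat \<Rightarrow> nat \<Rightarrow> ('y \<Rightarrow> nat) \<Rightarrow> 'w \<times> ('t \<Rightarrow> bool) \<times> (nat \<Rightarrow> 'x) \<Rightarrow> bool" where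
  "typc s m1 m2 \<beta> c \<longleftrightarrow> typ2 (fst c) (chosen s m1 \<beta> c) (snd (snd c) m2)"

text \<open>Each later term carries the success of the earlier ones, because the bounds on a wrong
  index or a wrong message are available only for a typical output.\<close>

lemma bad_union_bound:
  "(of_bool (\<not> good (\<beta>, \<gamma>, cb) l m1 m2 s) :: ennreal) \<le>
    of_bool (\<not> has_cand s m1 \<beta> (cb l)) + of_bool (has_cand s m1 \<beta> (cb l) \<and> \<not> typc s m1 m2 \<beta> (cb l)) +
    (\<Sum>l'\<in>{..<L} - {l}. of_bool (has_cand s m1 \<beta> (cb l) \<and> typc s m1 m2 \<beta> (cb l) \<and>
       pass (fst (cb l')) (fst (snd (cb l'))) (f (snd (snd (cb l)) m2) (chosen s m1 \<beta> (cb l))))) +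
    (\<Sum>m2'\<in>{..<M2} - {m2}. of_bool (collides (fst (cb l)) s \<beta> (fst (snd (cb l))) m1 (snd (snd (cb l)) m2) (snd
        (snd (cb l)) m2')) *
       of_bool (\<gamma> (z (snd (snd (cb l)) m2')) = \<gamma> (z (snd (snd (cb l)) m2))))"
  (is "_ \<le> ?T1 + ?T2 + ?T3 + ?T4")
proof (cases "good (\<beta>, \<gamma>, cb) l m1 m2 s")
  case False
  obtain w Th X where c: "cb l = (w, Th, X)" by (cases "cb l")
  consider "\<not> has_cand s m1 \<beta> (cb l)" | "has_cand s m1 \<beta> (cb l)" "\<not> typc s m1 m2 \<beta> (cb l)"
    | l' where "has_cand s m1 \<beta> (cb l)" "typc s m1 m2 \<beta> (cb l)" "l' < L" "l' \<noteq> l"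
       "pass (fst (cb l')) (fst (snd (cb l'))) (f (X m2) (chosen s m1 \<beta> (cb l)))"
    | m2' where "has_cand s m1 \<beta> (cb l)" "typc s m1 m2 \<beta> (cb l)" "m2' < M2" "m2' \<noteq> m2"
       "\<gamma> (z (X m2')) = \<gamma> (z (X m2))" "\<exists>t'. Th t' \<and> f (X m2') t' = f (X m2) (chosen s m1 \<beta> (cb l))"
    using False c unfolding good.simps chosen_def has_cand_def typc_def Let_def
    by (auto simp: case_prod_unfold)
  then have "1 \<le> ?T1 + ?T2 + ?T3 + ?T4"
  proof cases
    case 1
    then show ?thesis by simp
  next
    case 2
    then show ?thesis by simp
  next
    case (3 l')
    then have "1 = (of_bool (has_cand s m1 \<beta> (cb l) \<and> typc s m1 m2 \<beta> (cb l) \<and>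
       pass (fst (cb l')) (fst (snd (cb l'))) (f (snd (snd (cb l)) m2) (chosen s m1 \<beta> (cb l)))) :: ennreal)"
      by (simp add: c)
    also have "\<dots> \<le> ?T3" by (rule member_le_sum) (use 3 in auto)
    also have "\<dots> \<le> ?T1 + ?T2 + ?T3 + ?T4" by (simp add: add_increasing add_increasing2)
    finally show ?thesis .
  next
    case (4 m2')
    then have "1 = (of_bool (collides (fst (cb l)) s \<beta> (fst (snd (cb l))) m1 (snd (snd (cb l)) m2) (snd (snd
        (cb l)) m2')) *
       of_bool (\<gamma> (z (snd (snd (cb l)) m2')) = \<gamma> (z (snd (snd (cb l)) m2))) :: ennreal)"
      by (simp add: c collides_def has_cand_def typc_def chosen_def)
    also have "\<dots> \<le> ?T4" by (rule member_le_sum) (use 4 in auto)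
    also have "\<dots> \<le> ?T1 + ?T2 + ?T3 + ?T4" by (simp add: add_increasing add_increasing2)
    finally show ?thesis .
  qed
  with False show ?thesis by simp
qed simp

theorem random_code_error:
  assumes l: "l < L" and m1: "m1 < M1" and m2: "m2 < M2" and \<epsilon>: "0 \<le> \<epsilon>1" "0 \<le> \<epsilon>2"
    and H1: "(\<integral>\<^sup>+s. \<integral>\<^sup>+w. \<integral>\<^sup>+u. of_bool (\<not> typ1 w s u) \<partial>measure_pmf (k w s) \<partial>measure_pmf pW \<partial>measure_pmf pS)
        \<le> ennreal \<epsilon>1"
    and H2: "(\<integral>\<^sup>+s. \<integral>\<^sup>+w. \<integral>\<^sup>+u. \<integral>\<^sup>+x. of_bool (\<not> typ2 w (tt u) x) \<partial>measure_pmf (p2 w) \<partial>measure_pmf (k w s)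
        \<partial>measure_pmf pW \<partial>measure_pmf pS) \<le> ennreal \<epsilon>2"
  shows "(\<integral>\<^sup>+s. \<integral>\<^sup>+c. of_bool (\<not> good c l m1 m2 s) \<partial>measure_pmf code_pmf \<partial>measure_pmf pS) \<le>
    ennreal (4 * (a2 / K + (real M1 - 1) * a3 + (real M1 - 1) * a1 / K) + 2 * (\<epsilon>1 + \<epsilon>2 / \<eta>) + \<eta> +
      (real L - 1) * min (1 / b0) (K / b1) + (real M2 - 1) * c4)"
proof -
  let ?B = "Pi_pmf {..<L} undefined (\<lambda>_. book_pmf)"
  let ?V = "4 * (a2 / K + (real M1 - 1) * a3 + (real M1 - 1) * a1 / K)"
  let ?T1 = "\<lambda>s \<beta> cb. of_bool (\<not> has_cand s m1 \<beta> (cb l)) :: ennreal"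
  let ?T2 = "\<lambda>s \<beta> cb. of_bool (has_cand s m1 \<beta> (cb l) \<and> \<not> typc s m1 m2 \<beta> (cb l)) :: ennreal"
  let ?T3 = "\<lambda>l' s \<beta> cb. of_bool (has_cand s m1 \<beta> (cb l) \<and> typc s m1 m2 \<beta> (cb l) \<and>
       pass (fst (cb l')) (fst (snd (cb l'))) (f (snd (snd (cb l)) m2) (chosen s m1 \<beta> (cb l)))) :: ennreal"
  let ?T4 = "\<lambda>m2' s \<beta> \<gamma> cb. of_bool (collides (fst (cb l)) s \<beta> (fst (snd (cb l))) m1 (snd (snd (cb l)) m2)
      (snd (snd (cb l)) m2')) *
       of_bool (\<gamma> (z (snd (snd (cb l)) m2')) = \<gamma> (z (snd (snd (cb l)) m2))) :: ennreal"
  let ?E = "\<lambda>F. \<integral>\<^sup>+s. \<integral>\<^sup>+\<beta>. \<integral>\<^sup>+\<gamma>. \<integral>\<^sup>+cb. F s \<beta> \<gamma> cb \<partial>measure_pmf ?B \<partial>measure_pmf zbin_pmf \<partial>measure_pmf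
      ybin_pmf \<partial>measure_pmf pS"
  have lL: "l \<in> {..<L}" using l by simp
  have book: "(\<integral>\<^sup>+cb. F (cb l) \<partial>measure_pmf ?B) = (\<integral>\<^sup>+c. F c \<partial>measure_pmf book_pmf)" for F
    by (rule nn_integral_Pi_pmf_component[OF _ lL]) simp
  have B1: "?E (\<lambda>s \<beta> \<gamma> cb. ?T1 s \<beta> cb) \<le> ennreal ?V + 2 * (ennreal \<epsilon>1 + ennreal (1 / \<eta>) * ennreal \<epsilon>2)"
  proof -
    have "?E (\<lambda>s \<beta> \<gamma> cb. ?T1 s \<beta> cb) = (\<integral>\<^sup>+s. \<integral>\<^sup>+\<beta>. \<integral>\<^sup>+w. \<integral>\<^sup>+Th. of_bool (cand w s \<beta> Th m1 = {}) \<partial>measure_pmf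
        (incl_pmf w) \<partial>measure_pmf pW \<partial>measure_pmf ybin_pmf \<partial>measure_pmf pS)"
      unfolding book[of "\<lambda>c. of_bool (\<not> has_cand s m1 \<beta> c)" for s \<beta>] nn_integral_book
      by (simp add: has_cand_def)
    also have "\<dots> = (\<integral>\<^sup>+s. \<integral>\<^sup>+w. \<integral>\<^sup>+\<beta>. \<integral>\<^sup>+Th. of_bool (cand w s \<beta> Th m1 = {}) \<partial>measure_pmf (incl_pmf w)
        \<partial>measure_pmf ybin_pmf \<partial>measure_pmf pW \<partial>measure_pmf pS)"
      by (rule nn_integral_cong) (rule nn_integral_pmf_commute)
    also have "\<dots> \<le> (\<integral>\<^sup>+s. \<integral>\<^sup>+w. ennreal ?V + 2 * ((\<integral>\<^sup>+u. of_bool (\<not> typ1 w s u) \<partial>measure_pmf (k w s)) +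
   ennreal (1 / \<eta>) * (\<integral>\<^sup>+u. \<integral>\<^sup>+x. of_bool (\<not> typ2 w (tt u) x) \<partial>measure_pmf (p2 w) \<partial>measure_pmf (k w s)))
       \<partial>measure_pmf pW \<partial>measure_pmf pS)"
    proof (rule nn_integral_pmf_mono, rule nn_integral_pmf_mono)
      fix s w assume s: "s \<in> set_pmf pS" and w: "w \<in> set_pmf pW"
      show "(\<integral>\<^sup>+\<beta>. \<integral>\<^sup>+Th. of_bool (cand w s \<beta> Th m1 = {}) \<partial>measure_pmf (incl_pmf w) \<partial>measure_pmf ybin_pmf) \<le>
        ennreal ?V + 2 * ((\<integral>\<^sup>+u. of_bool (\<not> typ1 w s u) \<partial>measure_pmf (k w s)) +
   ennreal (1 / \<eta>) * (\<integral>\<^sup>+u. \<integral>\<^sup>+x. of_bool (\<not> typ2 w (tt u) x) \<partial>measure_pmf (p2 w) \<partial>measure_pmf (k w s)))"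
        by (rule order_trans[OF no_cand_bound[OF w s m1]]) (intro add_left_mono mult_left_mono not_A_bound,
            simp)
    qed
    also have "\<dots> = ennreal ?V + 2 * ((\<integral>\<^sup>+s. \<integral>\<^sup>+w. \<integral>\<^sup>+u. of_bool (\<not> typ1 w s u) \<partial>measure_pmf (k w s)
        \<partial>measure_pmf pW \<partial>measure_pmf pS) +
      ennreal (1 / \<eta>) * (\<integral>\<^sup>+s. \<integral>\<^sup>+w. \<integral>\<^sup>+u. \<integral>\<^sup>+x. of_bool (\<not> typ2 w (tt u) x) \<partial>measure_pmf (p2 w) \<partial>measure_pmf
          (k w s) \<partial>measure_pmf pW \<partial>measure_pmf pS))"
      by (simp add: nn_integral_add nn_integral_cmult)
    also have "\<dots> \<le> ennreal ?V + 2 * (ennreal \<epsilon>1 + ennreal (1 / \<eta>) * ennreal \<epsilon>2)"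
      by (intro add_mono mult_left_mono order_refl H1 H2) simp_all
    finally show ?thesis .
  qed
  \<comment> \<open>The input \<open>X m2\<close> is independent of the choice of \<open>u\<close>,
    and membership in \<open>A\<close> bounds the failure for every possible choice.\<close>
  have B2: "?E (\<lambda>s \<beta> \<gamma> cb. ?T2 s \<beta> cb) \<le> ennreal \<eta>"
  proof (rule nn_integral_pmf_le, rule nn_integral_pmf_le, rule nn_integral_pmf_le)
    fix s \<beta>
    have "(\<integral>\<^sup>+cb. ?T2 s \<beta> cb \<partial>measure_pmf ?B) = (\<integral>\<^sup>+c. of_bool (has_cand s m1 \<beta> c \<and> \<not> typc s m1 m2 \<beta> c)
        \<partial>measure_pmf book_pmf)"
      by (rule book[of "\<lambda>c. of_bool (has_cand s m1 \<beta> c \<and> \<not> typc s m1 m2 \<beta> c)"])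
    also have "\<dots> \<le> ennreal \<eta>"
      unfolding nn_integral_book
    proof (rule nn_integral_pmf_le, rule nn_integral_pmf_le)
      fix w Th
      let ?C = "cand w s \<beta> Th m1"
      have "(\<integral>\<^sup>+X. of_bool (has_cand s m1 \<beta> (w, Th, X) \<and> \<not> typc s m1 m2 \<beta> (w, Th, X)) \<partial>measure_pmf (Pi_pmf
          {..<M2} undefined (\<lambda>_. p2 w))) =
        (\<integral>\<^sup>+X. of_bool (?C \<noteq> {} \<and> \<not> typ2 w (tt (pick ?C)) (X m2)) \<partial>measure_pmf (Pi_pmf {..<M2} undefined (\<lambda>_.
            p2 w)))"
        by (simp add: has_cand_def typc_def chosen_def)
      also have "\<dots> = (\<integral>\<^sup>+x. of_bool (?C \<noteq> {} \<and> \<not> typ2 w (tt (pick ?C)) x) \<partial>measure_pmf (p2 w))"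
        by (rule nn_integral_Pi_pmf_component[where F = "\<lambda>x. of_bool (?C \<noteq> {} \<and> \<not> typ2 w (tt (pick ?C)) x)"])
            (use m2 in auto)
      also have "\<dots> \<le> ennreal \<eta>"
      proof (cases "?C = {}")
        case False
        then have "pick ?C \<in> A w s" using pick_in[OF False] by (auto simp: cand_def)
        then have "measure_pmf.prob (p2 w) {x. \<not> typ2 w (tt (pick ?C)) x} \<le> \<eta>" by (simp add: A_def)
        then have "emeasure (measure_pmf (p2 w)) {x. \<not> typ2 w (tt (pick ?C)) x} \<le> ennreal \<eta>"
          by (simp add: measure_pmf.emeasure_eq_measure ennreal_leI)
        then show ?thesis using False by (simp add: emeasure_of_bool)
      qed simp
      finally show "(\<integral>\<^sup>+X. of_bool (has_cand s m1 \<beta> (w, Th, X) \<and> \<not> typc s m1 m2 \<beta> (w, Th, X)) \<partial>measure_pmf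
          (Pi_pmf {..<M2} undefined (\<lambda>_. p2 w))) \<le> ennreal \<eta>" .
    qed
    finally show "(\<integral>\<^sup>+cb. ?T2 s \<beta> cb \<partial>measure_pmf ?B) \<le> ennreal \<eta>" .
  qed
  \<comment> \<open>The codebook \<open>cb l'\<close> is drawn independently of the one that
    produced the output.\<close>
  have B3: "?E (\<lambda>s \<beta> \<gamma> cb. ?T3 l' s \<beta> cb) \<le> ennreal (min (1 / b0) (K / b1))" if l': "l' \<in> {..<L} - {l}" for l'
  proof (rule nn_integral_pmf_le, rule nn_integral_pmf_le, rule nn_integral_pmf_le)
    fix s \<beta>
    let ?F = "\<lambda>c c'. of_bool (has_cand s m1 \<beta> c \<and> typc s m1 m2 \<beta> c \<and>
       pass (fst c') (fst (snd c')) (f (snd (snd c) m2) (chosen s m1 \<beta> c))) :: ennreal"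
    have "(\<integral>\<^sup>+cb. ?T3 l' s \<beta> cb \<partial>measure_pmf ?B) = (\<integral>\<^sup>+c. \<integral>\<^sup>+c'. ?F c c' \<partial>measure_pmf book_pmf \<partial>measure_pmf
        book_pmf)"
      by (rule nn_integral_Pi_pmf_component2[where F = ?F]) (use l' l in auto)
    also have "\<dots> \<le> ennreal (min (1 / b0) (K / b1))"
    proof (rule nn_integral_pmf_le)
      fix c
      show "(\<integral>\<^sup>+c'. ?F c c' \<partial>measure_pmf book_pmf) \<le> ennreal (min (1 / b0) (K / b1))"
      proof (cases "has_cand s m1 \<beta> c \<and> typc s m1 m2 \<beta> c")
        case True
        then have "0 < pmf PV (f (snd (snd c) m2) (chosen s m1 \<beta> c))" by (simp add: typc_def typ2_def)
        from pass_bound[OF this] show ?thesis using True by (simp add: case_prod_unfold)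
      next
        case False
        then show ?thesis by (intro nn_integral_pmf_le) (auto simp: of_bool_def)
      qed
    qed
    finally show "(\<integral>\<^sup>+cb. ?T3 l' s \<beta> cb \<partial>measure_pmf ?B) \<le> ennreal (min (1 / b0) (K / b1))" .
  qed
  have B4: "?E (\<lambda>s \<beta> \<gamma> cb. ?T4 m2' s \<beta> \<gamma> cb) \<le> ennreal c4" if m2': "m2' \<in> {..<M2} - {m2}" for m2'
  proof (rule nn_integral_pmf_le, rule nn_integral_pmf_le)
    fix s \<beta>
    let ?G = "\<lambda>\<gamma> w Th x x'. of_bool (collides w s \<beta> Th m1 x x') * of_bool (\<gamma> (z x') = \<gamma> (z x)) :: ennreal"
    have inner: "(\<integral>\<^sup>+cb. ?T4 m2' s \<beta> \<gamma> cb \<partial>measure_pmf ?B) =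
       (\<integral>\<^sup>+w. \<integral>\<^sup>+Th. \<integral>\<^sup>+x. \<integral>\<^sup>+x'. ?G \<gamma> w Th x x' \<partial>measure_pmf (p2 w) \<partial>measure_pmf (p2 w) \<partial>measure_pmf
           (incl_pmf w) \<partial>measure_pmf pW)" for \<gamma>
    proof -
      have "(\<integral>\<^sup>+cb. ?T4 m2' s \<beta> \<gamma> cb \<partial>measure_pmf ?B) = (\<integral>\<^sup>+c. ?G \<gamma> (fst c) (fst (snd c)) (snd (snd c) m2)
          (snd (snd c) m2') \<partial>measure_pmf book_pmf)"
        by (rule book[of "\<lambda>c. ?G \<gamma> (fst c) (fst (snd c)) (snd (snd c) m2) (snd (snd c) m2')"])
      also have "\<dots> = (\<integral>\<^sup>+w. \<integral>\<^sup>+Th. \<integral>\<^sup>+X. ?G \<gamma> w Th (X m2) (X m2') \<partial>measure_pmf (Pi_pmf {..<M2} undefined (\<lambda>_.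
          p2 w)) \<partial>measure_pmf (incl_pmf w) \<partial>measure_pmf pW)"
        by (simp add: nn_integral_book)
      also have "\<dots> = (\<integral>\<^sup>+w. \<integral>\<^sup>+Th. \<integral>\<^sup>+x. \<integral>\<^sup>+x'. ?G \<gamma> w Th x x' \<partial>measure_pmf (p2 w) \<partial>measure_pmf (p2 w)
          \<partial>measure_pmf (incl_pmf w) \<partial>measure_pmf pW)"
        by (rule nn_integral_cong, rule nn_integral_cong)
          (rule nn_integral_Pi_pmf_component2, use m2 m2' in auto)
      finally show ?thesis .
    qed
    have "(\<integral>\<^sup>+\<gamma>. \<integral>\<^sup>+cb. ?T4 m2' s \<beta> \<gamma> cb \<partial>measure_pmf ?B \<partial>measure_pmf zbin_pmf) =
      (\<integral>\<^sup>+w. \<integral>\<^sup>+\<gamma>. \<integral>\<^sup>+Th. \<integral>\<^sup>+x. \<integral>\<^sup>+x'. ?G \<gamma> w Th x x' \<partial>measure_pmf (p2 w) \<partial>measure_pmf (p2 w) \<partial>measure_pmf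
          (incl_pmf w) \<partial>measure_pmf zbin_pmf \<partial>measure_pmf pW)"
      unfolding inner by (rule nn_integral_pmf_commute)
    \<comment> \<open>The hash and the set are moved innermost, so that both are averaged for fixed
      inputs \<open>x\<close> and \<open>x'\<close>.\<close>
    also have "\<dots> = (\<integral>\<^sup>+w. \<integral>\<^sup>+x. \<integral>\<^sup>+x'. \<integral>\<^sup>+Th. \<integral>\<^sup>+\<gamma>. ?G \<gamma> w Th x x' \<partial>measure_pmf zbin_pmf \<partial>measure_pmf
        (incl_pmf w) \<partial>measure_pmf (p2 w) \<partial>measure_pmf (p2 w) \<partial>measure_pmf pW)"
      by (rule nn_integral_cong) (rule nn_integral_pmf_rotate)
    also have "\<dots> \<le> ennreal c4"
    proof (rule nn_integral_pmf_le)
      fix w assume w: "w \<in> set_pmf pW"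
      have "(\<integral>\<^sup>+x. \<integral>\<^sup>+x'. \<integral>\<^sup>+Th. \<integral>\<^sup>+\<gamma>. ?G \<gamma> w Th x x' \<partial>measure_pmf zbin_pmf \<partial>measure_pmf (incl_pmf w)
          \<partial>measure_pmf (p2 w) \<partial>measure_pmf (p2 w)) \<le>
        (\<integral>\<^sup>+x. \<integral>\<^sup>+x'. \<integral>\<^sup>+Th. of_bool (collides w s \<beta> Th m1 x x') *
       (of_bool (z x' = z x) + ennreal (1 / real L)) \<partial>measure_pmf (incl_pmf w) \<partial>measure_pmf (p2 w)
           \<partial>measure_pmf (p2 w))"
      proof (rule nn_integral_pmf_mono, rule nn_integral_pmf_mono, rule nn_integral_pmf_mono)
        fix x x' Th assume "x \<in> set_pmf (p2 w)" "x' \<in> set_pmf (p2 w)"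
        then have "z x \<in> Zs" "z x' \<in> Zs" using Zs[OF w] by auto
        then show "(\<integral>\<^sup>+\<gamma>. ?G \<gamma> w Th x x' \<partial>measure_pmf zbin_pmf) \<le> of_bool (collides w s \<beta> Th m1 x x') *
       (of_bool (z x' = z x) + ennreal (1 / real L))"
          by (simp add: nn_integral_cmult mult_left_mono zbin_collision)
      qed
      also have "\<dots> \<le> ennreal c4" by (rule collision_bound[OF w])
      finally show "(\<integral>\<^sup>+x. \<integral>\<^sup>+x'. \<integral>\<^sup>+Th. \<integral>\<^sup>+\<gamma>. ?G \<gamma> w Th x x' \<partial>measure_pmf zbin_pmf \<partial>measure_pmf (incl_pmf w)
          \<partial>measure_pmf (p2 w) \<partial>measure_pmf (p2 w)) \<le> ennreal c4" .
    qed
    finally show "(\<integral>\<^sup>+\<gamma>. \<integral>\<^sup>+cb. ?T4 m2' s \<beta> \<gamma> cb \<partial>measure_pmf ?B \<partial>measure_pmf zbin_pmf) \<le> ennreal c4" .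
  qed
  have "(\<integral>\<^sup>+s. \<integral>\<^sup>+c. of_bool (\<not> good c l m1 m2 s) \<partial>measure_pmf code_pmf \<partial>measure_pmf pS) \<le>
    ?E (\<lambda>s \<beta> \<gamma> cb. ?T1 s \<beta> cb + ?T2 s \<beta> cb + (\<Sum>l'\<in>{..<L} - {l}. ?T3 l' s \<beta> cb) + (\<Sum>m2'\<in>{..<M2} - {m2}. ?T4
        m2' s \<beta> \<gamma> cb))"
    unfolding nn_integral_code
    by (rule nn_integral_pmf_mono, rule nn_integral_pmf_mono, rule nn_integral_pmf_mono, rule
        nn_integral_pmf_mono)
      (rule bad_union_bound)
  also have "\<dots> = ?E (\<lambda>s \<beta> \<gamma> cb. ?T1 s \<beta> cb) + ?E (\<lambda>s \<beta> \<gamma> cb. ?T2 s \<beta> cb) +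
     (\<Sum>l'\<in>{..<L} - {l}. ?E (\<lambda>s \<beta> \<gamma> cb. ?T3 l' s \<beta> cb)) + (\<Sum>m2'\<in>{..<M2} - {m2}. ?E (\<lambda>s \<beta> \<gamma> cb. ?T4 m2' s \<beta> \<gamma>
         cb))"
    by (rule nn_integral_pmf4_add)
  also have "\<dots> \<le> (ennreal ?V + 2 * (ennreal \<epsilon>1 + ennreal (1 / \<eta>) * ennreal \<epsilon>2)) + ennreal \<eta> +
     (\<Sum>l'\<in>{..<L} - {l}. ennreal (min (1 / b0) (K / b1))) + (\<Sum>m2'\<in>{..<M2} - {m2}. ennreal c4)"
    by (intro add_mono sum_mono B1 B2 B3 B4)
  also have "\<dots> = ennreal (?V + 2 * (\<epsilon>1 + \<epsilon>2 / \<eta>) + \<eta> + (real L - 1) * min (1 / b0) (K / b1) + (real M2 - 1) *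
      c4)"
  proof -
    have V0: "0 \<le> ?V" using nn pos m1 by simp
    have e1: "2 * (ennreal \<epsilon>1 + ennreal (1 / \<eta>) * ennreal \<epsilon>2) = ennreal (2 * (\<epsilon>1 + \<epsilon>2 / \<eta>))"
    proof -
      have "ennreal \<epsilon>1 + ennreal (1 / \<eta>) * ennreal \<epsilon>2 = ennreal (\<epsilon>1 + \<epsilon>2 / \<eta>)"
        using \<epsilon> pos by (simp add: ennreal_mult[symmetric])
      then show ?thesis using \<epsilon> pos by (subst ennreal_mult) auto
    qed
    have e2: "(\<Sum>l'\<in>{..<L} - {l}. ennreal (min (1 / b0) (K / b1))) = ennreal ((real L - 1) * min (1 / b0) (K /
        b1))"
      using l pos by (simp add: ennreal_of_nat_eq_real_of_nat of_nat_diff ennreal_mult[symmetric])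
    have e3: "(\<Sum>m2'\<in>{..<M2} - {m2}. ennreal c4) = ennreal ((real M2 - 1) * c4)"
      using m2 c4_nonneg by (simp add: ennreal_of_nat_eq_real_of_nat of_nat_diff ennreal_mult[symmetric])
    have n: "0 \<le> 2 * (\<epsilon>1 + \<epsilon>2 / \<eta>)" "0 \<le> \<eta>" "0 \<le> (real L - 1) * min (1 / b0) (K / b1)" "0 \<le> (real M2 - 1) *
        c4"
      using \<epsilon> pos l m2 c4_nonneg by auto
    show ?thesis unfolding e1 e2 e3
      using V0 n by (simp only: ennreal_plus[symmetric] add_nonneg_nonneg)
  qed
  finally show ?thesis .
qed

end

section \<open>Entropy of finitely supported laws\<close>

text \<open>As an expectation under the law itself, only atoms of positive probability count, and
  identities between entropies become linearity of expectation.\<close>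

definition ent :: "'a pmf \<Rightarrow> real" where
  "ent q = - measure_pmf.expectation q (\<lambda>x. log 2 (pmf q x))"

abbreviation HH :: "'a pmf \<Rightarrow> ('a \<Rightarrow> 'b) \<Rightarrow> real" where
  "HH p X \<equiv> ent (map_pmf X p)"

lemma HH_eq: "HH p X = - measure_pmf.expectation p (\<lambda>\<omega>. log 2 (pmf (map_pmf X p) (X \<omega>)))"
  unfolding ent_def by simp

lemma expectation_finite:
  fixes f :: "'a \<Rightarrow> real"
  assumes "finite (set_pmf p)"
  shows "measure_pmf.expectation p f = (\<Sum>x\<in>set_pmf p. pmf p x * f x)"
  by (subst integral_measure_pmf_real[OF assms]) (auto simp: mult.commute)

lemma expectation_mono_finite:
  fixes f g :: "'a \<Rightarrow> real"
  assumes "finite (set_pmf p)" "\<And>x. x \<in> set_pmf p \<Longrightarrow> f x \<le> g x"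
  shows "measure_pmf.expectation p f \<le> measure_pmf.expectation p g"
  unfolding expectation_finite[OF assms(1)] by (intro sum_mono mult_left_mono assms(2)) auto

lemma expectation_cong_finite:
  fixes f g :: "'a \<Rightarrow> real"
  assumes "\<And>x. x \<in> set_pmf p \<Longrightarrow> f x = g x"
  shows "measure_pmf.expectation p f = measure_pmf.expectation p g"
  by (rule integral_cong_AE) (use assms in \<open>auto simp: AE_measure_pmf_iff\<close>)

lemma expectation_add_finite:
  fixes f g :: "'a \<Rightarrow> real"
  assumes "finite (set_pmf p)"
  shows "measure_pmf.expectation p (\<lambda>x. f x + g x) = measure_pmf.expectation p f + measure_pmf.expectation p
      g"
  by (simp add: integrable_measure_pmf_finite assms)

lemma expectation_diff_finite:
  fixes f g :: "'a \<Rightarrow> real"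
  assumes "finite (set_pmf p)"
  shows "measure_pmf.expectation p (\<lambda>x. f x - g x) = measure_pmf.expectation p f - measure_pmf.expectation p
      g"
  by (simp add: integrable_measure_pmf_finite assms)

lemma expectation_bind_finite:
  fixes h :: "'b \<Rightarrow> real"
  assumes "finite (set_pmf p)" "\<And>x. x \<in> set_pmf p \<Longrightarrow> finite (set_pmf (K x))"
  shows "measure_pmf.expectation (bind_pmf p K) h = measure_pmf.expectation p (\<lambda>x. measure_pmf.expectation (K
      x) h)"
  by (subst pmf_expectation_bind[OF assms]) (auto simp: expectation_finite[OF assms(1)])

text \<open>The inequality \<open>ln x \<le> x - 1\<close>, applied to \<open>g / q\<close> at each
  atom. Subnormalisation of \<open>g\<close> on the support suffices, which spares its uses any
  summation outside the support.\<close>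

lemma gibbs:
  assumes fin: "finite (set_pmf q)" and pos: "\<And>x. x \<in> set_pmf q \<Longrightarrow> 0 < g x"
    and sum: "(\<Sum>x\<in>set_pmf q. g x) \<le> 1"
  shows "measure_pmf.expectation q (\<lambda>x. log 2 (g x)) \<le> measure_pmf.expectation q (\<lambda>x. log 2 (pmf q x))"
proof -
  have "measure_pmf.expectation q (\<lambda>x. log 2 (g x)) - measure_pmf.expectation q (\<lambda>x. log 2 (pmf q x)) =
    (\<Sum>x\<in>set_pmf q. pmf q x * (log 2 (g x) - log 2 (pmf q x)))"
    unfolding expectation_finite[OF fin] by (simp add: sum_subtractf right_diff_distrib)
  also have "\<dots> \<le> (\<Sum>x\<in>set_pmf q. (g x - pmf q x) / ln 2)"
  proof (rule sum_mono)
    fix x assume x: "x \<in> set_pmf q"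
    then have p: "0 < pmf q x" by (simp add: pmf_positive)
    have "ln (g x / pmf q x) \<le> g x / pmf q x - 1"
      by (rule ln_le_minus_one) (use p pos[OF x] in auto)
    then have "pmf q x * (ln (g x) - ln (pmf q x)) \<le> pmf q x * (g x / pmf q x - 1)"
      using p pos[OF x] by (intro mult_left_mono) (auto simp: ln_div)
    also have "\<dots> = g x - pmf q x" using p by (simp add: field_simps)
    finally have "pmf q x * (ln (g x) - ln (pmf q x)) / ln 2 \<le> (g x - pmf q x) / ln 2"
      by (rule divide_right_mono) simp
    then show "pmf q x * (log 2 (g x) - log 2 (pmf q x)) \<le> (g x - pmf q x) / ln 2"
      by (simp add: log_def diff_divide_distrib right_diff_distrib)
  qed
  also have "\<dots> = ((\<Sum>x\<in>set_pmf q. g x) - 1) / ln 2"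
    using sum_pmf_eq_1[OF fin order_refl] by (simp add: sum_divide_distrib[symmetric] sum_subtractf)
  also have "\<dots> \<le> 0" using sum by (simp add: divide_nonpos_pos)
  finally show ?thesis by simp
qed

lemma HH_mono:
  assumes fin: "finite (set_pmf p)" and g: "\<And>\<omega>. \<omega> \<in> set_pmf p \<Longrightarrow> X \<omega> = g (Y \<omega>)"
  shows "HH p X \<le> HH p Y"
proof -
  have "measure_pmf.expectation p (\<lambda>\<omega>. log 2 (pmf (map_pmf Y p) (Y \<omega>))) \<le>
    measure_pmf.expectation p (\<lambda>\<omega>. log 2 (pmf (map_pmf X p) (X \<omega>)))"
  proof (rule expectation_mono_finite[OF fin])
    fix \<omega> assume \<omega>: "\<omega> \<in> set_pmf p"
    have Y: "0 < pmf (map_pmf Y p) (Y \<omega>)" using \<omega> by (simp add: pmf_positive)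
    have "pmf (map_pmf Y p) (Y \<omega>) = measure_pmf.prob p (Y -` {Y \<omega>})" by (rule pmf_map)
    also have "\<dots> \<le> measure_pmf.prob p (X -` {X \<omega>})"
      by (subst (1 2) measure_Int_set_pmf[symmetric], rule measure_pmf.finite_measure_mono) (use g \<omega> in auto)
    also have "\<dots> = pmf (map_pmf X p) (X \<omega>)" by (rule pmf_map[symmetric])
    finally show "log 2 (pmf (map_pmf Y p) (Y \<omega>)) \<le> log 2 (pmf (map_pmf X p) (X \<omega>))"
      using Y by simp
  qed
  then show ?thesis unfolding HH_eq by simp
qed

lemma HH_eqI:
  assumes fin: "finite (set_pmf p)" and "\<And>\<omega>. \<omega> \<in> set_pmf p \<Longrightarrow> X \<omega> = g (Y \<omega>)"
    and "\<And>\<omega>. \<omega> \<in> set_pmf p \<Longrightarrow> Y \<omega> = h (X \<omega>)"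
  shows "HH p X = HH p Y"
  by (rule antisym; rule HH_mono[OF fin]) (use assms in auto)

lemma HH_nonneg: "0 \<le> HH p X"
proof -
  have "0 \<le> - (\<integral>x. log 2 (pmf q x) \<partial>measure_pmf q)" for q :: "'c pmf"
    unfolding integral_minus[symmetric]
    by (rule integral_nonneg_AE) (auto simp: AE_measure_pmf_iff pmf_le_1 pmf_positive)
  then show ?thesis by (simp only: ent_def)
qed

lemma sum_pmf_fst_le:
  assumes "finite A"
  shows "(\<Sum>x\<in>A. pmf a (x, z)) \<le> pmf (map_pmf snd a) z"
proof -
  have "(\<Sum>x\<in>A. pmf a (x, z)) = (\<Sum>y\<in>(\<lambda>x. (x, z)) ` A. pmf a y)"
    by (subst sum.reindex) (auto simp: inj_on_def)
  also have "\<dots> = measure_pmf.prob a ((\<lambda>x. (x, z)) ` A)"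
    by (rule measure_measure_pmf_finite[symmetric]) (use assms in auto)
  also have "\<dots> \<le> measure_pmf.prob a (snd -` {z})"
    by (rule measure_pmf.finite_measure_mono) auto
  finally show ?thesis by (simp add: pmf_map)
qed

text \<open>Gibbs' inequality against the law with the same two pair marginals under which
  \<open>X\<close> and \<open>Y\<close> are conditionally independent given
  \<open>Z\<close>.\<close>

lemma HH_submodular:
  assumes fin: "finite (set_pmf p)"
  shows "HH p (\<lambda>\<omega>. (X \<omega>, Y \<omega>, Z \<omega>)) + HH p Z \<le> HH p (\<lambda>\<omega>. (X \<omega>, Z \<omega>)) + HH p (\<lambda>\<omega>. (Y \<omega>, Z \<omega>))"
proof -
  define q where "q = map_pmf (\<lambda>\<omega>. (X \<omega>, Y \<omega>, Z \<omega>)) p"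
  define a where "a = map_pmf (\<lambda>\<omega>. (X \<omega>, Z \<omega>)) p"
  define b where "b = map_pmf (\<lambda>\<omega>. (Y \<omega>, Z \<omega>)) p"
  define c where "c = map_pmf Z p"
  define g where "g = (\<lambda>(x, y, z). pmf a (x, z) * pmf b (y, z) / pmf c z)"
  have finq: "finite (set_pmf q)" using fin by (simp add: q_def)
  have ca: "c = map_pmf snd a" and cb: "c = map_pmf snd b" by (simp_all add: a_def b_def c_def map_pmf_comp)
  have pos: "0 < pmf a (X \<omega>, Z \<omega>)" "0 < pmf b (Y \<omega>, Z \<omega>)" "0 < pmf c (Z \<omega>)" if "\<omega> \<in> set_pmf p" for \<omega>
    using that by (auto simp: a_def b_def c_def pmf_positive_iff)
  have le: "measure_pmf.expectation q (\<lambda>x. log 2 (g x)) \<le> measure_pmf.expectation q (\<lambda>x. log 2 (pmf q x))"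
  proof (rule gibbs[OF finq])
    show "0 < g x" if "x \<in> set_pmf q" for x using that pos by (auto simp: q_def g_def)
    let ?Xs = "X ` set_pmf p" and ?Ys = "Y ` set_pmf p" and ?Zs = "Z ` set_pmf p"
    have "(\<Sum>x\<in>set_pmf q. g x) \<le> (\<Sum>x\<in>?Xs \<times> ?Ys \<times> ?Zs. g x)"
      by (rule sum_mono2) (use fin in \<open>auto simp: q_def g_def\<close>)
    also have "\<dots> = (\<Sum>x\<in>?Xs. \<Sum>y\<in>?Ys. \<Sum>z\<in>?Zs. pmf a (x, z) * pmf b (y, z) / pmf c z)"
      unfolding g_def by (simp add: sum.cartesian_product)
    also have "\<dots> = (\<Sum>x\<in>?Xs. \<Sum>z\<in>?Zs. \<Sum>y\<in>?Ys. pmf a (x, z) * pmf b (y, z) / pmf c z)"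
      by (intro sum.cong refl sum.swap)
    also have "\<dots> = (\<Sum>z\<in>?Zs. \<Sum>x\<in>?Xs. \<Sum>y\<in>?Ys. pmf a (x, z) * pmf b (y, z) / pmf c z)"
      by (rule sum.swap)
    also have "\<dots> = (\<Sum>z\<in>?Zs. (\<Sum>x\<in>?Xs. pmf a (x, z)) * (\<Sum>y\<in>?Ys. pmf b (y, z)) / pmf c z)"
      by (simp add: sum_product sum_divide_distrib)
    also have "\<dots> \<le> (\<Sum>z\<in>?Zs. pmf c z * pmf c z / pmf c z)"
      by (intro sum_mono divide_right_mono mult_mono)
        (use sum_pmf_fst_le[of ?Xs a] sum_pmf_fst_le[of ?Ys b] fin in \<open>auto simp: ca[symmetric] cb[symmetric]
            intro: sum_nonneg\<close>)
    also have "\<dots> = (\<Sum>z\<in>?Zs. pmf c z)" by (intro sum.cong) auto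
    also have "\<dots> = 1" by (rule sum_pmf_eq_1) (use fin in \<open>auto simp: c_def\<close>)
    finally show "(\<Sum>x\<in>set_pmf q. g x) \<le> 1" .
  qed
  have "measure_pmf.expectation q (\<lambda>x. log 2 (g x)) =
    measure_pmf.expectation p (\<lambda>\<omega>. log 2 (pmf a (X \<omega>, Z \<omega>)) + log 2 (pmf b (Y \<omega>, Z \<omega>)) - log 2 (pmf c (Z \<omega>)))"
    unfolding q_def integral_map_pmf g_def
  proof (rule expectation_cong_finite)
    fix \<omega> assume "\<omega> \<in> set_pmf p"
    from pos[OF this] show "log 2 (case (X \<omega>, Y \<omega>, Z \<omega>) of (x, y, z) \<Rightarrow> pmf a (x, z) * pmf b (y, z) / pmf c z)
        =
      log 2 (pmf a (X \<omega>, Z \<omega>)) + log 2 (pmf b (Y \<omega>, Z \<omega>)) - log 2 (pmf c (Z \<omega>))"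
      by (simp add: log_mult log_divide)
  qed
  also have "\<dots> = - HH p (\<lambda>\<omega>. (X \<omega>, Z \<omega>)) - HH p (\<lambda>\<omega>. (Y \<omega>, Z \<omega>)) + HH p Z"
    unfolding HH_eq a_def b_def c_def
    by (simp add: expectation_diff_finite expectation_add_finite fin)
  finally have "measure_pmf.expectation q (\<lambda>x. log 2 (g x)) = \<dots>" .
  with le show ?thesis unfolding ent_def[of q] q_def[symmetric] by (simp add: q_def[symmetric] ent_def[of q])
qed

lemma HH_indep:
  assumes fin: "finite (set_pmf p)"
    and ind: "map_pmf (\<lambda>\<omega>. (X \<omega>, Y \<omega>)) p = pair_pmf (map_pmf X p) (map_pmf Y p)"
  shows "HH p (\<lambda>\<omega>. (X \<omega>, Y \<omega>)) = HH p X + HH p Y"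
proof -
  have "measure_pmf.expectation p (\<lambda>\<omega>. log 2 (pmf (map_pmf (\<lambda>\<omega>. (X \<omega>, Y \<omega>)) p) (X \<omega>, Y \<omega>))) =
    measure_pmf.expectation p (\<lambda>\<omega>. log 2 (pmf (map_pmf X p) (X \<omega>)) + log 2 (pmf (map_pmf Y p) (Y \<omega>)))"
  proof (rule expectation_cong_finite)
    fix \<omega> assume "\<omega> \<in> set_pmf p"
    then have "0 < pmf (map_pmf X p) (X \<omega>)" "0 < pmf (map_pmf Y p) (Y \<omega>)" by (simp_all add: pmf_positive)
    then show "log 2 (pmf (map_pmf (\<lambda>\<omega>. (X \<omega>, Y \<omega>)) p) (X \<omega>, Y \<omega>)) = log 2 (pmf (map_pmf X p) (X \<omega>)) + log 2
        (pmf (map_pmf Y p) (Y \<omega>))"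
      unfolding ind pmf_pair by (simp add: log_mult)
  qed
  then show ?thesis unfolding HH_eq by (simp add: expectation_add_finite fin)
qed

lemma pmf_bind_Pair: "pmf (bind_pmf p (\<lambda>x. map_pmf (Pair x) (K x))) (x, y) = pmf p x * pmf (K x) y"
proof -
  have "pmf (map_pmf (Pair x') (K x')) (x, y) = indicator {x} x' * pmf (K x) y" for x'
  proof (cases "x' = x")
    case True
    then show ?thesis using pmf_map_inj'[of "Pair x" "K x" y] by (simp add: inj_on_def)
  next
    case False
    then show ?thesis by (auto simp: pmf_eq_0_set_pmf)
  qed
  then show ?thesis by (simp add: pmf_bind measure_pmf_single)
qed

text \<open>A conditional entropy read off a kernel instead of a quotient of joint laws: its
  negative is the mean around which the log-likelihood per letter concentrates.\<close>

lemma expectation_log_kernel: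
  assumes fin: "finite (set_pmf p)"
    and K: "map_pmf (\<lambda>\<omega>. (X \<omega>, Y \<omega>)) p = bind_pmf (map_pmf X p) (\<lambda>x. map_pmf (Pair x) (K x))"
  shows "measure_pmf.expectation p (\<lambda>\<omega>. log 2 (pmf (K (X \<omega>)) (Y \<omega>))) = HH p X - HH p (\<lambda>\<omega>. (X \<omega>, Y \<omega>))"
    and "\<And>\<omega>. \<omega> \<in> set_pmf p \<Longrightarrow> 0 < pmf (K (X \<omega>)) (Y \<omega>)"
proof -
  have eq: "pmf (map_pmf (\<lambda>\<omega>. (X \<omega>, Y \<omega>)) p) (x, y) = pmf (map_pmf X p) x * pmf (K x) y" for x y
    unfolding K by (rule pmf_bind_Pair)
  show pos: "0 < pmf (K (X \<omega>)) (Y \<omega>)" if "\<omega> \<in> set_pmf p" for \<omega>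
  proof -
    have "0 < pmf (map_pmf (\<lambda>\<omega>. (X \<omega>, Y \<omega>)) p) (X \<omega>, Y \<omega>)" using that by (simp add: pmf_positive)
    then show ?thesis unfolding eq by (simp add: zero_less_mult_iff)
  qed
  have "measure_pmf.expectation p (\<lambda>\<omega>. log 2 (pmf (K (X \<omega>)) (Y \<omega>))) =
    measure_pmf.expectation p (\<lambda>\<omega>. log 2 (pmf (map_pmf (\<lambda>\<omega>. (X \<omega>, Y \<omega>)) p) (X \<omega>, Y \<omega>)) - log 2 (pmf (map_pmf
        X p) (X \<omega>)))"
  proof (rule expectation_cong_finite)
    fix \<omega> assume \<omega>: "\<omega> \<in> set_pmf p"
    then have "0 < pmf (map_pmf X p) (X \<omega>)" by (simp add: pmf_positive)
    then show "log 2 (pmf (K (X \<omega>)) (Y \<omega>)) = log 2 (pmf (map_pmf (\<lambda>\<omega>. (X \<omega>, Y \<omega>)) p) (X \<omega>, Y \<omega>)) - log 2 (pmf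
        (map_pmf X p) (X \<omega>))"
      using pos[OF \<omega>] unfolding eq by (simp add: log_mult)
  qed
  then show "measure_pmf.expectation p (\<lambda>\<omega>. log 2 (pmf (K (X \<omega>)) (Y \<omega>))) = HH p X - HH p (\<lambda>\<omega>. (X \<omega>, Y \<omega>))"
    unfolding HH_eq by (simp add: expectation_diff_finite fin)
qed

section \<open>Product laws on lists\<close>

text \<open>The law of a letter may depend on its position, because the block kernels given a word
  \<open>w\<close> are of this kind. Appending at the end keeps the indices of the earlier
  letters.\<close>

primrec lprod :: "nat \<Rightarrow> (nat \<Rightarrow> 'a pmf) \<Rightarrow> 'a list pmf" where
  "lprod 0 P = return_pmf []"
| "lprod (Suc n) P = bind_pmf (lprod n P) (\<lambda>xs. map_pmf (\<lambda>x. xs @ [x]) (P n))"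

lemma length_lprod: "xs \<in> set_pmf (lprod n P) \<Longrightarrow> length xs = n"
  by (induction n arbitrary: xs) auto

lemma lprod_cong: "(\<And>i. i < n \<Longrightarrow> P i = P' i) \<Longrightarrow> lprod n P = lprod n P'"
  by (induction n) auto

lemma set_lprod: "xs \<in> set_pmf (lprod n P) \<Longrightarrow> i < n \<Longrightarrow> xs ! i \<in> set_pmf (P i)"
proof (induction n arbitrary: xs)
  case (Suc n)
  then obtain ys y where ys: "ys \<in> set_pmf (lprod n P)" "y \<in> set_pmf (P n)" "xs = ys @ [y]" by auto
  show ?case
  proof (cases "i = n")
    case True
    then show ?thesis using ys length_lprod[OF ys(1)] by (simp add: nth_append)
  next
    case False
    then show ?thesis using Suc ys length_lprod[OF ys(1)] by (simp add: nth_append)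
  qed
qed simp

lemma finite_lprod: "(\<And>i. i < n \<Longrightarrow> finite (set_pmf (P i))) \<Longrightarrow> finite (set_pmf (lprod n P))"
  by (induction n) auto

lemma pmf_lprod: "length xs = n \<Longrightarrow> pmf (lprod n P) xs = (\<Prod>i<n. pmf (P i) (xs ! i))"
proof (induction n arbitrary: xs)
  case (Suc n)
  then obtain ys y where xs: "xs = ys @ [y]" "length ys = n" by (metis length_Suc_conv_rev)
  have "pmf (map_pmf (\<lambda>x. zs @ [x]) (P n)) xs = indicator {ys} zs * pmf (P n) y" if "zs \<in> set_pmf (lprod n
      P)" for zs
  proof (cases "zs = ys")
    case True
    have "pmf (map_pmf (\<lambda>x. ys @ [x]) (P n)) ((\<lambda>x. ys @ [x]) y) = pmf (P n) y"
      by (rule pmf_map_inj') (simp add: inj_on_def)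
    then show ?thesis using True xs by simp
  next
    case False
    then have "xs \<notin> set_pmf (map_pmf (\<lambda>x. zs @ [x]) (P n))" using xs by auto
    then show ?thesis using False by (simp only: set_pmf_iff) simp
  qed
  then have "pmf (lprod (Suc n) P) xs = measure_pmf.expectation (lprod n P) (\<lambda>zs. indicator {ys} zs * pmf (P
      n) y)"
    by (simp only: lprod.simps pmf_bind) (rule expectation_cong_finite, simp)
  also have "\<dots> = pmf (lprod n P) ys * pmf (P n) y" by (simp add: measure_pmf_single)
  also have "\<dots> = (\<Prod>i<Suc n. pmf (P i) (xs ! i))"
    using Suc.IH[OF xs(2)] xs by (simp add: nth_append)
  finally show ?case .
qed simp

lemma lprod_return: "lprod n (\<lambda>i. return_pmf (v i)) = return_pmf (map v [0..<n])"
  by (induction n) (simp_all add: bind_return_pmf)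

text \<open>A memoryless channel maps product laws to product laws; through this fact the block laws
  of the scheme reduce to laws of letters.\<close>

lemma bind_lprod:
  "bind_pmf (lprod n P) (\<lambda>xs. lprod n (\<lambda>i. K i (xs ! i))) = lprod n (\<lambda>i. bind_pmf (P i) (K i))"
proof (induction n)
  case (Suc n)
  have "bind_pmf (lprod (Suc n) P) (\<lambda>xs. lprod (Suc n) (\<lambda>i. K i (xs ! i))) =
    bind_pmf (lprod n P) (\<lambda>xs. bind_pmf (P n) (\<lambda>x. bind_pmf (lprod n (\<lambda>i. K i ((xs @ [x]) ! i)))
      (\<lambda>ys. map_pmf (\<lambda>y. ys @ [y]) (K n ((xs @ [x]) ! n)))))"
    by (simp add: bind_assoc_pmf bind_map_pmf)
  also have "\<dots> = bind_pmf (lprod n P) (\<lambda>xs. bind_pmf (P n) (\<lambda>x. bind_pmf (lprod n (\<lambda>i. K i (xs ! i)))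
      (\<lambda>ys. map_pmf (\<lambda>y. ys @ [y]) (K n x))))"
  proof (rule bind_pmf_cong[OF refl], rule bind_pmf_cong[OF refl])
    fix xs x assume "xs \<in> set_pmf (lprod n P)"
    then have len: "length xs = n" by (rule length_lprod)
    then have "lprod n (\<lambda>i. K i ((xs @ [x]) ! i)) = lprod n (\<lambda>i. K i (xs ! i))"
      by (intro lprod_cong) (simp add: nth_append)
    then show "bind_pmf (lprod n (\<lambda>i. K i ((xs @ [x]) ! i))) (\<lambda>ys. map_pmf (\<lambda>y. ys @ [y]) (K n ((xs @ [x]) !
        n))) =
      bind_pmf (lprod n (\<lambda>i. K i (xs ! i))) (\<lambda>ys. map_pmf (\<lambda>y. ys @ [y]) (K n x))"
      using len by (simp add: nth_append)
  qed
  also have "\<dots> = bind_pmf (lprod n P) (\<lambda>xs. bind_pmf (lprod n (\<lambda>i. K i (xs ! i))) (\<lambda>ys. bind_pmf (P n) (\<lambda>x.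
      map_pmf (\<lambda>y. ys @ [y]) (K n x))))"
    by (rule bind_pmf_cong[OF refl]) (rule bind_commute_pmf)
  also have "\<dots> = bind_pmf (bind_pmf (lprod n P) (\<lambda>xs. lprod n (\<lambda>i. K i (xs ! i)))) (\<lambda>ys. map_pmf (\<lambda>y. ys @
      [y]) (bind_pmf (P n) (K n)))"
    by (simp add: bind_assoc_pmf map_bind_pmf)
  also have "\<dots> = lprod (Suc n) (\<lambda>i. bind_pmf (P i) (K i))"
    unfolding Suc.IH by simp
  finally show ?case .
qed (simp add: bind_return_pmf)

lemma map_lprod:
  "map_pmf (\<lambda>xs. map (\<lambda>i. F i (xs ! i)) [0..<n]) (lprod n P) = lprod n (\<lambda>i. map_pmf (F i) (P i))"
  using bind_lprod[of n P "\<lambda>i x. return_pmf (F i x)"] by (simp add: lprod_return map_pmf_def)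

lemma replicate_pmf_lprod: "replicate_pmf n p = lprod n (\<lambda>_. p)"
proof (induction n)
  case (Suc n)
  have "replicate_pmf (Suc n) p = replicate_pmf (n + 1) p" by simp
  also have "\<dots> = bind_pmf (replicate_pmf n p) (\<lambda>xs. bind_pmf (replicate_pmf 1 p) (\<lambda>ys. return_pmf (xs @ ys)))"
    by (rule replicate_pmf_distrib)
  also have "\<dots> = lprod (Suc n) (\<lambda>_. p)"
    unfolding replicate_pmf_1 Suc.IH by (simp add: map_pmf_def bind_return_pmf bind_assoc_pmf)
  finally show ?case .
qed simp

lemma second_moment_lprod:
  fixes \<phi> :: "'a \<Rightarrow> real"
  assumes fin: "finite (set_pmf J)" and zero: "measure_pmf.expectation J \<phi> = 0"
  shows "measure_pmf.expectation (lprod n (\<lambda>_. J)) (\<lambda>v. (\<Sum>i<n. \<phi> (v ! i))\<^sup>2) = real n *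
      measure_pmf.expectation J (\<lambda>x. (\<phi> x)\<^sup>2)"
proof (induction n)
  case (Suc n)
  let ?D = "lprod n (\<lambda>_. J)"
  have finD: "finite (set_pmf ?D)" by (rule finite_lprod[OF fin])
  have "measure_pmf.expectation (lprod (Suc n) (\<lambda>_. J)) (\<lambda>v. (\<Sum>i<Suc n. \<phi> (v ! i))\<^sup>2) =
    measure_pmf.expectation ?D (\<lambda>v. measure_pmf.expectation J (\<lambda>x. (\<Sum>i<Suc n. \<phi> ((v @ [x]) ! i))\<^sup>2))"
    unfolding lprod.simps by (subst expectation_bind_finite) (use finD fin in auto)
  also have "\<dots> = measure_pmf.expectation ?D (\<lambda>v. (\<Sum>i<n. \<phi> (v ! i))\<^sup>2 + measure_pmf.expectation J (\<lambda>x. (\<phi>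
      x)\<^sup>2))"
  proof (rule expectation_cong_finite)
    fix v assume "v \<in> set_pmf ?D"
    then have len: "length v = n" by (rule length_lprod)
    let ?S = "\<Sum>i<n. \<phi> (v ! i)"
    have "(\<Sum>i<Suc n. \<phi> ((v @ [x]) ! i))\<^sup>2 = ?S\<^sup>2 + 2 * ?S * \<phi> x + (\<phi> x)\<^sup>2" for x
    proof -
      have "(\<Sum>i<Suc n. \<phi> ((v @ [x]) ! i)) = ?S + \<phi> x" using len by (simp add: nth_append)
      then show ?thesis by (simp add: power2_sum)
    qed
    then show "measure_pmf.expectation J (\<lambda>x. (\<Sum>i<Suc n. \<phi> ((v @ [x]) ! i))\<^sup>2) = ?S\<^sup>2 +
        measure_pmf.expectation J (\<lambda>x. (\<phi> x)\<^sup>2)"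
      by (simp add: expectation_add_finite fin zero)
  qed
  also have "\<dots> = real (Suc n) * measure_pmf.expectation J (\<lambda>x. (\<phi> x)\<^sup>2)"
    by (simp add: expectation_add_finite finD Suc.IH algebra_simps)
  finally show ?case .
qed simp

lemma wlln_lprod:
  fixes \<phi> :: "'a \<Rightarrow> real"
  assumes fin: "finite (set_pmf J)" and \<delta>: "0 < \<delta>"
  obtains V where "\<And>n. 0 < n \<Longrightarrow> measure_pmf.prob (lprod n (\<lambda>_. J))
     {v. \<not> (\<Sum>i<n. \<phi> (v ! i)) \<le> real n * (measure_pmf.expectation J \<phi> + \<delta>)} \<le> V / real n" "0 \<le> V"
proof
  let ?\<mu> = "measure_pmf.expectation J \<phi>"
  let ?\<psi> = "\<lambda>x. \<phi> x - ?\<mu>"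
  define V where "V = measure_pmf.expectation J (\<lambda>x. (?\<psi> x)\<^sup>2) / \<delta>\<^sup>2"
  show "0 \<le> measure_pmf.expectation J (\<lambda>x. (?\<psi> x)\<^sup>2) / \<delta>\<^sup>2" by simp
  fix n :: nat assume n: "0 < n"
  let ?D = "lprod n (\<lambda>_. J)"
  let ?B = "{v. \<not> (\<Sum>i<n. \<phi> (v ! i)) \<le> real n * (?\<mu> + \<delta>)}"
  have finD: "finite (set_pmf ?D)" by (rule finite_lprod[OF fin])
  have "(real n * \<delta>)\<^sup>2 * measure_pmf.prob ?D ?B = measure_pmf.expectation ?D (\<lambda>v. (real n * \<delta>)\<^sup>2 * indicator
      ?B v)"
    by simp
  also have "\<dots> \<le> measure_pmf.expectation ?D (\<lambda>v. (\<Sum>i<n. ?\<psi> (v ! i))\<^sup>2)"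
  proof (rule expectation_mono_finite[OF finD])
    fix v
    show "(real n * \<delta>)\<^sup>2 * indicator ?B v \<le> (\<Sum>i<n. ?\<psi> (v ! i))\<^sup>2"
    proof (cases "v \<in> ?B")
      case True
      then have "real n * \<delta> \<le> (\<Sum>i<n. ?\<psi> (v ! i))" by (simp add: sum_subtractf algebra_simps)
      then have "(real n * \<delta>)\<^sup>2 \<le> (\<Sum>i<n. ?\<psi> (v ! i))\<^sup>2" by (rule power_mono) (use \<delta> in simp)
      with True show ?thesis by simp
    qed simp
  qed
  also have "\<dots> = real n * measure_pmf.expectation J (\<lambda>x. (?\<psi> x)\<^sup>2)"
    by (rule second_moment_lprod[OF fin]) (simp add: expectation_diff_finite fin)
  finally have "real n * (real n * \<delta>\<^sup>2 * measure_pmf.prob ?D ?B) \<le> real n * measure_pmf.expectation J (\<lambda>x.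
      (?\<psi> x)\<^sup>2)"
    by (simp add: power2_eq_square mult_ac)
  then have "real n * \<delta>\<^sup>2 * measure_pmf.prob ?D ?B \<le> measure_pmf.expectation J (\<lambda>x. (?\<psi> x)\<^sup>2)"
    using n by simp
  then show "measure_pmf.prob ?D ?B \<le> measure_pmf.expectation J (\<lambda>x. (?\<psi> x)\<^sup>2) / \<delta>\<^sup>2 / real n"
    using n \<delta> by (simp add: field_simps)
qed

text \<open>A union bound over the finitely many functions, each with its own Chebyshev constant;
  one constant then serves all block lengths.\<close>

lemma wlln_family:
  fixes \<Phi> :: "('a \<Rightarrow> real) set"
  assumes fin: "finite (set_pmf J)" and \<delta>: "0 < \<delta>" and \<Phi>: "finite \<Phi>"
  shows "\<exists>V\<ge>0. \<forall>n>0. measure_pmf.prob (lprod n (\<lambda>_. J))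
     {v. \<exists>\<phi>\<in>\<Phi>. \<not> (\<Sum>i<n. \<phi> (v ! i)) \<le> real n * (measure_pmf.expectation J \<phi> + \<delta>)} \<le> V / real n"
  using \<Phi>
proof (induction \<Phi> rule: finite_induct)
  case (insert \<phi> \<Phi>)
  let ?B = "\<lambda>n \<phi>. {v. \<not> (\<Sum>i<n. \<phi> (v ! i)) \<le> real n * (measure_pmf.expectation J \<phi> + \<delta>)}"
  have eq: "{v. \<exists>\<phi>\<in>A. \<not> (\<Sum>i<n. \<phi> (v ! i)) \<le> real n * (measure_pmf.expectation J \<phi> + \<delta>)} = (\<Union>\<phi>\<in>A. ?B n \<phi>)" for
      A n
    by auto
  obtain V where V: "V \<ge> 0" "\<And>n. 0 < n \<Longrightarrow> measure_pmf.prob (lprod n (\<lambda>_. J)) (\<Union>\<phi>\<in>\<Phi>. ?B n \<phi>) \<le> V / real n"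
    using insert.IH unfolding eq by blast
  obtain V' where V': "V' \<ge> 0" "\<And>n. 0 < n \<Longrightarrow> measure_pmf.prob (lprod n (\<lambda>_. J)) (?B n \<phi>) \<le> V' / real n"
    using wlln_lprod[OF fin \<delta>, of \<phi>] by metis
  have "measure_pmf.prob (lprod n (\<lambda>_. J)) (\<Union>\<phi>\<in>insert \<phi> \<Phi>. ?B n \<phi>) \<le> (V' + V) / real n" if "0 < n" for n
  proof -
    have "measure_pmf.prob (lprod n (\<lambda>_. J)) (\<Union>\<phi>\<in>insert \<phi> \<Phi>. ?B n \<phi>) \<le>
      measure_pmf.prob (lprod n (\<lambda>_. J)) (?B n \<phi>) + measure_pmf.prob (lprod n (\<lambda>_. J)) (\<Union>\<phi>\<in>\<Phi>. ?B n \<phi>)"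
      by (simp add: measure_Un_le)
    also have "\<dots> \<le> V' / real n + V / real n" by (rule add_mono[OF V'(2)[OF that] V(2)[OF that]])
    finally show ?thesis by (simp add: add_divide_distrib)
  qed
  then show ?case unfolding eq using V(1) V'(1) by (intro exI[of _ "V' + V"] conjI allI impI) simp_all
qed (auto intro!: exI[of _ 0])

section \<open>Block codes\<close>

lemma prod_le_of_sum_log:
  fixes g h :: "nat \<Rightarrow> real"
  assumes "\<And>i. i < n \<Longrightarrow> 0 < g i" "\<And>i. i < n \<Longrightarrow> 0 < h i"
    and le: "(\<Sum>i<n. log 2 (g i) - log 2 (h i)) \<le> c"
  shows "(\<Prod>i<n. g i) \<le> 2 powr c * (\<Prod>i<n. h i)"
proof -
  have lm: "log 2 (a * b) = log 2 a + log 2 b" if "0 < a" "0 < b" for a b :: real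
    using that by (simp add: log_mult)
  have l: "log 2 (\<Prod>i<n. f i) = (\<Sum>i<n. log 2 (f i))" if "\<And>i. i < n \<Longrightarrow> 0 < f i" for f :: "nat \<Rightarrow> real"
    using that
  proof (induction n)
    case (Suc n)
    have "(\<Prod>i<n. f i) > 0" by (intro prod_pos) (use Suc.prems in auto)
    moreover have "f n > 0" using Suc.prems by simp
    ultimately have "log 2 ((\<Prod>i<n. f i) * f n) = log 2 (\<Prod>i<n. f i) + log 2 (f n)"
      by (rule lm)
    then show ?case using Suc by simp
  qed simp
  have g: "0 < (\<Prod>i<n. g i)" and h: "0 < (\<Prod>i<n. h i)" using assms by (auto intro!: prod_pos)
  have "log 2 (\<Prod>i<n. g i) \<le> log 2 (2 powr c * (\<Prod>i<n. h i))"
    using le h assms by (subst lm) (auto simp: l sum_subtractf)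
  then show ?thesis using g h by simp
qed

lemma prod_le_of_sum_log1:
  fixes g :: "nat \<Rightarrow> real"
  assumes "\<And>i. i < n \<Longrightarrow> 0 < g i" and "(\<Sum>i<n. log 2 (g i)) \<le> c"
  shows "(\<Prod>i<n. g i) \<le> 2 powr c"
  using prod_le_of_sum_log[of n g "\<lambda>_. 1" c] assms by simp

lemma inj_unzip: "inj (\<lambda>l. (map fst l, map snd l))"
  by (rule injI) (metis prod.inject zip_map_fst_snd)

locale single_letter =
  fixes C :: "('s::finite, 'x1::finite, 'x2::finite, 't1::finite, 'y1::finite, 'y2::finite, 'z2::finite) zic"
    and pw :: "nat pmf" and px2 :: "nat \<Rightarrow> 'x2 pmf" and px1 :: "nat \<Rightarrow> 's \<Rightarrow> 'x1 pmf"
  assumes fin_pw: "finite (set_pmf pw)"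
begin

abbreviation "ps \<equiv> state_pmf C"

text \<open>Given the state, \<open>x1\<close> affects the receivers only through this pair. With
  the pair itself as the object to be covered, it is determined by its two components, as the second
  moment bound demands.\<close>

definition k1 :: "nat \<Rightarrow> 's \<Rightarrow> ('t1 \<times> 'y1) pmf" where
  "k1 w s = map_pmf (\<lambda>x1. (interf C x1 s, out1 C x1 s)) (px1 w s)"
definition Q1 :: "nat \<Rightarrow> 't1 pmf" where
  "Q1 w = bind_pmf ps (\<lambda>s. map_pmf fst (k1 w s))"
definition PYt1 :: "nat \<Rightarrow> 't1 \<Rightarrow> 'y2 pmf" where
  "PYt1 w t = map_pmf (\<lambda>x. out2 C x t) (px2 w)"
definition PYZt1 :: "nat \<Rightarrow> 't1 \<Rightarrow> ('y2 \<times> 'z2) pmf" where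
  "PYZt1 w t = map_pmf (\<lambda>x. (out2 C x t, crib C x)) (px2 w)"
definition PY1 :: "nat \<Rightarrow> 'y2 pmf" where "PY1 w = bind_pmf (Q1 w) (PYt1 w)"
definition PYZ1 :: "nat \<Rightarrow> ('y2 \<times> 'z2) pmf" where "PYZ1 w = bind_pmf (Q1 w) (PYZt1 w)"
definition PV1 :: "'y2 pmf" where "PV1 = bind_pmf pw PY1"

definition J :: "(nat \<times> 's \<times> ('t1 \<times> 'y1) \<times> 'x2) pmf" where
  "J = bind_pmf pw (\<lambda>w. bind_pmf ps (\<lambda>s. bind_pmf (k1 w s) (\<lambda>u. map_pmf (\<lambda>x. (w, s, u, x)) (px2 w))))"

lemma fin_J: "finite (set_pmf J)"
  unfolding J_def using fin_pw by (auto intro!: finite_imageI)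

abbreviation "jW \<equiv> \<lambda>(w, s, u, x :: 'x2). w"
abbreviation "jS \<equiv> \<lambda>(w, s, u, x :: 'x2). s"
abbreviation "jU \<equiv> \<lambda>(w, s, u :: 't1 \<times> 'y1, x :: 'x2). u"
abbreviation "jT \<equiv> \<lambda>(w, s, u :: 't1 \<times> 'y1, x :: 'x2). fst u"
abbreviation "jY \<equiv> \<lambda>(w, s, u :: 't1 \<times> 'y1, x :: 'x2). snd u"
abbreviation "jV \<equiv> \<lambda>(w, s, u :: 't1 \<times> 'y1, x). out2 C x (fst u)"
abbreviation "jZ \<equiv> \<lambda>(w, s, u :: 't1 \<times> 'y1, x). crib C x"

text \<open>This and the following are conditional entropies, except \<open>hV\<close>, which is
  unconditional. The condition comes first in each pair, to match laws of the shape
  \<open>bind_pmf p (\<lambda>x. map_pmf (Pair x) (K x))\<close>.\<close>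

definition hU :: real where
  "hU = HH J (\<lambda>\<omega>. ((jW \<omega>, jS \<omega>), jU \<omega>)) - HH J (\<lambda>\<omega>. (jW \<omega>, jS \<omega>))"
definition hTS :: real where
  "hTS = HH J (\<lambda>\<omega>. ((jW \<omega>, jS \<omega>), jT \<omega>)) - HH J (\<lambda>\<omega>. (jW \<omega>, jS \<omega>))"
definition hYS :: real where
  "hYS = HH J (\<lambda>\<omega>. ((jW \<omega>, jS \<omega>), jY \<omega>)) - HH J (\<lambda>\<omega>. (jW \<omega>, jS \<omega>))"
definition hT :: real where
  "hT = HH J (\<lambda>\<omega>. (jW \<omega>, jT \<omega>)) - HH J jW"
definition hV :: real where "hV = HH J jV"
definition hVW :: real where
  "hVW = HH J (\<lambda>\<omega>. (jW \<omega>, jV \<omega>)) - HH J jW"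
definition hVT :: real where
  "hVT = HH J (\<lambda>\<omega>. ((jW \<omega>, jT \<omega>), jV \<omega>)) - HH J (\<lambda>\<omega>. (jW \<omega>, jT \<omega>))"
definition hVZW :: real where
  "hVZW = HH J (\<lambda>\<omega>. (jW \<omega>, (jV \<omega>, jZ \<omega>))) - HH J jW"
definition hVZT :: real where
  "hVZT = HH J (\<lambda>\<omega>. ((jW \<omega>, jT \<omega>), (jV \<omega>, jZ \<omega>))) - HH J (\<lambda>\<omega>. (jW \<omega>, jT \<omega>))"

lemmas kernel_simps = J_def map_pmf_def bind_assoc_pmf bind_return_pmf

lemma kernel_U: "map_pmf (\<lambda>\<omega>. ((jW \<omega>, jS \<omega>), jU \<omega>)) J = bind_pmf (map_pmf (\<lambda>\<omega>. (jW \<omega>, jS \<omega>)) J) (\<lambda>x. map_pmf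
    (Pair x) (k1 (fst x) (snd x)))"
  by (simp add: kernel_simps)
lemma kernel_TS: "map_pmf (\<lambda>\<omega>. ((jW \<omega>, jS \<omega>), jT \<omega>)) J = bind_pmf (map_pmf (\<lambda>\<omega>. (jW \<omega>, jS \<omega>)) J) (\<lambda>x. map_pmf
    (Pair x) (map_pmf fst (k1 (fst x) (snd x))))"
  by (simp add: kernel_simps)
lemma kernel_YS: "map_pmf (\<lambda>\<omega>. ((jW \<omega>, jS \<omega>), jY \<omega>)) J = bind_pmf (map_pmf (\<lambda>\<omega>. (jW \<omega>, jS \<omega>)) J) (\<lambda>x. map_pmf
    (Pair x) (map_pmf snd (k1 (fst x) (snd x))))"
  by (simp add: kernel_simps)
lemma kernel_T: "map_pmf (\<lambda>\<omega>. (jW \<omega>, jT \<omega>)) J = bind_pmf (map_pmf jW J) (\<lambda>x. map_pmf (Pair x) (Q1 x))"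
  by (simp add: kernel_simps Q1_def)
lemma kernel_V: "map_pmf jV J = PV1"
  by (simp add: kernel_simps Q1_def PV1_def PY1_def[abs_def] PYt1_def)
lemma kernel_VW: "map_pmf (\<lambda>\<omega>. (jW \<omega>, jV \<omega>)) J = bind_pmf (map_pmf jW J) (\<lambda>x. map_pmf (Pair x) (PY1 x))"
  by (simp add: kernel_simps Q1_def PY1_def PYt1_def)
lemma kernel_VZW: "map_pmf (\<lambda>\<omega>. (jW \<omega>, (jV \<omega>, jZ \<omega>))) J = bind_pmf (map_pmf jW J) (\<lambda>x. map_pmf (Pair x) (PYZ1
    x))"
  by (simp add: kernel_simps Q1_def PYZ1_def PYZt1_def)
lemma kernel_VT: "map_pmf (\<lambda>\<omega>. ((jW \<omega>, jT \<omega>), jV \<omega>)) J = bind_pmf (map_pmf (\<lambda>\<omega>. (jW \<omega>, jT \<omega>)) J) (\<lambda>x. map_pmf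
    (Pair x) (PYt1 (fst x) (snd x)))"
  by (simp add: kernel_simps PYt1_def)
lemma kernel_VZT: "map_pmf (\<lambda>\<omega>. ((jW \<omega>, jT \<omega>), (jV \<omega>, jZ \<omega>))) J = bind_pmf (map_pmf (\<lambda>\<omega>. (jW \<omega>, jT \<omega>)) J)
    (\<lambda>x. map_pmf (Pair x) (PYZt1 (fst x) (snd x)))"
  by (simp add: kernel_simps PYZt1_def)

definition "lU = (\<lambda>\<omega>. log 2 (pmf (k1 (jW \<omega>) (jS \<omega>)) (jU \<omega>)))"
definition "lTS = (\<lambda>\<omega>. log 2 (pmf (map_pmf fst (k1 (jW \<omega>) (jS \<omega>))) (jT \<omega>)))"
definition "lYS = (\<lambda>\<omega>. log 2 (pmf (map_pmf snd (k1 (jW \<omega>) (jS \<omega>))) (jY \<omega>)))"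
definition "lT = (\<lambda>\<omega>. log 2 (pmf (Q1 (jW \<omega>)) (jT \<omega>)))"
definition "lV = (\<lambda>\<omega>. log 2 (pmf PV1 (jV \<omega>)))"
definition "lVW = (\<lambda>\<omega>. log 2 (pmf (PY1 (jW \<omega>)) (jV \<omega>)))"
definition "lVT = (\<lambda>\<omega>. log 2 (pmf (PYt1 (jW \<omega>) (jT \<omega>)) (jV \<omega>)))"
definition "lVZW = (\<lambda>\<omega>. log 2 (pmf (PYZ1 (jW \<omega>)) (jV \<omega>, jZ \<omega>)))"
definition "lVZT = (\<lambda>\<omega>. log 2 (pmf (PYZt1 (jW \<omega>) (jT \<omega>)) (jV \<omega>, jZ \<omega>)))"

lemma expectation_l:
  "measure_pmf.expectation J lU = - hU" "measure_pmf.expectation J lTS = - hTS"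
  "measure_pmf.expectation J lYS = - hYS" "measure_pmf.expectation J lT = - hT"
  "measure_pmf.expectation J lV = - hV" "measure_pmf.expectation J lVW = - hVW"
  "measure_pmf.expectation J lVT = - hVT" "measure_pmf.expectation J lVZW = - hVZW"
  "measure_pmf.expectation J lVZT = - hVZT"
  unfolding lU_def lTS_def lYS_def lT_def lV_def lVW_def lVT_def lVZW_def lVZT_def
    hU_def hTS_def hYS_def hT_def hV_def hVW_def hVT_def hVZW_def hVZT_def
  using expectation_log_kernel(1)[OF fin_J kernel_U] expectation_log_kernel(1)[OF fin_J kernel_TS]
    expectation_log_kernel(1)[OF fin_J kernel_YS] expectation_log_kernel(1)[OF fin_J kernel_T]
    expectation_log_kernel(1)[OF fin_J kernel_VW] expectation_log_kernel(1)[OF fin_J kernel_VT]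
    expectation_log_kernel(1)[OF fin_J kernel_VZW] expectation_log_kernel(1)[OF fin_J kernel_VZT]
  using HH_eq[where p = J and X = jV, unfolded kernel_V] by (simp_all add: kernel_V)

lemma l_pos:
  assumes "\<omega> \<in> set_pmf J"
  shows "0 < pmf (k1 (jW \<omega>) (jS \<omega>)) (jU \<omega>)" "0 < pmf (map_pmf fst (k1 (jW \<omega>) (jS \<omega>))) (jT \<omega>)"
    "0 < pmf (map_pmf snd (k1 (jW \<omega>) (jS \<omega>))) (jY \<omega>)" "0 < pmf (Q1 (jW \<omega>)) (jT \<omega>)"
    "0 < pmf PV1 (jV \<omega>)" "0 < pmf (PY1 (jW \<omega>)) (jV \<omega>)" "0 < pmf (PYt1 (jW \<omega>) (jT \<omega>)) (jV \<omega>)"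
    "0 < pmf (PYZ1 (jW \<omega>)) (jV \<omega>, jZ \<omega>)" "0 < pmf (PYZt1 (jW \<omega>) (jT \<omega>)) (jV \<omega>, jZ \<omega>)"
proof -
  have "jV \<omega> \<in> set_pmf (map_pmf jV J)" using assms by auto
  then show "0 < pmf PV1 (jV \<omega>)" unfolding kernel_V by (rule pmf_positive)
qed (use expectation_log_kernel(2)[OF fin_J kernel_U assms] expectation_log_kernel(2)[OF fin_J kernel_TS
    assms]
    expectation_log_kernel(2)[OF fin_J kernel_YS assms] expectation_log_kernel(2)[OF fin_J kernel_T assms]
    expectation_log_kernel(2)[OF fin_J kernel_VW assms] expectation_log_kernel(2)[OF fin_J kernel_VT assms]
    expectation_log_kernel(2)[OF fin_J kernel_VZW assms] expectation_log_kernel(2)[OF fin_J kernel_VZT assms]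
        in simp_all)

text \<open>One function for each threshold of \<open>typ1\<close> and \<open>typ2\<close>, signed
  so that the threshold is respected when the empirical mean is not too large. Hence a one-sided law
  of large numbers is enough.\<close>

definition \<Phi> :: "(nat \<times> 's \<times> ('t1 \<times> 'y1) \<times> 'x2 \<Rightarrow> real) set" where
  "\<Phi> = {\<lambda>\<omega>. lU \<omega> - lT \<omega>, \<lambda>\<omega>. lTS \<omega> - lT \<omega>, lYS, \<lambda>\<omega>. lV \<omega> - lVW \<omega>, \<lambda>\<omega>. lV \<omega> - lVT \<omega>, lVW, lVZW, lVZT, lVT}"

definition zipn :: "nat \<Rightarrow> nat list \<Rightarrow> 's list \<Rightarrow> ('t1 \<times> 'y1) list \<Rightarrow> 'x2 list \<Rightarrow> (nat \<times> 's \<times> ('t1 \<times> 'y1) \<times> 'x2)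
    list" where
  "zipn n w s u x = map (\<lambda>i. (w ! i, s ! i, u ! i, x ! i)) [0..<n]"

text \<open>Drawing the words \<open>w\<close>, \<open>s\<close>, \<open>u\<close>, \<open>x\<close>
  one after the other amounts to \<open>n\<close> independent draws from \<open>J\<close>, to which
  the weak law applies.\<close>

lemma nn_integral_zipn:
  "(\<integral>\<^sup>+w. \<integral>\<^sup>+s. \<integral>\<^sup>+u. \<integral>\<^sup>+x. F (zipn n w s u x) \<partial>measure_pmf (lprod n (\<lambda>i. px2 (w ! i)))
     \<partial>measure_pmf (lprod n (\<lambda>i. k1 (w ! i) (s ! i))) \<partial>measure_pmf (lprod n (\<lambda>_. ps)) \<partial>measure_pmf (lprod n
         (\<lambda>_. pw))) =
   (\<integral>\<^sup>+v. F v \<partial>measure_pmf (lprod n (\<lambda>_. J)))"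
proof -
  have 1: "map_pmf (zipn n w s u) (lprod n (\<lambda>i. px2 (w ! i))) = lprod n (\<lambda>i. map_pmf (\<lambda>x. (w ! i, s ! i, u !
      i, x)) (px2 (w ! i)))" for w s u
    unfolding zipn_def by (rule map_lprod)
  have 2: "bind_pmf (lprod n (\<lambda>i. k1 (w ! i) (s ! i))) (\<lambda>u. lprod n (\<lambda>i. map_pmf (\<lambda>x. (w ! i, s ! i, u ! i,
      x)) (px2 (w ! i)))) =
    lprod n (\<lambda>i. bind_pmf (k1 (w ! i) (s ! i)) (\<lambda>u. map_pmf (\<lambda>x. (w ! i, s ! i, u, x)) (px2 (w ! i))))" for w
        s
    by (rule bind_lprod[where K = "\<lambda>i u. map_pmf (\<lambda>x. (w ! i, s ! i, u, x)) (px2 (w ! i))"])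
  have 3: "bind_pmf (lprod n (\<lambda>_. ps)) (\<lambda>s. lprod n (\<lambda>i. bind_pmf (k1 (w ! i) (s ! i)) (\<lambda>u. map_pmf (\<lambda>x. (w !
      i, s ! i, u, x)) (px2 (w ! i))))) =
    lprod n (\<lambda>i. bind_pmf ps (\<lambda>s. bind_pmf (k1 (w ! i) s) (\<lambda>u. map_pmf (\<lambda>x. (w ! i, s, u, x)) (px2 (w !
        i)))))" for w
    by (rule bind_lprod[where K = "\<lambda>i s. bind_pmf (k1 (w ! i) s) (\<lambda>u. map_pmf (\<lambda>x. (w ! i, s, u, x)) (px2 (w
        ! i)))"])
  have "lprod n (\<lambda>_. J) = bind_pmf (lprod n (\<lambda>_. pw)) (\<lambda>w. bind_pmf (lprod n (\<lambda>_. ps)) (\<lambda>s.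
      bind_pmf (lprod n (\<lambda>i. k1 (w ! i) (s ! i))) (\<lambda>u. map_pmf (zipn n w s u) (lprod n (\<lambda>i. px2 (w ! i))))))"
    unfolding 1 2 3 J_def
    by (rule bind_lprod[where K = "\<lambda>i w. bind_pmf ps (\<lambda>s. bind_pmf (k1 w s) (\<lambda>u. map_pmf (\<lambda>x. (w, s, u, x))
        (px2 w)))", symmetric])
  then show ?thesis by simp
qed

end

lemma map_lprod_list: "map_pmf (map g) (lprod n P) = lprod n (\<lambda>i. map_pmf g (P i))"
proof -
  have "map_pmf (map g) (lprod n P) = map_pmf (\<lambda>xs. map (\<lambda>i. g (xs ! i)) [0..<n]) (lprod n P)"
  proof (rule map_pmf_cong[OF refl])
    fix xs assume "xs \<in> set_pmf (lprod n P)"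
    then have "length xs = n" by (rule length_lprod)
    then show "map g xs = map (\<lambda>i. g (xs ! i)) [0..<n]" by (auto simp: list_eq_iff_nth_eq)
  qed
  then show ?thesis by (simp only: map_lprod[where F = "\<lambda>_. g"])
qed

lemma finite_lists_length: "finite {xs :: 'a::finite list. length xs = n}"
  using finite_lists_length_eq[of "UNIV :: 'a set" n] by simp

locale nfold = single_letter C pw px2 px1
  for C :: "('s::finite, 'x1::finite, 'x2::finite, 't1::finite, 'y1::finite, 'y2::finite, 'z2::finite) zic"
    and pw px2 px1 +
  fixes n :: nat and \<delta> K \<eta> :: real and L M1 M2 :: nat
  assumes npos: "0 < K" "0 < \<eta>" "0 < L"
begin

text \<open>The exponent of each threshold is \<open>n\<close> times the mean of the matching
  function of \<open>\<Phi>\<close> plus \<delta>. The thresholds \<open>b0\<close> and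
  \<open>b1\<close> are lower bounds, hence the negated exponents.\<close>

sublocale os: one_shot "lprod n (\<lambda>_. pw)" "lprod n (\<lambda>_. ps)" "\<lambda>w s. lprod n (\<lambda>i. k1 (w ! i) (s ! i))"
    "\<lambda>w. lprod n (\<lambda>i. px2 (w ! i))" "map fst" "map snd" "\<lambda>x t. map (\<lambda>i. out2 C (x ! i) (t ! i)) [0..<n]" "map
        (crib C)"
    "{t. length t = n}" "{y. length y = n}" "{z. length z = n}" K
    "2 powr (real n * (hT - hU + \<delta>))" "2 powr (real n * (hT - hTS + \<delta>))" "2 powr (real n * (\<delta> - hYS))"
    "2 powr (real n * (\<delta> - hVW))" "2 powr (real n * (\<delta> - hVZW))" "2 powr (real n * (\<delta> - hVZT))" "2 powr (real
        n * (\<delta> - hVT))"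
    "2 powr - (real n * (hVW - hV + \<delta>))" "2 powr - (real n * (hVT - hV + \<delta>))" \<eta> L M1 M2
proof
  show "finite (set_pmf (lprod n (\<lambda>i. k1 (w ! i) (s ! i))))" for w s
    by (rule finite_lprod) simp
  show "u = u'" if "map fst u = map fst u'" "map snd u = map snd u'" for u u' :: "('t1 \<times> 'y1) list"
    using that injD[OF inj_unzip, of u u'] by simp
qed (use npos in \<open>auto simp: finite_lists_length dest: length_lprod\<close>)

lemma Q_n: "os.Q w = lprod n (\<lambda>i. Q1 (w ! i))"
  unfolding os.Q_def Q1_def map_lprod_list
  by (rule bind_lprod[where K = "\<lambda>i s. map_pmf fst (k1 (w ! i) s)"])

lemma PYt_n: "os.PYt w t = lprod n (\<lambda>i. PYt1 (w ! i) (t ! i))"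
  unfolding os.PYt_def PYt1_def by (rule map_lprod)

text \<open>The one-shot laws live on pairs of lists, whereas \<open>lprod\<close> yields lists of
  pairs; this injective map mediates without changing probabilities.\<close>

abbreviation "unzip \<equiv> \<lambda>l. (map fst l, map snd l)"

lemma PYZt_n: "os.PYZt w t = map_pmf unzip (lprod n (\<lambda>i. PYZt1 (w ! i) (t ! i)))"
proof -
  have "os.PYZt w t = map_pmf (\<lambda>x. unzip (map (\<lambda>i. (out2 C (x ! i) (t ! i), crib C (x ! i))) [0..<n])) (lprod
      n (\<lambda>i. px2 (w ! i)))"
    unfolding os.PYZt_def
  proof (rule map_pmf_cong[OF refl])
    fix x assume "x \<in> set_pmf (lprod n (\<lambda>i. px2 (w ! i)))"
    then have "length x = n" by (rule length_lprod)
    then show "(map (\<lambda>i. out2 C (x ! i) (t ! i)) [0..<n], map (crib C) x) = unzip (map (\<lambda>i. (out2 C (x ! i)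
        (t ! i), crib C (x ! i))) [0..<n])"
      by (auto simp: list_eq_iff_nth_eq)
  qed
  also have "\<dots> = map_pmf unzip (map_pmf (\<lambda>x. map (\<lambda>i. (out2 C (x ! i) (t ! i), crib C (x ! i))) [0..<n])
      (lprod n (\<lambda>i. px2 (w ! i))))"
    by (simp add: map_pmf_comp)
  also have "\<dots> = map_pmf unzip (lprod n (\<lambda>i. PYZt1 (w ! i) (t ! i)))"
    unfolding PYZt1_def by (subst map_lprod[where F = "\<lambda>i x. (out2 C x (t ! i), crib C x)"]) (rule refl)
  finally show ?thesis .
qed

lemma PY_n: "os.PY w = lprod n (\<lambda>i. PY1 (w ! i))"
  unfolding os.PY_def Q_n PYt_n PY1_def by (rule bind_lprod[where K = "\<lambda>i t. PYt1 (w ! i) t"])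

lemma PYZ_n: "os.PYZ w = map_pmf unzip (lprod n (\<lambda>i. PYZ1 (w ! i)))"
  unfolding os.PYZ_def Q_n PYZt_n PYZ1_def map_bind_pmf[symmetric]
  by (subst bind_lprod[where K = "\<lambda>i t. PYZt1 (w ! i) t"]) (rule refl)

lemma PV_n: "os.PV = lprod n (\<lambda>_. PV1)"
  unfolding os.PV_def PY_n PV1_def by (rule bind_lprod[where K = "\<lambda>i w. PY1 w"])

lemma pmf_unzip_lprod:
  "pmf (map_pmf unzip (lprod n P)) (map f [0..<n], map g [0..<n]) = (\<Prod>i<n. pmf (P i) (f i, g i))"
proof -
  have "pmf (map_pmf unzip (lprod n P)) (unzip (map (\<lambda>i. (f i, g i)) [0..<n])) = pmf (lprod n P) (map (\<lambda>i. (f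
      i, g i)) [0..<n])"
    by (rule pmf_map_inj'[OF inj_unzip])
  then show ?thesis by (simp add: pmf_lprod comp_def)
qed

definition bad :: "(nat \<times> 's \<times> ('t1 \<times> 'y1) \<times> 'x2) list \<Rightarrow> bool" where
  "bad v \<longleftrightarrow> (\<exists>\<phi>\<in>\<Phi>. \<not> (\<Sum>i<n. \<phi> (v ! i)) \<le> real n * (measure_pmf.expectation J \<phi> + \<delta>))"

text \<open>Each threshold compares products of letter probabilities; in logarithms it is a bound on
  a sum of one function of \<open>\<Phi>\<close> along the word. All factors are positive because
  the letters lie in the support of \<open>J\<close>.\<close>

lemma typical:
  assumes w: "w \<in> set_pmf (lprod n (\<lambda>_. pw))" and s: "s \<in> set_pmf (lprod n (\<lambda>_. ps))"
    and u: "u \<in> set_pmf (lprod n (\<lambda>i. k1 (w ! i) (s ! i)))" and x: "x \<in> set_pmf (lprod n (\<lambda>i. px2 (w ! i)))"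
    and good: "\<not> bad (zipn n w s u x)"
  shows "os.typ1 w s u" "os.typ2 w (map fst u) x"
proof -
  have len: "length w = n" "length s = n" "length u = n" "length x = n"
    using w s u x by (auto dest: length_lprod)
  define \<omega> where "\<omega> i = (w ! i, s ! i, u ! i, x ! i)" for i
  have mem: "\<omega> i \<in> set_pmf J" if "i < n" for i
    using set_lprod[OF w that] set_lprod[OF s that] set_lprod[OF u that] set_lprod[OF x that]
    unfolding J_def \<omega>_def by auto
  note pos = l_pos[OF mem, unfolded \<omega>_def prod.case]
  have good': "(\<Sum>i<n. \<phi> (\<omega> i)) \<le> real n * (measure_pmf.expectation J \<phi> + \<delta>)" if "\<phi> \<in> \<Phi>" for \<phi>
  proof -
    have "(\<Sum>i<n. \<phi> (zipn n w s u x ! i)) \<le> real n * (measure_pmf.expectation J \<phi> + \<delta>)"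
      using good that unfolding bad_def by blast
    also have "(\<Sum>i<n. \<phi> (zipn n w s u x ! i)) = (\<Sum>i<n. \<phi> (\<omega> i))"
      by (rule sum.cong) (auto simp: zipn_def \<omega>_def)
    finally show ?thesis .
  qed
  have E: "measure_pmf.expectation J (\<lambda>\<omega>. f \<omega> - g \<omega>) = measure_pmf.expectation J f - measure_pmf.expectation
      J g" for f g :: "_ \<Rightarrow> real"
    by (rule expectation_diff_finite[OF fin_J])
  have sums:
    "(\<Sum>i<n. lU (\<omega> i) - lT (\<omega> i)) \<le> real n * (hT - hU + \<delta>)"
    "(\<Sum>i<n. lTS (\<omega> i) - lT (\<omega> i)) \<le> real n * (hT - hTS + \<delta>)"
    "(\<Sum>i<n. lYS (\<omega> i)) \<le> real n * (\<delta> - hYS)"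
    "(\<Sum>i<n. lV (\<omega> i) - lVW (\<omega> i)) \<le> real n * (hVW - hV + \<delta>)"
    "(\<Sum>i<n. lV (\<omega> i) - lVT (\<omega> i)) \<le> real n * (hVT - hV + \<delta>)"
    "(\<Sum>i<n. lVW (\<omega> i)) \<le> real n * (\<delta> - hVW)"
    "(\<Sum>i<n. lVZW (\<omega> i)) \<le> real n * (\<delta> - hVZW)"
    "(\<Sum>i<n. lVZT (\<omega> i)) \<le> real n * (\<delta> - hVZT)"
    "(\<Sum>i<n. lVT (\<omega> i)) \<le> real n * (\<delta> - hVT)"
    using good'[of "\<lambda>\<omega>. lU \<omega> - lT \<omega>"] good'[of "\<lambda>\<omega>. lTS \<omega> - lT \<omega>"] good'[of lYS]
      good'[of "\<lambda>\<omega>. lV \<omega> - lVW \<omega>"] good'[of "\<lambda>\<omega>. lV \<omega> - lVT \<omega>"] good'[of lVW] good'[of lVZW] good'[of lVZT]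
          good'[of lVT]
    unfolding E expectation_l by (simp_all add: \<Phi>_def add.commute)
  note sums' = sums[unfolded lU_def lTS_def lYS_def lT_def lV_def lVW_def lVT_def lVZW_def lVZT_def \<omega>_def
      prod.case]
  have t: "map fst u = map (\<lambda>i. fst (u ! i)) [0..<n]" using len by (auto simp: list_eq_iff_nth_eq)
  have y: "map snd u = map (\<lambda>i. snd (u ! i)) [0..<n]" using len by (auto simp: list_eq_iff_nth_eq)
  have z: "map (crib C) x = map (\<lambda>i. crib C (x ! i)) [0..<n]" using len by (auto simp: list_eq_iff_nth_eq)
  have v: "map (\<lambda>i. out2 C (x ! i) (map fst u ! i)) [0..<n] = map (\<lambda>i. out2 C (x ! i) (fst (u ! i))) [0..<n]"
    using len by auto
  have P: "pmf (lprod n (\<lambda>i. k1 (w ! i) (s ! i))) u = (\<Prod>i<n. pmf (k1 (w ! i) (s ! i)) (u ! i))"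
    "pmf (os.Q w) (map fst u) = (\<Prod>i<n. pmf (Q1 (w ! i)) (fst (u ! i)))"
    "pmf (map_pmf (map fst) (lprod n (\<lambda>i. k1 (w ! i) (s ! i)))) (map fst u) = (\<Prod>i<n. pmf (map_pmf fst (k1 (w
        ! i) (s ! i))) (fst (u ! i)))"
    "pmf (map_pmf (map snd) (lprod n (\<lambda>i. k1 (w ! i) (s ! i)))) (map snd u) = (\<Prod>i<n. pmf (map_pmf snd (k1 (w
        ! i) (s ! i))) (snd (u ! i)))"
    using len by (simp_all add: pmf_lprod Q_n map_lprod_list)
  show "os.typ1 w s u"
    unfolding os.typ1_def P
    by (intro conjI prod_le_of_sum_log prod_le_of_sum_log1 pos sums')
  have P2: "pmf os.PV (map (\<lambda>i. out2 C (x ! i) (fst (u ! i))) [0..<n]) = (\<Prod>i<n. pmf PV1 (out2 C (x ! i) (fst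
      (u ! i))))"
    "pmf (os.PY w) (map (\<lambda>i. out2 C (x ! i) (fst (u ! i))) [0..<n]) = (\<Prod>i<n. pmf (PY1 (w ! i)) (out2 C (x !
        i) (fst (u ! i))))"
    "pmf (os.PYt w (map fst u)) (map (\<lambda>i. out2 C (x ! i) (fst (u ! i))) [0..<n]) = (\<Prod>i<n. pmf (PYt1 (w ! i)
        (fst (u ! i))) (out2 C (x ! i) (fst (u ! i))))"
    "pmf (os.PYZ w) (map (\<lambda>i. out2 C (x ! i) (fst (u ! i))) [0..<n], map (\<lambda>i. crib C (x ! i)) [0..<n]) =
       (\<Prod>i<n. pmf (PYZ1 (w ! i)) (out2 C (x ! i) (fst (u ! i)), crib C (x ! i)))"
    "pmf (os.PYZt w (map fst u)) (map (\<lambda>i. out2 C (x ! i) (fst (u ! i))) [0..<n], map (\<lambda>i. crib C (x ! i))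
        [0..<n]) =
       (\<Prod>i<n. pmf (PYZt1 (w ! i) (fst (u ! i))) (out2 C (x ! i) (fst (u ! i)), crib C (x ! i)))"
    using len by (simp_all add: PV_n PY_n PYt_n PYZ_n PYZt_n pmf_lprod pmf_unzip_lprod)
  have div: "2 powr - c * a \<le> b" if "a \<le> 2 powr c * b" for a b c :: real
  proof -
    have "2 powr - c * a \<le> 2 powr - c * (2 powr c * b)" by (rule mult_left_mono[OF that]) simp
    also have "\<dots> = b" by (simp add: mult.assoc[symmetric] powr_add[symmetric])
    finally show ?thesis .
  qed
  show "os.typ2 w (map fst u) x"
    unfolding os.typ2_def v z P2
    by (intro conjI div prod_le_of_sum_log prod_le_of_sum_log1 prod_pos pos sums') (auto intro: pos)
qed

lemma typicality:
  assumes V: "measure_pmf.prob (lprod n (\<lambda>_. J)) {v. bad v} \<le> \<epsilon>"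
  shows "(\<integral>\<^sup>+s. \<integral>\<^sup>+w. \<integral>\<^sup>+u. of_bool (\<not> os.typ1 w s u) \<partial>measure_pmf (lprod n (\<lambda>i. k1 (w ! i) (s ! i)))
       \<partial>measure_pmf (lprod n (\<lambda>_. pw)) \<partial>measure_pmf (lprod n (\<lambda>_. ps))) \<le> ennreal \<epsilon>" (is "?A \<le> _")
    and "(\<integral>\<^sup>+s. \<integral>\<^sup>+w. \<integral>\<^sup>+u. \<integral>\<^sup>+x. of_bool (\<not> os.typ2 w (map fst u) x) \<partial>measure_pmf (lprod n (\<lambda>i. px2 (w ! i)))
       \<partial>measure_pmf (lprod n (\<lambda>i. k1 (w ! i) (s ! i))) \<partial>measure_pmf (lprod n (\<lambda>_. pw)) \<partial>measure_pmf (lprod n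
           (\<lambda>_. ps))) \<le> ennreal \<epsilon>" (is "?B \<le> _")
proof -
  let ?N = "\<integral>\<^sup>+w. \<integral>\<^sup>+s. \<integral>\<^sup>+u. \<integral>\<^sup>+x. of_bool (bad (zipn n w s u x)) \<partial>measure_pmf (lprod n (\<lambda>i. px2 (w ! i)))
     \<partial>measure_pmf (lprod n (\<lambda>i. k1 (w ! i) (s ! i))) \<partial>measure_pmf (lprod n (\<lambda>_. ps)) \<partial>measure_pmf (lprod n
         (\<lambda>_. pw))"
  have "?N = (\<integral>\<^sup>+v. of_bool (bad v) \<partial>measure_pmf (lprod n (\<lambda>_. J)))"
    by (rule nn_integral_zipn)
  also have "\<dots> = ennreal (measure_pmf.prob (lprod n (\<lambda>_. J)) {v. bad v})"
    unfolding emeasure_of_bool[symmetric] by (rule measure_pmf.emeasure_eq_measure)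
  also have "\<dots> \<le> ennreal \<epsilon>" by (rule ennreal_leI[OF V])
  finally have N: "?N \<le> ennreal \<epsilon>" .
  have "?A = (\<integral>\<^sup>+w. \<integral>\<^sup>+s. \<integral>\<^sup>+u. \<integral>\<^sup>+x. of_bool (\<not> os.typ1 w s u) \<partial>measure_pmf (lprod n (\<lambda>i. px2 (w ! i)))
     \<partial>measure_pmf (lprod n (\<lambda>i. k1 (w ! i) (s ! i))) \<partial>measure_pmf (lprod n (\<lambda>_. ps)) \<partial>measure_pmf (lprod n
         (\<lambda>_. pw)))"
    by (subst nn_integral_pmf_commute) simp
  also have "\<dots> \<le> ?N"
    by (intro nn_integral_pmf_mono) (use typical in \<open>auto simp: of_bool_def\<close>)
  finally show "?A \<le> ennreal \<epsilon>" using N by (rule order_trans)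
  have "?B = (\<integral>\<^sup>+w. \<integral>\<^sup>+s. \<integral>\<^sup>+u. \<integral>\<^sup>+x. of_bool (\<not> os.typ2 w (map fst u) x) \<partial>measure_pmf (lprod n (\<lambda>i. px2 (w !
      i)))
     \<partial>measure_pmf (lprod n (\<lambda>i. k1 (w ! i) (s ! i))) \<partial>measure_pmf (lprod n (\<lambda>_. ps)) \<partial>measure_pmf (lprod n
         (\<lambda>_. pw)))"
    by (subst nn_integral_pmf_commute) simp
  also have "\<dots> \<le> ?N"
    by (intro nn_integral_pmf_mono) (use typical in \<open>auto simp: of_bool_def\<close>)
  finally show "?B \<le> ennreal \<epsilon>" using N by (rule order_trans)
qed

end

text \<open>The arguments of \<open>bdec2\<close> are the link of the current block, the hash of its
  cribbed sequence and its output. The hash arrives as the link of the next block, so that a block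
  is finished once the next link is known.\<close>

record ('s, 'x1, 'x2, 'y1, 'y2, 'z2) block_code =
  bx1 :: "nat \<Rightarrow> nat \<Rightarrow> 's list \<Rightarrow> 'x1 list"
  bx2 :: "nat \<Rightarrow> nat \<Rightarrow> 'x2 list"
  bhash :: "'z2 list \<Rightarrow> nat"
  bdec1 :: "'y1 list \<Rightarrow> nat"
  bdec_link :: "'y2 list \<Rightarrow> nat"
  bdec2 :: "nat \<Rightarrow> nat \<Rightarrow> 'y2 list \<Rightarrow> nat"

definition block_wf :: "nat \<Rightarrow> nat \<Rightarrow> ('s, 'x1, 'x2, 'y1, 'y2, 'z2) block_code \<Rightarrow> bool" where
  "block_wf n L b \<longleftrightarrow> (\<forall>l m s. length (bx1 b l m s) = n) \<and> (\<forall>l m. length (bx2 b l m) = n) \<and> (\<forall>z. bhash b z < L)"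

text \<open>
  The first argument of the encoders is the link index \<open>l\<close> of the current block, which both encoders
  and, after decoding, receiver 2 know; it is the hash of the cribbed sequence of the preceding block.
\<close>

definition block_ok ::
  "('s, 'x1, 'x2, 't1, 'y1, 'y2, 'z2) zic \<Rightarrow> ('s, 'x1, 'x2, 'y1, 'y2, 'z2) block_code \<Rightarrow>
   nat \<Rightarrow> nat \<Rightarrow> nat \<Rightarrow> 's list \<Rightarrow> bool" where
  "block_ok C b l m1 m2 s \<longleftrightarrow>
    (let x1 = bx1 b l m1 s; x2 = bx2 b l m2; t = map2 (interf C) x1 s;
         y1 = map2 (out1 C) x1 s; y2 = map2 (out2 C) x2 t
     in bdec1 b y1 = m1 \<and> bdec_link b y2 = l \<and> bdec2 b l (bhash b (map (crib C) x2)) y2 = m2)"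

lemma exists_le_nn_integral_pmf:
  assumes "(\<integral>\<^sup>+x. F x \<partial>measure_pmf p) \<le> ennreal e"
  shows "\<exists>x\<in>set_pmf p. F x \<le> ennreal e"
proof (rule ccontr)
  assume "\<not> (\<exists>x\<in>set_pmf p. F x \<le> ennreal e)"
  then have *: "ennreal e < F x" if "x \<in> set_pmf p" for x using that by (auto simp: not_le)
  have "(\<integral>\<^sup>+x. ennreal e \<partial>measure_pmf p) < (\<integral>\<^sup>+x. F x \<partial>measure_pmf p)"
  proof (rule nn_integral_less)
    show "AE x in measure_pmf p. ennreal e \<le> F x" using * by (auto simp: AE_measure_pmf_iff less_imp_le)
    show "\<not> (AE x in measure_pmf p. F x \<le> ennreal e)"
      using * set_pmf_not_empty[of p] by (auto simp: AE_measure_pmf_iff not_le)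
  qed simp_all
  with assms show False by simp
qed

context nfold
begin

text \<open>Any letterwise preimage of the chosen pair serves as \<open>x1\<close>, as the outputs
  depend on nothing else. The explicit range over \<open>[0..<n]\<close> and the
  \<open>mod L\<close> secure lengths and range for all arguments; on the sequences that occur they
  change nothing.\<close>

definition to_block where
  "to_block c = (case c of (\<beta>, \<gamma>, cb) \<Rightarrow>
    \<lparr> bx1 = (\<lambda>l m1 s. case cb l of (w, Th, X) \<Rightarrow>
        map (\<lambda>i. SOME x. (interf C x (s ! i), out1 C x (s ! i)) = pick (os.cand w s \<beta> Th m1) ! i) [0..<n]),
      bx2 = (\<lambda>l m2. case cb l of (w, Th, X) \<Rightarrow> map (\<lambda>i. X m2 ! i) [0..<n]),
      bhash = (\<lambda>z. \<gamma> z mod L),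
      bdec1 = \<beta>,
      bdec_link = (\<lambda>v. THE l. l < L \<and> (case cb l of (w, Th, X) \<Rightarrow> os.pass w Th v)),
      bdec2 = (\<lambda>l h v. case cb l of (w, Th, X) \<Rightarrow>
        THE m2. m2 < M2 \<and> \<gamma> (map (crib C) (X m2)) = h \<and> (\<exists>t. Th t \<and> map (\<lambda>i. out2 C (X m2 ! i) (t ! i))
            [0..<n] = v)) \<rparr>)"

lemma block_wf_to_block: "block_wf n L (to_block c)"
  using npos by (auto simp: block_wf_def to_block_def split: prod.splits)

lemma block_ok_to_block:
  assumes c: "c \<in> set_pmf os.code_pmf" and l: "l < L" and m2: "m2 < M2"
    and s: "s \<in> set_pmf (lprod n (\<lambda>_. ps))" and good: "os.good c l m1 m2 s"
  shows "block_ok C (to_block c) l m1 m2 s"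
proof -
  obtain \<beta> \<gamma> cb where c': "c = (\<beta>, \<gamma>, cb)" by (cases c)
  obtain w Th X where cb: "cb l = (w, Th, X)" by (cases "cb l")
  have \<gamma>: "\<gamma> \<in> set_pmf os.zbin_pmf" and cbs: "cb \<in> set_pmf (Pi_pmf {..<L} undefined (\<lambda>_. os.book_pmf))"
    using c unfolding c' os.code_pmf_def by auto
  have "cb l \<in> set_pmf os.book_pmf"
    using cbs l by (subst (asm) set_Pi_pmf) (auto simp: PiE_dflt_def)
  then have w: "w \<in> set_pmf (lprod n (\<lambda>_. pw))" and X: "X \<in> set_pmf (Pi_pmf {..<M2} undefined (\<lambda>_. lprod n
      (\<lambda>i. px2 (w ! i))))"
    unfolding cb os.book_pmf_def by auto
  have Xm: "length (X m2) = n"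
  proof -
    have "X m2 \<in> set_pmf (lprod n (\<lambda>i. px2 (w ! i)))"
      using X m2 by (subst (asm) set_Pi_pmf) (auto simp: PiE_dflt_def)
    then show ?thesis by (rule length_lprod)
  qed
  define u where "u = pick (os.cand w s \<beta> Th m1)"
  define t where "t = map fst u"
  define v where "v = map (\<lambda>i. out2 C (X m2 ! i) (t ! i)) [0..<n]"
  have cand: "os.cand w s \<beta> Th m1 \<noteq> {}" and ty: "os.typ2 w t (X m2)"
    and link: "\<And>l'. l' < L \<Longrightarrow> l' \<noteq> l \<Longrightarrow> \<not> (case cb l' of (w', Th', X') \<Rightarrow> os.pass w' Th' v)"
    and msg: "\<And>m. m < M2 \<Longrightarrow> m \<noteq> m2 \<Longrightarrow> \<not> (\<gamma> (map (crib C) (X m)) = \<gamma> (map (crib C) (X m2)) \<and>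
       (\<exists>t'. Th t' \<and> map (\<lambda>i. out2 C (X m ! i) (t' ! i)) [0..<n] = v))"
    using good unfolding c' os.good.simps cb by (auto simp: Let_def u_def t_def v_def)
  have "u \<in> os.cand w s \<beta> Th m1" unfolding u_def by (rule pick_in[OF cand])
  then have uA: "u \<in> os.A w s" and Th: "Th t" and \<beta>: "\<beta> (map snd u) = m1" by (auto simp: os.cand_def t_def)
  have u: "u \<in> set_pmf (lprod n (\<lambda>i. k1 (w ! i) (s ! i)))" using uA by (auto simp: os.A_def)
  have len: "length u = n" "length s = n" "length t = n" using u s by (auto dest: length_lprod simp: t_def)
  define x1 where "x1 = map (\<lambda>i. SOME x. (interf C x (s ! i), out1 C x (s ! i)) = u ! i) [0..<n]"
  have x1: "(interf C (x1 ! i) (s ! i), out1 C (x1 ! i) (s ! i)) = u ! i" if "i < n" for i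
  proof -
    have "u ! i \<in> set_pmf (k1 (w ! i) (s ! i))" by (rule set_lprod[OF u that])
    then have "\<exists>x. (interf C x (s ! i), out1 C x (s ! i)) = u ! i" by (auto simp: k1_def)
    then have "(interf C (SOME x. (interf C x (s ! i), out1 C x (s ! i)) = u ! i) (s ! i),
        out1 C (SOME x. (interf C x (s ! i), out1 C x (s ! i)) = u ! i) (s ! i)) = u ! i"
      by (rule someI_ex)
    then show ?thesis using that by (simp add: x1_def)
  qed
  have x1': "interf C (x1 ! i) (s ! i) = fst (u ! i)" "out1 C (x1 ! i) (s ! i) = snd (u ! i)" if "i < n" for i
    by (simp_all flip: x1[OF that])
  have lx: "length x1 = n" by (simp add: x1_def)
  have b1: "bx1 (to_block c) l m1 s = x1" by (simp add: to_block_def c' cb x1_def u_def)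
  have b2: "bx2 (to_block c) l m2 = X m2" using Xm by (simp add: to_block_def c' cb list_eq_iff_nth_eq)
  have tt: "map2 (interf C) x1 s = t" using len lx x1' by (auto simp: list_eq_iff_nth_eq t_def)
  have yy: "map2 (out1 C) x1 s = map snd u" using len lx x1' by (auto simp: list_eq_iff_nth_eq)
  have vv: "map2 (out2 C) (X m2) t = v" using len Xm by (auto simp: list_eq_iff_nth_eq v_def)
  have z: "\<gamma> (map (crib C) (X m2)) < L"
  proof -
    have "\<gamma> (map (crib C) (X m2)) \<in> set_pmf (pmf_of_set {..<L})"
      using \<gamma> Xm unfolding os.zbin_pmf_def by (subst (asm) set_Pi_pmf) (auto simp: PiE_dflt_def
          finite_lists_length)
    then show ?thesis using npos by (simp add: lessThan_empty_iff)
  qed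
  have pass: "os.pass w Th v" using ty Th unfolding os.typ2_def os.pass_def v_def by blast
  have "(THE l. l < L \<and> (case cb l of (w, Th, X) \<Rightarrow> os.pass w Th v)) = l"
  proof (rule the_equality)
    show "l < L \<and> (case cb l of (w, Th, X) \<Rightarrow> os.pass w Th v)" unfolding cb prod.case by (rule conjI[OF l
        pass])
    show "la = l" if "la < L \<and> (case cb la of (w, Th, X) \<Rightarrow> os.pass w Th v)" for la
    proof (rule ccontr)
      assume "la \<noteq> l"
      from link[OF conjunct1[OF that] this] conjunct2[OF that] show False by (rule notE)
    qed
  qed
  then have "bdec_link (to_block c) v = l" unfolding to_block_def c' by simp
  moreover have "bdec2 (to_block c) l (bhash (to_block c) (map (crib C) (X m2))) v = m2"
    unfolding to_block_def c' using msg m2 Th z by (auto simp: cb v_def intro!: the_equality)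
  moreover have "bdec1 (to_block c) (map snd u) = m1" using \<beta> by (simp add: to_block_def c')
  ultimately show ?thesis unfolding block_ok_def b1 b2 tt yy vv Let_def by simp
qed

text \<open>Averaging over the random code. The bound holds for each triple separately, so it also
  holds on average under any fixed law of triples, and some code of the support does at least as
  well. The code depends on that law, which therefore has to be given beforehand.\<close>

lemma exists_block:
  assumes \<mu>: "set_pmf \<mu> \<subseteq> {..<L} \<times> {..<M1} \<times> {..<M2}"
    and e: "\<And>l m1 m2. l < L \<Longrightarrow> m1 < M1 \<Longrightarrow> m2 < M2 \<Longrightarrow>
      (\<integral>\<^sup>+s. \<integral>\<^sup>+c. of_bool (\<not> os.good c l m1 m2 s) \<partial>measure_pmf os.code_pmf \<partial>measure_pmf (lprod n (\<lambda>_. ps)))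
          \<le> ennreal e"
  shows "\<exists>b. block_wf n L b \<and>
    (\<integral>\<^sup>+x. \<integral>\<^sup>+s. of_bool (\<not> block_ok C b (fst x) (fst (snd x)) (snd (snd x)) s) \<partial>measure_pmf (lprod n (\<lambda>_.
        ps)) \<partial>measure_pmf \<mu>) \<le> ennreal e"
proof -
  have "(\<integral>\<^sup>+c. \<integral>\<^sup>+x. \<integral>\<^sup>+s. of_bool (\<not> os.good c (fst x) (fst (snd x)) (snd (snd x)) s) \<partial>measure_pmf (lprod n
      (\<lambda>_. ps)) \<partial>measure_pmf \<mu> \<partial>measure_pmf os.code_pmf) =
    (\<integral>\<^sup>+x. \<integral>\<^sup>+c. \<integral>\<^sup>+s. of_bool (\<not> os.good c (fst x) (fst (snd x)) (snd (snd x)) s) \<partial>measure_pmf (lprod n (\<lambda>_.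
        ps)) \<partial>measure_pmf os.code_pmf \<partial>measure_pmf \<mu>)"
    by (rule nn_integral_pmf_commute)
  also have "\<dots> = (\<integral>\<^sup>+x. \<integral>\<^sup>+s. \<integral>\<^sup>+c. of_bool (\<not> os.good c (fst x) (fst (snd x)) (snd (snd x)) s) \<partial>measure_pmf
      os.code_pmf \<partial>measure_pmf (lprod n (\<lambda>_. ps)) \<partial>measure_pmf \<mu>)"
    by (rule nn_integral_cong) (rule nn_integral_pmf_commute)
  also have "\<dots> \<le> ennreal e"
    by (rule nn_integral_pmf_le) (use \<mu> in \<open>auto intro!: e\<close>)
  finally obtain c where c: "c \<in> set_pmf os.code_pmf"
    and le: "(\<integral>\<^sup>+x. \<integral>\<^sup>+s. of_bool (\<not> os.good c (fst x) (fst (snd x)) (snd (snd x)) s) \<partial>measure_pmf (lprod n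
        (\<lambda>_. ps)) \<partial>measure_pmf \<mu>) \<le> ennreal e"
    using exists_le_nn_integral_pmf by blast
  have "(\<integral>\<^sup>+x. \<integral>\<^sup>+s. of_bool (\<not> block_ok C (to_block c) (fst x) (fst (snd x)) (snd (snd x)) s) \<partial>measure_pmf
      (lprod n (\<lambda>_. ps)) \<partial>measure_pmf \<mu>) \<le>
    (\<integral>\<^sup>+x. \<integral>\<^sup>+s. of_bool (\<not> os.good c (fst x) (fst (snd x)) (snd (snd x)) s) \<partial>measure_pmf (lprod n (\<lambda>_. ps))
        \<partial>measure_pmf \<mu>)"
  proof (rule nn_integral_pmf_mono, rule nn_integral_pmf_mono)
    fix x s assume x: "x \<in> set_pmf \<mu>" and s: "s \<in> set_pmf (lprod n (\<lambda>_. ps))"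
    have "fst x < L" "snd (snd x) < M2" using x \<mu> by auto
    from block_ok_to_block[OF c this s, of "fst (snd x)"]
    show "(of_bool (\<not> block_ok C (to_block c) (fst x) (fst (snd x)) (snd (snd x)) s) :: ennreal) \<le>
      of_bool (\<not> os.good c (fst x) (fst (snd x)) (snd (snd x)) s)"
      by (auto simp: of_bool_def)
  qed
  with le block_wf_to_block show ?thesis by (intro exI[of _ "to_block c"]) auto
qed

end

section \<open>Balancing the rates of link, interference set and messages\<close>

lemma ceil_bounds:
  assumes "0 < (x :: real)"
  shows "real (nat \<lceil>x\<rceil>) - 1 \<le> x" "x \<le> real (nat \<lceil>x\<rceil>)" "0 < nat \<lceil>x\<rceil>"
proof -
  have "0 < \<lceil>x\<rceil>" using assms by simp
  then show "real (nat \<lceil>x\<rceil>) - 1 \<le> x" "x \<le> real (nat \<lceil>x\<rceil>)" "0 < nat \<lceil>x\<rceil>"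
    using ceiling_correct[of x] by auto
qed

context single_letter
begin

abbreviation msgs :: "nat \<Rightarrow> real \<Rightarrow> nat" where
  "msgs n r \<equiv> nat \<lceil>2 powr (real n * r)\<rceil>"

text \<open>Each covering or union term is a power of 2 whose exponent is \<open>n\<close> times a
  rate minus an entropy plus the slack \<delta> of a threshold. The margin 2 * \<delta> in the
  hypotheses outweighs that slack and leaves a decay of 2^(-n * \<delta>).\<close>

lemma block_error_exponents:
  assumes \<delta>: "0 < \<delta>" and \<epsilon>: "0 < \<epsilon>"
    and e1: "r1 + 2 * \<delta> \<le> hYS"
    and e2: "hT - hTS + 2 * \<delta> \<le> RT" "r1 + hT - hU + 2 * \<delta> \<le> RT"
    and e3: "Rl + 2 * \<delta> \<le> hV - hVW \<or> Rl + 2 * \<delta> \<le> hV - hVT - RT"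
    and e4: "r2 + 2 * \<delta> \<le> hVZT" "r2 + RT + 2 * \<delta> \<le> hVZW" "r2 - Rl + 2 * \<delta> \<le> hVT" "r2 + RT - Rl + 2 * \<delta> \<le> hVW"
  shows "\<forall>\<^sub>F n in sequentially. \<forall>\<mu>. set_pmf \<mu> \<subseteq> {..<msgs n Rl} \<times> {..<msgs n r1} \<times> {..<msgs n r2} \<longrightarrow>
    (\<exists>b. block_wf n (msgs n Rl) b \<and>
      (\<integral>\<^sup>+x. \<integral>\<^sup>+s. of_bool (\<not> block_ok C b (fst x) (fst (snd x)) (snd (snd x)) s) \<partial>measure_pmf (lprod n (\<lambda>_.
          ps)) \<partial>measure_pmf \<mu>) \<le> ennreal \<epsilon>)"
proof -
  have "finite \<Phi>" by (simp add: \<Phi>_def)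
  then obtain V where V0: "0 \<le> V" and V: "\<And>n. 0 < n \<Longrightarrow> measure_pmf.prob (lprod n (\<lambda>_. J))
     {v. \<exists>\<phi>\<in>\<Phi>. \<not> (\<Sum>i<n. \<phi> (v ! i)) \<le> real n * (measure_pmf.expectation J \<phi> + \<delta>)} \<le> V / real n"
    using wlln_family[OF fin_J \<delta>, of \<Phi>] by blast
  define \<eta> where "\<eta> = \<epsilon> / 4"
  have \<eta>: "0 < \<eta>" using \<epsilon> by (simp add: \<eta>_def)
  \<comment> \<open>The 17 collects 4 * 3 from the covering terms, 1 from the wrong links and 4 from
    the wrong messages. The fraction is the failure of typicality, and \<eta> itself adds another
    quarter of \<epsilon> below.\<close>
  have "((\<lambda>n. 17 * 2 powr (- (real n * \<delta>)) + 2 * (V / real n + V / real n / \<eta>)) \<longlongrightarrow> 0) sequentially"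
  proof -
    have "(\<lambda>n. (2 powr - \<delta>) ^ n) \<longlonglongrightarrow> 0"
      by (rule LIMSEQ_realpow_zero) (use \<delta> in \<open>auto simp: powr_less_one\<close>)
    then have "(\<lambda>n. 2 powr (- (real n * \<delta>))) \<longlonglongrightarrow> 0"
      by (simp add: powr_power mult.commute)
    moreover have "(\<lambda>n. V / real n) \<longlonglongrightarrow> 0" by (rule lim_const_over_n)
    ultimately have "(\<lambda>n. 17 * 2 powr (- (real n * \<delta>)) + 2 * (V / real n + V / real n / \<eta>)) \<longlonglongrightarrow> 17 * 0 + 2 * (0
        + 0 / \<eta>)"
      using \<eta> by (intro tendsto_intros) auto
    then show ?thesis by simp
  qed
  then have ev: "\<forall>\<^sub>F n in sequentially. 17 * 2 powr (- (real n * \<delta>)) + 2 * (V / real n + V / real n / \<eta>) < \<epsilon>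
      / 4"
    by (rule order_tendstoD) (use \<epsilon> in simp)
  show ?thesis
    using ev eventually_gt_at_top[of 0]
  proof eventually_elim
    case (elim n)
    let ?D = "2 powr (- (real n * \<delta>))"
    define K where "K = 2 powr (real n * RT)"
    define L where "L = msgs n Rl"
    define M1 where "M1 = msgs n r1"
    define M2 where "M2 = msgs n r2"
    \<comment> \<open>In the error bound the rounded-up sizes enter only as \<open>L - 1\<close>,
      \<open>M1 - 1\<close>, \<open>M2 - 1\<close> and \<open>1 / L\<close>, so the rounding costs
      nothing, even when a rate is negative and the size is 1.\<close>
    have L: "real L - 1 \<le> 2 powr (real n * Rl)" "2 powr (real n * Rl) \<le> real L" "0 < L"
      unfolding L_def by (rule ceil_bounds, simp)+
    have M1: "real M1 - 1 \<le> 2 powr (real n * r1)" "0 < M1"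
      unfolding M1_def by (rule ceil_bounds, simp)+
    have M2: "real M2 - 1 \<le> 2 powr (real n * r2)" "0 < M2"
      unfolding M2_def by (rule ceil_bounds, simp)+
    interpret nf: nfold C pw px2 px1 n \<delta> K \<eta> L M1 M2
      by unfold_locales (use \<eta> L in \<open>auto simp: K_def\<close>)
    have bad: "measure_pmf.prob (lprod n (\<lambda>_. J)) {v. nf.bad v} \<le> V / real n"
      using V[OF elim(2)] unfolding nf.bad_def .
    have Vn: "0 \<le> V / real n" using V0 by simp
    have pb: "2 powr (real n * e) \<le> ?D" if "e \<le> - \<delta>" for e
    proof -
      have "real n * e \<le> real n * - \<delta>" by (rule mult_left_mono[OF that]) simp
      then show ?thesis by simp
    qed
    have pm: "2 powr (real n * a) * 2 powr (real n * b) = 2 powr (real n * (a + b))" for a b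
      by (simp add: powr_add[symmetric] distrib_left)
    have pd: "2 powr (real n * a) / 2 powr (real n * b) = 2 powr (real n * (a - b))" for a b
      by (simp add: powr_diff[symmetric] right_diff_distrib)
    have T1: "2 powr (real n * (hT - hTS + \<delta>)) / K \<le> ?D"
      unfolding K_def pd by (rule pb) (use e2 in simp)
    have T2: "(real M1 - 1) * 2 powr (real n * (\<delta> - hYS)) \<le> ?D"
    proof -
      have "(real M1 - 1) * 2 powr (real n * (\<delta> - hYS)) \<le> 2 powr (real n * r1) * 2 powr (real n * (\<delta> - hYS))"
        by (rule mult_right_mono[OF M1(1)]) simp
      also have "\<dots> \<le> ?D" unfolding pm by (rule pb) (use e1 in simp)
      finally show ?thesis .
    qed
    have T3: "(real M1 - 1) * 2 powr (real n * (hT - hU + \<delta>)) / K \<le> ?D"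
    proof -
      have "(real M1 - 1) * 2 powr (real n * (hT - hU + \<delta>)) / K \<le> 2 powr (real n * r1) * 2 powr (real n * (hT
          - hU + \<delta>)) / K"
        by (intro divide_right_mono mult_right_mono M1(1)) (simp_all add: K_def)
      also have "\<dots> \<le> ?D" unfolding K_def pm pd by (rule pb) (use e2 in simp)
      finally show ?thesis .
    qed
    have T4: "(real L - 1) * min (1 / 2 powr - (real n * (hVW - hV + \<delta>))) (K / 2 powr - (real n * (hVT - hV +
        \<delta>))) \<le> ?D"
    proof -
      have L1: "0 \<le> real L - 1" using L by simp
      have i: "1 / 2 powr - (real n * a) = 2 powr (real n * a)" for a by (simp add: powr_minus field_simps)
      from e3 show ?thesis
      proof
        assume e: "Rl + 2 * \<delta> \<le> hV - hVW"
        have "(real L - 1) * min (1 / 2 powr - (real n * (hVW - hV + \<delta>))) (K / 2 powr - (real n * (hVT - hV +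
            \<delta>))) \<le>
          2 powr (real n * Rl) * 2 powr (real n * (hVW - hV + \<delta>))"
          by (rule mult_mono[OF L(1)]) (auto simp: i K_def)
        also have "\<dots> \<le> ?D" unfolding pm by (rule pb) (use e in simp)
        finally show ?thesis .
      next
        assume e: "Rl + 2 * \<delta> \<le> hV - hVT - RT"
        have "K / 2 powr - (real n * (hVT - hV + \<delta>)) = K * (1 / 2 powr - (real n * (hVT - hV + \<delta>)))" by simp
        also have "\<dots> = 2 powr (real n * (RT + (hVT - hV + \<delta>)))" unfolding i K_def pm ..
        finally have k: "K / 2 powr - (real n * (hVT - hV + \<delta>)) = 2 powr (real n * (RT + (hVT - hV + \<delta>)))" .
        have "(real L - 1) * min (1 / 2 powr - (real n * (hVW - hV + \<delta>))) (K / 2 powr - (real n * (hVT - hV +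
            \<delta>))) \<le>
          2 powr (real n * Rl) * 2 powr (real n * (RT + (hVT - hV + \<delta>)))"
          unfolding k by (rule mult_mono[OF L(1)]) (auto simp: i)
        also have "\<dots> \<le> ?D" unfolding pm by (rule pb) (use e in simp)
        finally show ?thesis .
      qed
    qed
    have T5: "(real M2 - 1) * nf.os.c4 \<le> 4 * ?D"
    proof -
      have Li: "1 / real L \<le> 2 powr (real n * - Rl)"
      proof -
        have "1 / real L \<le> 1 / 2 powr (real n * Rl)" using L by (intro divide_left_mono) auto
        also have "\<dots> = 2 powr (real n * - Rl)" by (simp add: powr_minus field_simps)
        finally show ?thesis .
      qed
      have dl: "2 powr (real n * a) / real L \<le> 2 powr (real n * (a - Rl))" for a
      proof -
        have "2 powr (real n * a) * (1 / real L) \<le> 2 powr (real n * a) * 2 powr (real n * - Rl)"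
          by (rule mult_left_mono[OF Li]) simp
        then show ?thesis unfolding pm by simp
      qed
      have "nf.os.c4 \<le> (2 powr (real n * (\<delta> - hVZT)) + 2 powr (real n * (\<delta> - hVT - Rl))) +
         K * (2 powr (real n * (\<delta> - hVZW)) + 2 powr (real n * (\<delta> - hVW - Rl)))"
        unfolding nf.os.c4_def by (intro add_mono mult_left_mono dl order_refl) (simp add: K_def)
      also have "\<dots> = 2 powr (real n * (\<delta> - hVZT)) + 2 powr (real n * (\<delta> - hVT - Rl)) +
         2 powr (real n * (RT + (\<delta> - hVZW))) + 2 powr (real n * (RT + (\<delta> - hVW - Rl)))"
        unfolding K_def distrib_left[of "2 powr _"] pm by simp
      finally have c: "nf.os.c4 \<le> \<dots>" .
      have "(real M2 - 1) * nf.os.c4 \<le> 2 powr (real n * r2) * (2 powr (real n * (\<delta> - hVZT)) + 2 powr (real n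
          * (\<delta> - hVT - Rl)) +
         2 powr (real n * (RT + (\<delta> - hVZW))) + 2 powr (real n * (RT + (\<delta> - hVW - Rl))))"
        by (rule mult_mono[OF M2(1) c _ nf.os.c4_nonneg]) simp
      also have "\<dots> = 2 powr (real n * (r2 + (\<delta> - hVZT))) + 2 powr (real n * (r2 + (\<delta> - hVT - Rl))) +
         2 powr (real n * (r2 + (RT + (\<delta> - hVZW)))) + 2 powr (real n * (r2 + (RT + (\<delta> - hVW - Rl))))"
        unfolding distrib_left[of "2 powr _"] pm ..
      also have "\<dots> \<le> ?D + ?D + ?D + ?D"
        by (intro add_mono pb) (use e4 in simp_all)
      finally show ?thesis by simp
    qed
    have err: "(\<integral>\<^sup>+s. \<integral>\<^sup>+c. of_bool (\<not> nf.os.good c l m1 m2 s) \<partial>measure_pmf nf.os.code_pmf \<partial>measure_pmf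
        (lprod n (\<lambda>_. ps))) \<le> ennreal \<epsilon>"
      if "l < L" "m1 < M1" "m2 < M2" for l m1 m2
    proof -
      have "4 * (2 powr (real n * (hT - hTS + \<delta>)) / K + (real M1 - 1) * 2 powr (real n * (\<delta> - hYS)) +
          (real M1 - 1) * 2 powr (real n * (hT - hU + \<delta>)) / K) + 2 * (V / real n + V / real n / \<eta>) + \<eta> +
        (real L - 1) * min (1 / 2 powr - (real n * (hVW - hV + \<delta>))) (K / 2 powr - (real n * (hVT - hV + \<delta>))) +
        (real M2 - 1) * nf.os.c4 \<le> 4 * (?D + ?D + ?D) + 2 * (V / real n + V / real n / \<eta>) + \<eta> + ?D + 4 * ?D"
        by (intro add_mono mult_left_mono order_refl T1 T2 T3 T4 T5) simp
      also have "\<dots> \<le> \<epsilon>" using elim(1) \<epsilon> by (simp add: \<eta>_def)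
      finally show ?thesis
        using nf.os.random_code_error[OF that Vn Vn nf.typicality[OF bad]] by (rule order_trans[rotated, OF
            ennreal_leI])
    qed
    show ?case
      using nf.exists_block[OF _ err] unfolding L_def M1_def M2_def by blast
  qed
qed

theorem block_codes:
  assumes r: "r1 < hYS" "r2 < hVZT" "r2 < min hV hVZW - (hT - hTS)" "r1 + r2 < hU - hTS + min hV hVZW - (hT -
      hTS)"
  shows "\<exists>Rl. \<forall>\<epsilon>>0. \<forall>\<^sub>F n in sequentially. \<forall>\<mu>. set_pmf \<mu> \<subseteq> {..<msgs n Rl} \<times> {..<msgs n r1} \<times> {..<msgs n r2} \<longrightarrow>
    (\<exists>b. block_wf n (msgs n Rl) b \<and>
      (\<integral>\<^sup>+x. \<integral>\<^sup>+s. of_bool (\<not> block_ok C b (fst x) (fst (snd x)) (snd (snd x)) s) \<partial>measure_pmf (lprod n (\<lambda>_.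
          ps)) \<partial>measure_pmf \<mu>) \<le> ennreal \<epsilon>)"
proof -
  let ?m = "min hV hVZW - (hT - hTS)"
  \<comment> \<open>A sixth of the smallest slack: 2 * \<delta> is spent in \<open>RT\<close>, 2 *
    \<delta> in \<open>Rl\<close>, and 2 * \<delta> is the margin demanded of the exponents.\<close>
  define \<delta> where "\<delta> = min (min (hYS - r1) (hVZT - r2)) (min (?m - r2) (hU - hTS + ?m - (r1 + r2))) / 6"
  have \<delta>: "0 < \<delta>" using r unfolding \<delta>_def by simp
  have "6 * \<delta> \<le> hYS - r1" "6 * \<delta> \<le> hVZT - r2" "6 * \<delta> \<le> ?m - r2" "6 * \<delta> \<le> hU - hTS + ?m - (r1 + r2)"
  proof -
    have mins: "min (min a b) (min c d) \<le> a" "min (min a b) (min c d) \<le> b" "min (min a b) (min c d) \<le> c" "min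
        (min a b) (min c d) \<le> d"
      for a b c d :: real by auto
    have \<delta>6: "6 * \<delta> = min (min (hYS - r1) (hVZT - r2)) (min (?m - r2) (hU - hTS + ?m - (r1 + r2)))"
      unfolding \<delta>_def by simp
    show "6 * \<delta> \<le> hYS - r1" "6 * \<delta> \<le> hVZT - r2" "6 * \<delta> \<le> ?m - r2" "6 * \<delta> \<le> hU - hTS + ?m - (r1 + r2)"
      unfolding \<delta>6 by (rule mins)+
  qed
  note d = this[unfolded min_def]
  \<comment> \<open>The least rate at which encoder 1 finds an interference that fits the state, and
    also one that comes with the right hash of the output.\<close>
  define RT where "RT = max (hT - hTS) (r1 + hT - hU) + 2 * \<delta>"
  \<comment> \<open>The maximum is attained by one of the two link tests, which is the disjunction
    demanded; being at least as large as the other one too, it settles both conditions on hash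
    collisions.\<close>
  define Rl where "Rl = max (hV - hVW) (hV - hVT - RT) - 2 * \<delta>"
  have RT: "r2 + RT + 4 * \<delta> \<le> hV" "r2 + RT + 4 * \<delta> \<le> hVZW"
    using d unfolding RT_def max_def by (auto split: if_splits)
  show ?thesis
  proof (intro exI[of _ Rl] allI impI, rule block_error_exponents[OF \<delta>])
    show "r1 + 2 * \<delta> \<le> hYS" "r2 + 2 * \<delta> \<le> hVZT" using d \<delta> by auto
    show "hT - hTS + 2 * \<delta> \<le> RT" "r1 + hT - hU + 2 * \<delta> \<le> RT" by (auto simp: RT_def)
    show "Rl + 2 * \<delta> \<le> hV - hVW \<or> Rl + 2 * \<delta> \<le> hV - hVT - RT" by (auto simp: Rl_def max_def)
    have Rl: "hV - hVW - 2 * \<delta> \<le> Rl" "hV - hVT - RT - 2 * \<delta> \<le> Rl" by (auto simp: Rl_def)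
    show "r2 + RT + 2 * \<delta> \<le> hVZW" "r2 - Rl + 2 * \<delta> \<le> hVT" "r2 + RT - Rl + 2 * \<delta> \<le> hVW"
      using RT Rl \<delta> by linarith+
  qed
qed

end

section \<open>Concatenating blocks\<close>

text \<open>Messages are counted from 1 and digits from 0, hence \<open>m - 1\<close>. For
  \<open>m \<le> M ^ B\<close> the digit number \<open>B\<close> is 0, so the last of
  \<open>B + 1\<close> blocks carries no message and serves only to transmit a link.\<close>

definition dig :: "nat \<Rightarrow> nat \<Rightarrow> nat \<Rightarrow> nat" where
  "dig M b m = (m - 1) div M ^ b mod M"

lemma dig_less: "0 < M \<Longrightarrow> dig M b m < M"
  by (simp add: dig_def)

lemma digits_inj:
  assumes "x < M ^ B" "y < M ^ B" "\<And>b. b < B \<Longrightarrow> x div M ^ b mod M = y div M ^ b mod (M :: nat)"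
  shows "x = y"
  using assms
proof (induction B arbitrary: x y)
  case (Suc B)
  have "x div M = y div M"
  proof (rule Suc.IH)
    show "x div M < M ^ B" "y div M < M ^ B"
      using Suc.prems(1,2) by (simp_all add: less_mult_imp_div_less mult.commute)
    show "x div M div M ^ b mod M = y div M div M ^ b mod M" if "b < B" for b
      using Suc.prems(3)[of "Suc b"] that by (simp add: div_mult2_eq)
  qed
  moreover have "x mod M = y mod M" using Suc.prems(3)[of 0] by simp
  ultimately show ?case by (metis div_mult_mod_eq)
qed simp

lemma dig_inj:
  assumes "1 \<le> m" "m \<le> M ^ B" "1 \<le> m'" "m' \<le> M ^ B" "\<And>b. b < B \<Longrightarrow> dig M b m = dig M b m'"
  shows "m = m'"
proof -
  have "m - 1 = m' - 1"
    by (rule digits_inj[of _ M B]) (use assms in \<open>auto simp: dig_def\<close>)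
  with assms show ?thesis by simp
qed

definition blk :: "nat \<Rightarrow> nat \<Rightarrow> 'a list \<Rightarrow> 'a list" where
  "blk n b xs = take n (drop (b * n) xs)"

lemma length_blk: "(b + 1) * n \<le> length xs \<Longrightarrow> length (blk n b xs) = n"
  by (simp add: blk_def algebra_simps)

lemma nth_blk: "(b + 1) * n \<le> length xs \<Longrightarrow> j < n \<Longrightarrow> blk n b xs ! j = xs ! (b * n + j)"
  by (simp add: blk_def)

lemma blk_map2: "blk n b (map2 f xs ys) = map2 f (blk n b xs) (blk n b ys)"
  by (simp add: blk_def drop_map take_map drop_zip take_zip)

lemma blk_map: "blk n b (map f xs) = map f (blk n b xs)"
  by (simp add: blk_def drop_map take_map)

lemma blk_take: "(b + 1) * n \<le> k \<Longrightarrow> blk n b (take k xs) = blk n b xs"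
  by (simp add: blk_def drop_take min_def algebra_simps)

lemma map_blk_replicate_pmf:
  assumes "(b + 1) * n \<le> N"
  shows "map_pmf (blk n b) (replicate_pmf N p) = replicate_pmf n p"
proof -
  obtain r where N: "N = b * n + (n + r)" using assms by (metis add.assoc add.commute add_mult_distrib
      le_Suc_ex mult_1)
  have "map_pmf (blk n b) (replicate_pmf N p) =
    bind_pmf (replicate_pmf (b * n) p) (\<lambda>xs. bind_pmf (replicate_pmf n p) (\<lambda>ys. bind_pmf (replicate_pmf r p)
        (\<lambda>zs. return_pmf (blk n b (xs @ ys @ zs)))))"
    unfolding N replicate_pmf_distrib by (simp add: map_bind_pmf bind_assoc_pmf bind_return_pmf)
  also have "\<dots> = bind_pmf (replicate_pmf (b * n) p) (\<lambda>xs. bind_pmf (replicate_pmf n p) (\<lambda>ys. bind_pmf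
      (replicate_pmf r p) (\<lambda>zs. return_pmf ys)))"
    by (intro bind_pmf_cong refl) (auto simp: blk_def set_replicate_pmf)
  also have "\<dots> = replicate_pmf n p" by (simp add: bind_return_pmf')
  finally show ?thesis .
qed

context
  fixes C :: "('s, 'x1, 'x2, 't1, 'y1, 'y2, 'z2) zic" and n M1 M2 :: nat
begin

text \<open>No state and no message of encoder 1 enters, so encoder 2 can compute its links in
  advance. The initial link is a convention.\<close>

primrec lnk :: "(nat \<Rightarrow> ('s, 'x1, 'x2, 'y1, 'y2, 'z2) block_code) \<Rightarrow> nat \<Rightarrow> nat \<Rightarrow> nat" where
  "lnk bs 0 m = 0"
| "lnk bs (Suc b) m = bhash (bs b) (map (crib C) (bx2 (bs b) (lnk bs b m) (dig M2 b m)))"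

lemma lnk_cong: "(\<And>i. i < b \<Longrightarrow> bs i = bs' i) \<Longrightarrow> lnk bs b m = lnk bs' b m"
  by (induction b) auto

lemma lnk_less: "0 < L \<Longrightarrow> (\<And>i. i < b \<Longrightarrow> block_wf n L (bs i)) \<Longrightarrow> lnk bs b m < L"
  by (cases b) (auto simp: block_wf_def)

text \<open>The route by which encoder 1 reaches the same index: it reads the completed preceding
  block of the cribbed sequence and nothing later, as strict causality demands.\<close>

definition lnk_crib :: "(nat \<Rightarrow> ('s, 'x1, 'x2, 'y1, 'y2, 'z2) block_code) \<Rightarrow> nat \<Rightarrow> 'z2 list \<Rightarrow> nat" where
  "lnk_crib bs b zs = (case b of 0 \<Rightarrow> 0 | Suc b' \<Rightarrow> bhash (bs b') (blk n b' zs))"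

text \<open>The default 1 keeps the decoder inside the message set for every received sequence, as
  \<open>is_code\<close> demands.\<close>

definition decode_in :: "nat set \<Rightarrow> (nat \<Rightarrow> bool) \<Rightarrow> nat" where
  "decode_in ms P = (if \<exists>m\<in>ms. P m then SOME m. m \<in> ms \<and> P m else 1)"

text \<open>Decoding asks for the message whose digits agree with all block decisions. Letters after
  the \<open>B + 1\<close> complete blocks are arbitrary, hence \<open>undefined\<close>.\<close>

definition concat_code :: "(nat \<Rightarrow> ('s, 'x1, 'x2, 'y1, 'y2, 'z2) block_code) \<Rightarrow> nat \<Rightarrow> nat set \<Rightarrow> nat set \<Rightarrow>
    ('s, 'x1, 'x2, 'y1, 'y2, 'z2) zic_code" where
  "concat_code bs B ms1 ms2 =
    \<lparr> enc1 = (\<lambda>i m ss zs. if i div n \<le> B then bx1 (bs (i div n)) (lnk_crib bs (i div n) zs) (dig M1 (i div n)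
        m) (blk n (i div n) ss) ! (i mod n) else undefined),
      enc2 = (\<lambda>i m. if i div n \<le> B then bx2 (bs (i div n)) (lnk bs (i div n) m) (dig M2 (i div n) m) ! (i mod
          n) else undefined),
      dec1 = (\<lambda>ys. decode_in ms1 (\<lambda>m. \<forall>b<B. dig M1 b m = bdec1 (bs b) (blk n b ys))),
      dec2 = (\<lambda>ys. decode_in ms2 (\<lambda>m. \<forall>b<B. dig M2 b m =
        bdec2 (bs b) (bdec_link (bs b) (blk n b ys)) (bdec_link (bs (Suc b)) (blk n (Suc b) ys)) (blk n b
            ys))) \<rparr>"

lemma decode_in_mem:
  assumes "1 \<in> ms"
  shows "decode_in ms P \<in> ms"
proof (cases "\<exists>m\<in>ms. P m")
  case True
  then have "\<exists>m. m \<in> ms \<and> P m" by blast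
  from someI_ex[OF this] show ?thesis using True by (simp only: decode_in_def if_True)
qed (use assms in \<open>simp add: decode_in_def\<close>)

lemma decode_in_eq:
  assumes "m \<in> ms" "P m" "\<And>m'. m' \<in> ms \<Longrightarrow> P m' \<Longrightarrow> m' = m"
  shows "decode_in ms P = m"
proof -
  have "(SOME m. m \<in> ms \<and> P m) = m" by (rule some_equality) (use assms in blast)+
  moreover have "\<exists>m\<in>ms. P m" using assms by blast
  ultimately show ?thesis by (simp only: decode_in_def if_True)
qed

context
  fixes bs :: "nat \<Rightarrow> ('s, 'x1, 'x2, 'y1, 'y2, 'z2) block_code" and B L N :: nat and ms1 ms2 :: "nat set"
  assumes n: "0 < n" and N: "(B + 1) * n \<le> N" and wf: "\<And>b. b \<le> B \<Longrightarrow> block_wf n L (bs b)"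
begin

abbreviation "cc \<equiv> concat_code bs B ms1 ms2"

lemma block_end: "b \<le> B \<Longrightarrow> (b + 1) * n \<le> N"
  using N mult_le_mono1[of "b + 1" "B + 1" n] by linarith

lemma blk_seq_x2:
  assumes b: "b \<le> B"
  shows "blk n b (seq_x2 cc N m2) = bx2 (bs b) (lnk bs b m2) (dig M2 b m2)"
proof (rule nth_equalityI)
  have l: "length (bx2 (bs b) (lnk bs b m2) (dig M2 b m2)) = n" using wf[OF b] by (simp add: block_wf_def)
  show "length (blk n b (seq_x2 cc N m2)) = length (bx2 (bs b) (lnk bs b m2) (dig M2 b m2))"
    unfolding l by (rule length_blk) (use block_end[OF b] in \<open>simp add: seq_x2_def\<close>)
  fix j assume "j < length (blk n b (seq_x2 cc N m2))"
  then have j: "j < n" by (simp add: blk_def)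
  have "b * n + j < N" using block_end[OF b] j by simp
  then show "blk n b (seq_x2 cc N m2) ! j = bx2 (bs b) (lnk bs b m2) (dig M2 b m2) ! j"
    using block_end[OF b] j b by (subst nth_blk) (auto simp: seq_x2_def concat_code_def)
qed

lemma blk_seq_z2:
  assumes b: "b \<le> B"
  shows "blk n b (seq_z2 C cc N m2) = map (crib C) (bx2 (bs b) (lnk bs b m2) (dig M2 b m2))"
  unfolding seq_z2_def blk_map blk_seq_x2[OF b] ..

lemma blk_seq_x1:
  assumes b: "b \<le> B"
  shows "blk n b (seq_x1 C cc N m1 m2 ss) = bx1 (bs b) (lnk bs b m2) (dig M1 b m1) (blk n b ss)"
proof (rule nth_equalityI)
  have l: "length (bx1 (bs b) (lnk bs b m2) (dig M1 b m1) (blk n b ss)) = n" using wf[OF b] by (simp add: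
      block_wf_def)
  show "length (blk n b (seq_x1 C cc N m1 m2 ss)) = length (bx1 (bs b) (lnk bs b m2) (dig M1 b m1) (blk n b
      ss))"
    unfolding l by (rule length_blk) (use block_end[OF b] in \<open>simp add: seq_x1_def\<close>)
  fix j assume "j < length (blk n b (seq_x1 C cc N m1 m2 ss))"
  then have j: "j < n" by (simp add: blk_def)
  have lt: "b * n + j < N" using block_end[OF b] j by simp
  \<comment> \<open>At any position inside block \<open>b\<close> the prefix already contains all of
    block \<open>b - 1\<close>, so truncation does not affect the hash.\<close>
  have "lnk_crib bs b (take (b * n + j) (seq_z2 C cc N m2)) = lnk bs b m2"
  proof (cases b)
    case (Suc b')
    have "blk n b' (take (b * n + j) (seq_z2 C cc N m2)) = blk n b' (seq_z2 C cc N m2)"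
      by (rule blk_take) (simp add: Suc)
    then show ?thesis using blk_seq_z2[of b' m2] b Suc by (simp add: lnk_crib_def)
  qed (simp add: lnk_crib_def)
  then show "blk n b (seq_x1 C cc N m1 m2 ss) ! j = bx1 (bs b) (lnk bs b m2) (dig M1 b m1) (blk n b ss) ! j"
    using block_end[OF b] j b lt by (subst nth_blk) (auto simp: seq_x1_def concat_code_def)
qed

text \<open>The link found in block \<open>b + 1\<close> is the hash needed for the message of block
  \<open>b\<close>. Correct links in blocks 0 to \<open>B\<close> therefore yield all
  \<open>B\<close> digits, with no error carried from block to block.\<close>

lemma concat_code_correct:
  assumes ok: "\<And>b. b \<le> B \<Longrightarrow> block_ok C (bs b) (lnk bs b m2) (dig M1 b m1) (dig M2 b m2) (blk n b ss)"
    and m1: "m1 \<in> ms1" and m2: "m2 \<in> ms2" and ms: "ms1 \<subseteq> {1..M1 ^ B}" "ms2 \<subseteq> {1..M2 ^ B}"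
  shows "dec1 cc (seq_y1 C cc N m1 m2 ss) = m1" "dec2 cc (seq_y2 C cc N m1 m2 ss) = m2"
proof -
  let ?y1 = "seq_y1 C cc N m1 m2 ss" and ?y2 = "seq_y2 C cc N m1 m2 ss"
  have y1: "bdec1 (bs b) (blk n b ?y1) = dig M1 b m1" if "b \<le> B" for b
    using ok[OF that] unfolding seq_y1_def blk_map2 blk_seq_x1[OF that] block_ok_def Let_def by simp
  have yl: "bdec_link (bs b) (blk n b ?y2) = lnk bs b m2" if "b \<le> B" for b
    using ok[OF that] unfolding seq_y2_def seq_t1_def blk_map2 blk_seq_x1[OF that] blk_seq_x2[OF that]
        block_ok_def Let_def by simp
  have y2: "bdec2 (bs b) (lnk bs b m2) (lnk bs (Suc b) m2) (blk n b ?y2) = dig M2 b m2" if "b < B" for b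
    using ok[of b] that blk_seq_x1[of b m1 m2 ss] blk_seq_x2[of b m2] unfolding seq_y2_def seq_t1_def
        blk_map2 block_ok_def Let_def by simp
  have "dec1 cc ?y1 = decode_in ms1 (\<lambda>m. \<forall>b<B. dig M1 b m = bdec1 (bs b) (blk n b ?y1))"
    by (simp add: concat_code_def)
  also have "\<dots> = m1"
  proof (rule decode_in_eq[OF m1])
    show "\<forall>b<B. dig M1 b m1 = bdec1 (bs b) (blk n b ?y1)" using y1 by simp
    fix m assume m: "m \<in> ms1" and eq: "\<forall>b<B. dig M1 b m = bdec1 (bs b) (blk n b ?y1)"
    have d: "dig M1 b m = dig M1 b m1" if "b < B" for b using eq y1[of b] that by simp
    have "m \<in> {1..M1 ^ B}" "m1 \<in> {1..M1 ^ B}" using m m1 ms by blast+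
    then show "m = m1" by (intro dig_inj[of m M1 B m1] d) auto
  qed
  finally show "dec1 cc ?y1 = m1" .
  have "dec2 cc ?y2 = decode_in ms2 (\<lambda>m. \<forall>b<B. dig M2 b m =
        bdec2 (bs b) (bdec_link (bs b) (blk n b ?y2)) (bdec_link (bs (Suc b)) (blk n (Suc b) ?y2)) (blk n b
            ?y2))"
    by (simp add: concat_code_def)
  also have "\<dots> = decode_in ms2 (\<lambda>m. \<forall>b<B. dig M2 b m = dig M2 b m2)"
  proof (rule arg_cong[where f = "decode_in ms2"], rule ext)
    fix m
    have "bdec2 (bs b) (bdec_link (bs b) (blk n b ?y2)) (bdec_link (bs (Suc b)) (blk n (Suc b) ?y2)) (blk n b
        ?y2) = dig M2 b m2"
      if "b < B" for b
      using yl[of b] yl[of "Suc b"] y2[OF that] that by (simp only: Suc_leI less_imp_le)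
    then show "(\<forall>b<B. dig M2 b m = bdec2 (bs b) (bdec_link (bs b) (blk n b ?y2)) (bdec_link (bs (Suc b)) (blk
        n (Suc b) ?y2)) (blk n b ?y2)) \<longleftrightarrow>
      (\<forall>b<B. dig M2 b m = dig M2 b m2)"
      by (simp only: cong: imp_cong)
  qed
  also have "\<dots> = m2"
  proof (rule decode_in_eq[OF m2])
    fix m assume m: "m \<in> ms2" and eq: "\<forall>b<B. dig M2 b m = dig M2 b m2"
    have "m \<in> {1..M2 ^ B}" "m2 \<in> {1..M2 ^ B}" using m m2 ms by blast+
    then show "m = m2" by (intro dig_inj[of m M2 B m2]) (auto simp: eq)
  qed simp
  finally show "dec2 cc ?y2 = m2" .
qed

end

definition block_law :: "(nat \<Rightarrow> ('s, 'x1, 'x2, 'y1, 'y2, 'z2) block_code) \<Rightarrow> (nat \<times> nat) pmf \<Rightarrow> nat \<Rightarrow> (nat \<times>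
    nat \<times> nat) pmf" where
  "block_law bs p b = map_pmf (\<lambda>(m1, m2). (lnk bs b m2, dig M1 b m1, dig M2 b m2)) p"

definition block_err :: "(nat \<times> nat \<times> nat) pmf \<Rightarrow> ('s, 'x1, 'x2, 'y1, 'y2, 'z2) block_code \<Rightarrow> ennreal" where
  "block_err \<mu> b = (\<integral>\<^sup>+x. \<integral>\<^sup>+s. of_bool (\<not> block_ok C b (fst x) (fst (snd x)) (snd (snd x)) s)
     \<partial>measure_pmf (replicate_pmf n (state_pmf C)) \<partial>measure_pmf \<mu>)"

text \<open>
  The codes are chosen block after block: the law of the link index entering a block is determined
  by the codes of the preceding blocks.
\<close>

lemma choose_blocks:
  assumes ex: "\<And>\<mu>. set_pmf \<mu> \<subseteq> {..<L} \<times> {..<M1} \<times> {..<M2} \<Longrightarrow> \<exists>b. block_wf n L b \<and> block_err \<mu> b \<le> e"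
    and pos: "0 < L" "0 < M1" "0 < M2"
  shows "\<exists>bs. \<forall>b<k. block_wf n L (bs b) \<and> block_err (block_law bs p b) (bs b) \<le> e"
proof (induction k)
  case (Suc k)
  then obtain bs where bs: "\<And>b. b < k \<Longrightarrow> block_wf n L (bs b) \<and> block_err (block_law bs p b) (bs b) \<le> e" by
      blast
  have "set_pmf (block_law bs p k) \<subseteq> {..<L} \<times> {..<M1} \<times> {..<M2}"
    unfolding block_law_def using lnk_less[of L k bs] bs pos by (auto simp: dig_less)
  then obtain c where c: "block_wf n L c" "block_err (block_law bs p k) c \<le> e" using ex by blast
  let ?bs = "bs(k := c)"
  have law: "block_law ?bs p b = block_law bs p b" if "b \<le> k" for b
  proof -
    have "lnk ?bs b = lnk bs b" by (rule ext, rule lnk_cong) (use that in auto)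
    then show ?thesis by (simp add: block_law_def)
  qed
  have "block_wf n L (?bs b) \<and> block_err (block_law ?bs p b) (?bs b) \<le> e" if "b < Suc k" for b
    using that bs c law by (cases "b = k") auto
  then show ?case by blast
qed simp

text \<open>A union bound over the blocks. The link is a function of the messages alone, hence
  independent of the states, and each block of states is a fresh i.i.d. sequence; so the failure of
  a block has exactly the law for which its code was chosen.\<close>

lemma concat_code_error:
  assumes n: "0 < n" and N: "(B + 1) * n \<le> N" and wf: "\<And>b. b \<le> B \<Longrightarrow> block_wf n L (bs b)"
    and ms: "messages N R1 \<subseteq> {1..M1 ^ B}" "messages N R2 \<subseteq> {1..M2 ^ B}"
    and err: "\<And>b. b \<le> B \<Longrightarrow> block_err (block_law bs (pair_pmf (pmf_of_set (messages N R1)) (pmf_of_set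
        (messages N R2))) b) (bs b) \<le> ennreal e"
    and e: "0 \<le> e" and fin: "finite (messages N R1)" "messages N R1 \<noteq> {}" "finite (messages N R2)" "messages
        N R2 \<noteq> {}"
  defines "c \<equiv> concat_code bs B (messages N R1) (messages N R2)"
  shows "error_prob1 C N R1 R2 c \<le> real (B + 1) * e" "error_prob2 C N R1 R2 c \<le> real (B + 1) * e"
proof -
  let ?P = "pair_pmf (pmf_of_set (messages N R1)) (pmf_of_set (messages N R2))"
  let ?bad = "\<lambda>b m1 m2 ss. \<not> block_ok C (bs b) (lnk bs b m2) (dig M1 b m1) (dig M2 b m2) (blk n b ss)"
  have union: "(\<integral>\<^sup>+x. of_bool (F x) \<partial>measure_pmf (source_pmf C N R1 R2)) \<le> ennreal (real (B + 1) * e)"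
    if F: "\<And>m1 m2 ss. m1 \<in> messages N R1 \<Longrightarrow> m2 \<in> messages N R2 \<Longrightarrow> F (m1, m2, ss) \<Longrightarrow> \<exists>b\<le>B. ?bad b m1 m2 ss" for F
  proof -
    have "(\<integral>\<^sup>+x. of_bool (F x) \<partial>measure_pmf (source_pmf C N R1 R2)) \<le>
      (\<integral>\<^sup>+x. (\<Sum>b\<le>B. of_bool (?bad b (fst x) (fst (snd x)) (snd (snd x)))) \<partial>measure_pmf (source_pmf C N R1
          R2))"
    proof (rule nn_integral_pmf_mono)
      fix x assume x: "x \<in> set_pmf (source_pmf C N R1 R2)"
      show "(of_bool (F x) :: ennreal) \<le> (\<Sum>b\<le>B. of_bool (?bad b (fst x) (fst (snd x)) (snd (snd x))))"
      proof (cases "F x")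
        case True
        have "fst x \<in> messages N R1" "fst (snd x) \<in> messages N R2" using x fin by (auto simp: source_pmf_def)
        with F[of "fst x" "fst (snd x)" "snd (snd x)"] True obtain b where b: "b \<le> B" "?bad b (fst x) (fst
            (snd x)) (snd (snd x))" by auto
        have "(of_bool (F x) :: ennreal) \<le> of_bool (?bad b (fst x) (fst (snd x)) (snd (snd x)))" using b by
            simp
        also have "\<dots> \<le> (\<Sum>b\<le>B. of_bool (?bad b (fst x) (fst (snd x)) (snd (snd x))))"
          by (rule member_le_sum) (use b in auto)
        finally show ?thesis .
      qed simp
    qed
    also have "\<dots> = (\<Sum>b\<le>B. \<integral>\<^sup>+x. of_bool (?bad b (fst x) (fst (snd x)) (snd (snd x))) \<partial>measure_pmf (source_pmf
        C N R1 R2))"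
      by (rule nn_integral_sum) simp
    also have "\<dots> \<le> (\<Sum>b\<le>B. ennreal e)"
    proof (rule sum_mono)
      fix b assume "b \<in> {..B}"
      then have b: "b \<le> B" by simp
      have bN: "(b + 1) * n \<le> N" using N b mult_le_mono1[of "b + 1" "B + 1" n] by linarith
      have "(\<integral>\<^sup>+x. of_bool (?bad b (fst x) (fst (snd x)) (snd (snd x))) \<partial>measure_pmf (source_pmf C N R1 R2)) =
        (\<integral>\<^sup>+m1. \<integral>\<^sup>+m2. \<integral>\<^sup>+ss. of_bool (\<not> block_ok C (bs b) (lnk bs b m2) (dig M1 b m1) (dig M2 b m2) (blk n b
            ss)) \<partial>measure_pmf (replicate_pmf N (state_pmf C))
          \<partial>measure_pmf (pmf_of_set (messages N R2)) \<partial>measure_pmf (pmf_of_set (messages N R1)))"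
        unfolding source_pmf_def nn_integral_pair_pmf' by simp
      also have "\<dots> = (\<integral>\<^sup>+m1. \<integral>\<^sup>+m2. \<integral>\<^sup>+s. of_bool (\<not> block_ok C (bs b) (lnk bs b m2) (dig M1 b m1) (dig M2 b
          m2) s) \<partial>measure_pmf (replicate_pmf n (state_pmf C))
          \<partial>measure_pmf (pmf_of_set (messages N R2)) \<partial>measure_pmf (pmf_of_set (messages N R1)))"
        unfolding map_blk_replicate_pmf[OF bN, of "state_pmf C", symmetric] by simp
      also have "\<dots> = block_err (block_law bs ?P b) (bs b)"
        unfolding block_err_def block_law_def by (simp add: nn_integral_pair_pmf' case_prod_unfold)
      also have "\<dots> \<le> ennreal e" by (rule err[OF b])
      finally show "(\<integral>\<^sup>+x. of_bool (?bad b (fst x) (fst (snd x)) (snd (snd x))) \<partial>measure_pmf (source_pmf C N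
          R1 R2)) \<le> ennreal e" .
    qed
    also have "\<dots> = ennreal (real (B + 1) * e)"
      using e by (subst sum_ennreal) auto
    finally show ?thesis .
  qed
  have toprob: "measure_pmf.prob (source_pmf C N R1 R2) {x. F x} \<le> real (B + 1) * e"
    if "\<And>m1 m2 ss. m1 \<in> messages N R1 \<Longrightarrow> m2 \<in> messages N R2 \<Longrightarrow> F (m1, m2, ss) \<Longrightarrow> \<exists>b\<le>B. ?bad b m1 m2 ss" for F
  proof -
    have "ennreal (measure_pmf.prob (source_pmf C N R1 R2) {x. F x}) \<le> ennreal (real (B + 1) * e)"
      using union[of F, OF that] unfolding emeasure_of_bool[symmetric] measure_pmf.emeasure_eq_measure .
    then show ?thesis using e by (subst (asm) ennreal_le_iff) auto
  qed
  have corr: "dec1 c (seq_y1 C c N m1 m2 ss) = m1 \<and> dec2 c (seq_y2 C c N m1 m2 ss) = m2"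
    if m: "m1 \<in> messages N R1" "m2 \<in> messages N R2" and "\<not> (\<exists>b\<le>B. ?bad b m1 m2 ss)" for m1 m2 ss
  proof -
    have ok: "block_ok C (bs b) (lnk bs b m2) (dig M1 b m1) (dig M2 b m2) (blk n b ss)" if "b \<le> B" for b
      using \<open>\<not> (\<exists>b\<le>B. _ b)\<close> that by blast
    show ?thesis
      unfolding c_def by (intro conjI concat_code_correct[OF n N wf ok m ms])
  qed
  show "error_prob1 C N R1 R2 c \<le> real (B + 1) * e"
    unfolding error_prob1_def
  proof (rule toprob)
    fix m1 m2 ss
    assume m: "m1 \<in> messages N R1" "m2 \<in> messages N R2" and "case (m1, m2, ss) of (m1, m2, ss) \<Rightarrow> dec1 c
        (seq_y1 C c N m1 m2 ss) \<noteq> m1"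
    then have "dec1 c (seq_y1 C c N m1 m2 ss) \<noteq> m1" by simp
    then show "\<exists>b\<le>B. ?bad b m1 m2 ss" using corr[OF m, of ss] by blast
  qed
  show "error_prob2 C N R1 R2 c \<le> real (B + 1) * e"
    unfolding error_prob2_def
  proof (rule toprob)
    fix m1 m2 ss
    assume m: "m1 \<in> messages N R1" "m2 \<in> messages N R2" and "case (m1, m2, ss) of (m1, m2, ss) \<Rightarrow> dec2 c
        (seq_y2 C c N m1 m2 ss) \<noteq> m2"
    then have "dec2 c (seq_y2 C c N m1 m2 ss) \<noteq> m2" by simp
    then show "\<exists>b\<le>B. ?bad b m1 m2 ss" using corr[OF m, of ss] by blast
  qed
qed

end

text \<open>The case \<open>R = 0\<close> stands apart because \<open>r\<close> may then be
  negative: there is a single message, and \<open>M ^ B\<close> is at least 1 anyway.\<close>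

lemma messages_subset:
  assumes M: "2 powr (real n * r) \<le> real M" and c: "R = 0 \<or> real N * R \<le> real n * real B * r" and pos: "0 < M"
  shows "messages N R \<subseteq> {1..M ^ B}"
proof -
  have "2 powr (real N * R) \<le> real (M ^ B)"
  proof (cases "R = 0")
    case True
    then show ?thesis using pos by (simp add: Suc_leI)
  next
    case False
    then have "2 powr (real N * R) \<le> 2 powr (real n * r * real B)" using c by (simp add: mult_ac)
    also have "\<dots> = (2 powr (real n * r)) ^ B" by (simp add: powr_power mult_ac)
    also have "\<dots> \<le> real M ^ B" by (rule power_mono[OF M]) simp
    finally show ?thesis by simp
  qed
  then have "\<lceil>2 powr (real N * R)\<rceil> \<le> int (M ^ B)" by (simp add: ceiling_le_iff)
  then have "nat \<lceil>2 powr (real N * R)\<rceil> \<le> M ^ B" by (simp add: nat_le_iff)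
  then show ?thesis by (auto simp: messages_def)
qed

lemma messages_finite_nonempty: "finite (messages N R)" "messages N R \<noteq> {}" "1 \<in> messages N R"
proof -
  have "1 \<le> nat \<lceil>2 powr (real N * R)\<rceil>"
    using ceil_bounds(3)[of "2 powr (real N * R)"] by (simp only: Suc_le_eq One_nat_def powr_gt_zero)
  then show "finite (messages N R)" "messages N R \<noteq> {}" "1 \<in> messages N R"
    by (auto simp: messages_def)
qed

text \<open>Two losses are covered: the last block carries no message, which the strict inequality
  for \<open>B\<close> absorbs, and up to \<open>B\<close> letters are left over, which becomes
  negligible as \<open>n\<close> grows.\<close>

lemma rate_loss_eventually:
  assumes "R = 0 \<or> 0 \<le> R \<and> real (B + 1) * R < real B * r"
  shows "\<forall>\<^sub>F n in sequentially. \<forall>N \<le> (n + 1) * (B + 1). R = 0 \<or> real N * R \<le> real n * real B * r"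
proof (cases "R = 0")
  case False
  then have R: "0 \<le> R" and lt: "real (B + 1) * R < real B * r" using assms by auto
  define d where "d = real B * r - real (B + 1) * R"
  have d: "0 < d" using lt by (simp add: d_def)
  have "\<forall>\<^sub>F n in sequentially. real (B + 1) * R / d \<le> real n"
    by (rule eventually_ge_at_top[THEN eventually_compose_filterlim[OF _ filterlim_real_sequentially]])
  then show ?thesis
  proof eventually_elim
    case (elim n)
    then have "real (B + 1) * R \<le> real n * d" using d by (simp add: field_simps)
    then have "real (n + 1) * real (B + 1) * R \<le> real n * real B * r" by (simp add: d_def algebra_simps)
    moreover have "real N * R \<le> real (n + 1) * real (B + 1) * R" if "N \<le> (n + 1) * (B + 1)" for N
    proof -
      have "real N \<le> real (n + 1) * real (B + 1)" using that by (metis of_nat_le_iff of_nat_mult)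
      then show ?thesis by (rule mult_right_mono[OF _ R])
    qed
    ultimately show ?case by (meson order_trans)
  qed
qed simp

lemma exists_block_number:
  assumes "R1 = 0 \<or> 0 \<le> R1 \<and> R1 < r1" "R2 = 0 \<or> 0 \<le> R2 \<and> R2 < (r2 :: real)"
  obtains B :: nat where "R1 = 0 \<or> 0 \<le> R1 \<and> real (B + 1) * R1 < real B * r1"
    "R2 = 0 \<or> 0 \<le> R2 \<and> real (B + 1) * R2 < real B * r2"
proof -
  have one: "\<forall>\<^sub>F B in sequentially. R = 0 \<or> 0 \<le> R \<and> real (B + 1) * R < real B * r" if "R = 0 \<or> 0 \<le> R \<and> R < r"
      for R r :: real
  proof (cases "R = 0")
    case False
    then have R: "0 \<le> R" "R < r" using that by auto
    have "\<forall>\<^sub>F B in sequentially. R / (r - R) < real B"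
      by (rule eventually_gt_at_top[THEN eventually_compose_filterlim[OF _ filterlim_real_sequentially]])
    then show ?thesis
      by eventually_elim (use R in \<open>simp add: field_simps\<close>)
  qed simp
  from eventually_happens'[OF _ eventually_conj[OF one[OF assms(1)] one[OF assms(2)]]] that show ?thesis by
      auto
qed

text \<open>The number of blocks is fixed by the gaps between the rates alone, before \<epsilon> and
  the block length. So the union bound costs only the constant factor \<open>B + 1\<close>, which is
  built into the error demanded of each block.\<close>

theorem achievable_of_blocks:
  fixes C :: "('s, 'x1, 'x2, 't1, 'y1, 'y2, 'z2) zic"
  assumes R: "R1 = 0 \<or> 0 \<le> R1 \<and> R1 < r1" "R2 = 0 \<or> 0 \<le> R2 \<and> R2 < r2"
    and blocks: "\<And>\<epsilon>. 0 < \<epsilon> \<Longrightarrow> \<forall>\<^sub>F n in sequentially. \<forall>\<mu>. set_pmf \<mu> \<subseteq> {..<nat \<lceil>2 powr (real n * Rl)\<rceil>} \<times> {..<nat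
        \<lceil>2 powr (real n * r1)\<rceil>} \<times> {..<nat \<lceil>2 powr (real n * r2)\<rceil>} \<longrightarrow>
      (\<exists>b :: ('s, 'x1, 'x2, 'y1, 'y2, 'z2) block_code. block_wf n (nat \<lceil>2 powr (real n * Rl)\<rceil>) b \<and> block_err
          C n \<mu> b \<le> ennreal \<epsilon>)"
  shows "achievable C R1 R2"
proof -
  obtain B :: nat where B: "R1 = 0 \<or> 0 \<le> R1 \<and> real (B + 1) * R1 < real B * r1"
    "R2 = 0 \<or> 0 \<le> R2 \<and> real (B + 1) * R2 < real B * r2"
    using exists_block_number[OF R] by blast
  have "\<forall>\<^sub>F N in sequentially. \<exists>c :: ('s, 'x1, 'x2, 'y1, 'y2, 'z2) zic_code. is_code N R1 R2 c \<and> error_prob1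
      C N R1 R2 c \<le> \<epsilon> \<and> error_prob2 C N R1 R2 c \<le> \<epsilon>"
    if \<epsilon>: "0 < \<epsilon>" for \<epsilon>
  proof -
    define e where "e = \<epsilon> / real (B + 1)"
    have e: "0 < e" using \<epsilon> by (simp add: e_def)
    have "\<forall>\<^sub>F N in sequentially. N div (B + 1) > 0 \<and> (\<forall>\<mu>. set_pmf \<mu> \<subseteq> {..<nat \<lceil>2 powr (real (N div (B + 1)) *
        Rl)\<rceil>} \<times> {..<nat \<lceil>2 powr (real (N div (B + 1)) * r1)\<rceil>} \<times> {..<nat \<lceil>2 powr (real (N div (B + 1)) * r2)\<rceil>}
        \<longrightarrow>
      (\<exists>b :: ('s, 'x1, 'x2, 'y1, 'y2, 'z2) block_code. block_wf (N div (B + 1)) (nat \<lceil>2 powr (real (N div (B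
          + 1)) * Rl)\<rceil>) b \<and> block_err C (N div (B + 1)) \<mu> b \<le> ennreal e)) \<and>
      (\<forall>N' \<le> (N div (B + 1) + 1) * (B + 1). R1 = 0 \<or> real N' * R1 \<le> real (N div (B + 1)) * real B * r1) \<and>
      (\<forall>N' \<le> (N div (B + 1) + 1) * (B + 1). R2 = 0 \<or> real N' * R2 \<le> real (N div (B + 1)) * real B * r2)"
      by (rule eventually_compose_filterlim[OF _ filterlim_at_top_div_const_nat])
        (intro eventually_conj eventually_gt_at_top blocks[OF e] rate_loss_eventually[OF B(1)]
            rate_loss_eventually[OF B(2)], simp)
    then show ?thesis
    proof eventually_elim
      case (elim N)
      define n where "n = N div (B + 1)"
      define L where "L = nat \<lceil>2 powr (real n * Rl)\<rceil>"
      define M1 where "M1 = nat \<lceil>2 powr (real n * r1)\<rceil>"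
      define M2 where "M2 = nat \<lceil>2 powr (real n * r2)\<rceil>"
      have n: "0 < n" and ex: "\<And>\<mu>. set_pmf \<mu> \<subseteq> {..<L} \<times> {..<M1} \<times> {..<M2} \<Longrightarrow> \<exists>b :: ('s, 'x1, 'x2, 'y1, 'y2,
          'z2) block_code. block_wf n L b \<and> block_err C n \<mu> b \<le> ennreal e"
        using elim unfolding n_def L_def M1_def M2_def by blast+
      have nN: "(B + 1) * n \<le> N" unfolding n_def by (rule times_div_less_eq_dividend)
      have Nn: "N \<le> (n + 1) * (B + 1)"
      proof -
        have "N = n * (B + 1) + N mod (B + 1)" unfolding n_def by (rule div_mult_mod_eq[symmetric])
        moreover have "N mod (B + 1) < B + 1" by (rule mod_less_divisor) simp
        moreover have "(n + 1) * (B + 1) = n * (B + 1) + (B + 1)" by (simp only: add_mult_distrib mult_1)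
        ultimately show ?thesis by linarith
      qed
      have pos: "0 < L" "0 < M1" "0 < M2" unfolding L_def M1_def M2_def by (simp_all add: ceil_bounds(3))
      have ms: "messages N R1 \<subseteq> {1..M1 ^ B}" "messages N R2 \<subseteq> {1..M2 ^ B}"
      proof -
        have c: "R1 = 0 \<or> real N * R1 \<le> real n * real B * r1" "R2 = 0 \<or> real N * R2 \<le> real n * real B * r2"
          using elim Nn unfolding n_def by blast+
        have m: "2 powr (real n * r1) \<le> real M1" "2 powr (real n * r2) \<le> real M2"
          unfolding M1_def M2_def by (rule ceil_bounds(2), simp)+
        show "messages N R1 \<subseteq> {1..M1 ^ B}" "messages N R2 \<subseteq> {1..M2 ^ B}"
          by (rule messages_subset[OF m(1) c(1) pos(2)], rule messages_subset[OF m(2) c(2) pos(3)])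
      qed
      let ?p = "pair_pmf (pmf_of_set (messages N R1)) (pmf_of_set (messages N R2))"
      obtain bs where bs: "\<And>b. b < B + 1 \<Longrightarrow> block_wf n L (bs b) \<and> block_err C n (block_law C M1 M2 bs ?p b)
          (bs b) \<le> ennreal e"
        using choose_blocks[of L M1 M2 n C "ennreal e" "B + 1" ?p, OF ex pos] by blast
      let ?c = "concat_code C n M1 M2 bs B (messages N R1) (messages N R2)"
      have "error_prob1 C N R1 R2 ?c \<le> real (B + 1) * e" "error_prob2 C N R1 R2 ?c \<le> real (B + 1) * e"
        by (rule concat_code_error[OF n nN _ ms _ less_imp_le[OF e] messages_finite_nonempty(1,2)
            messages_finite_nonempty(1,2), where L = L];
            use bs in simp)+
      moreover have "is_code N R1 R2 ?c"
        by (auto simp: is_code_def concat_code_def intro!: decode_in_mem[OF messages_finite_nonempty(3)])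
      ultimately show ?case by (intro exI[of _ ?c]) (simp add: e_def)
    qed
  qed
  then show ?thesis unfolding achievable_def using R by auto
qed

section \<open>The single-letter region\<close>

lemma integral_count_space_pmf:
  fixes f :: "'a \<Rightarrow> real"
  shows "(\<integral>x. pmf q x * f x \<partial>count_space UNIV) = measure_pmf.expectation q f"
  unfolding measure_pmf_eq_density by (subst integral_density) auto

lemma pmf_entropy_HH:
  fixes X :: "'a \<Rightarrow> 'b::countable"
  shows "pmf_entropy p X = HH p X"
  unfolding pmf_entropy_eq ent_def integral_count_space_pmf ..

lemma pmf_cond_entropy_HH:
  fixes X :: "'a \<Rightarrow> 'b::countable" and Y :: "'a \<Rightarrow> 'c::countable"
  assumes fin: "finite (set_pmf p)"
  shows "pmf_cond_entropy p X Y = HH p (\<lambda>\<omega>. (X \<omega>, Y \<omega>)) - HH p Y"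
proof -
  let ?q = "map_pmf (\<lambda>w. (X w, Y w)) p"
  have "(\<integral>(x,y). pmf ?q (x,y) * log 2 (pmf ?q (x,y) / pmf (map_pmf Y p) y) \<partial>count_space UNIV) =
    (\<integral>z. pmf ?q z * log 2 (pmf ?q z / pmf (map_pmf Y p) (snd z)) \<partial>count_space UNIV)"
    by (simp add: case_prod_unfold)
  also have "\<dots> = measure_pmf.expectation p (\<lambda>\<omega>. log 2 (pmf ?q (X \<omega>, Y \<omega>) / pmf (map_pmf Y p) (Y \<omega>)))"
    unfolding integral_count_space_pmf by simp
  also have "\<dots> = measure_pmf.expectation p (\<lambda>\<omega>. log 2 (pmf ?q (X \<omega>, Y \<omega>)) - log 2 (pmf (map_pmf Y p) (Y \<omega>)))"
  proof (rule expectation_cong_finite)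
    fix \<omega> assume "\<omega> \<in> set_pmf p"
    then have "0 < pmf ?q (X \<omega>, Y \<omega>)" "0 < pmf (map_pmf Y p) (Y \<omega>)" by (auto simp: pmf_positive_iff)
    then show "log 2 (pmf ?q (X \<omega>, Y \<omega>) / pmf (map_pmf Y p) (Y \<omega>)) = log 2 (pmf ?q (X \<omega>, Y \<omega>)) - log 2 (pmf
        (map_pmf Y p) (Y \<omega>))"
      by (simp add: log_divide)
  qed
  finally show ?thesis
    unfolding pmf_cond_entropy_eq HH_eq by (simp add: expectation_diff_finite fin)
qed

lemma pmf_cond_mutual_info_HH:
  fixes X :: "'a \<Rightarrow> 'b::countable" and Y :: "'a \<Rightarrow> 'c::countable" and Z :: "'a \<Rightarrow> 'd::countable"
  assumes fin: "finite (set_pmf p)"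
  shows "pmf_cond_mutual_info p X Y Z =
    HH p (\<lambda>\<omega>. (X \<omega>, Z \<omega>)) + HH p (\<lambda>\<omega>. (Y \<omega>, Z \<omega>)) - HH p (\<lambda>\<omega>. (X \<omega>, Y \<omega>, Z \<omega>)) - HH p Z"
proof -
  let ?q = "map_pmf (\<lambda>w. (X w, Y w, Z w)) p"
  let ?a = "map_pmf (\<lambda>w. (X w, Z w)) p" and ?b = "map_pmf (\<lambda>w. (Y w, Z w)) p" and ?c = "map_pmf Z p"
  have "pmf_cond_mutual_info p X Y Z = (\<integral>(x,y,z). pmf ?q (x,y,z) * log 2 (pmf ?q (x,y,z) / (pmf ?a (x,z) *
      (pmf ?b (y,z) / pmf ?c z))) \<partial>count_space UNIV)"
    by (rule pmf_cond_mutual_info_eq) (use fin in auto)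
  also have "\<dots> = (\<integral>t. pmf ?q t * log 2 (pmf ?q t / (pmf ?a (fst t, snd (snd t)) * (pmf ?b (snd t) / pmf ?c
      (snd (snd t))))) \<partial>count_space UNIV)"
    by (simp add: case_prod_unfold)
  also have "\<dots> = measure_pmf.expectation p (\<lambda>\<omega>. log 2 (pmf ?q (X \<omega>, Y \<omega>, Z \<omega>) / (pmf ?a (X \<omega>, Z \<omega>) * (pmf ?b
      (Y \<omega>, Z \<omega>) / pmf ?c (Z \<omega>)))))"
    unfolding integral_count_space_pmf by simp
  also have "\<dots> = measure_pmf.expectation p (\<lambda>\<omega>. (log 2 (pmf ?q (X \<omega>, Y \<omega>, Z \<omega>)) + log 2 (pmf ?c (Z \<omega>))) -
      (log 2 (pmf ?a (X \<omega>, Z \<omega>)) + log 2 (pmf ?b (Y \<omega>, Z \<omega>))))"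
  proof (rule expectation_cong_finite)
    fix \<omega> assume "\<omega> \<in> set_pmf p"
    then have "0 < pmf ?q (X \<omega>, Y \<omega>, Z \<omega>)" "0 < pmf ?a (X \<omega>, Z \<omega>)" "0 < pmf ?b (Y \<omega>, Z \<omega>)" "0 < pmf ?c (Z \<omega>)"
      by (auto simp: pmf_positive_iff)
    then show "log 2 (pmf ?q (X \<omega>, Y \<omega>, Z \<omega>) / (pmf ?a (X \<omega>, Z \<omega>) * (pmf ?b (Y \<omega>, Z \<omega>) / pmf ?c (Z \<omega>)))) =
      (log 2 (pmf ?q (X \<omega>, Y \<omega>, Z \<omega>)) + log 2 (pmf ?c (Z \<omega>))) - (log 2 (pmf ?a (X \<omega>, Z \<omega>)) + log 2 (pmf ?b (Y
          \<omega>, Z \<omega>)))"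
      by (simp add: log_divide log_mult)
  qed
  finally show ?thesis
    unfolding HH_eq by (simp add: expectation_diff_finite expectation_add_finite fin)
qed

abbreviation "rvW \<equiv> \<lambda>(w, s, x1, x2). w"
abbreviation "rvS \<equiv> \<lambda>(w, s, x1, x2). s"
abbreviation "rvT C \<equiv> \<lambda>(w, s, x1, x2). interf C x1 s"
abbreviation "rvY1 C \<equiv> \<lambda>(w, s, x1, x2). out1 C x1 s"
abbreviation "rvY2 C \<equiv> \<lambda>(w, s, x1, x2). out2 C x2 (interf C x1 s)"
abbreviation "rvZ C \<equiv> \<lambda>(w, s, x1, x2). crib C x2"

definition cH :: "'a pmf \<Rightarrow> ('a \<Rightarrow> 'b) \<Rightarrow> ('a \<Rightarrow> 'c) \<Rightarrow> real" where
  "cH p X Y = HH p (\<lambda>\<omega>. (X \<omega>, Y \<omega>)) - HH p Y"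

definition "HY1_WS C p = cH p (rvY1 C) (\<lambda>\<omega>. (rvW \<omega>, rvS \<omega>))"
definition "HYZ_TW C p = cH p (\<lambda>\<omega>. (rvY2 C \<omega>, rvZ C \<omega>)) (\<lambda>\<omega>. (rvT C \<omega>, rvW \<omega>))"
definition "HY2 C p = HH p (rvY2 C)"
definition "HYZ_W C p = cH p (\<lambda>\<omega>. (rvY2 C \<omega>, rvZ C \<omega>)) rvW"
text \<open>Mutual information seen from the side of \<open>S\<close>, since the converse produces
  the entropy of a state letter given interference and prefix. The covering argument produces it
  from the side of \<open>T1\<close>.\<close>

definition "ITS_W C p = cH p rvS rvW - cH p rvS (\<lambda>\<omega>. (rvT C \<omega>, rvW \<omega>))"
definition "HY1_WTS C p = cH p (rvY1 C) (\<lambda>\<omega>. (rvW \<omega>, rvT C \<omega>, rvS \<omega>))"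

lemma in_rate_region_iff:
  fixes C :: "('s::finite, 'x1::finite, 'x2::finite, 't1::finite, 'y1::finite, 'y2::finite, 'z2::finite) zic"
  assumes fin: "finite (set_pmf p)"
  shows "in_rate_region C p R1 R2 \<longleftrightarrow> 0 \<le> R1 \<and> 0 \<le> R2 \<and> R1 \<le> HY1_WS C p \<and> R2 \<le> HYZ_TW C p \<and>
    R2 \<le> min (HY2 C p) (HYZ_W C p) - ITS_W C p \<and> R1 + R2 \<le> HY1_WTS C p + min (HY2 C p) (HYZ_W C p) - ITS_W C
        p"
proof -
  have I: "pmf_cond_mutual_info p (rvT C) rvS rvW = ITS_W C p"
  proof -
    have "HH p (\<lambda>\<omega>. (rvT C \<omega>, rvS \<omega>, rvW \<omega>)) = HH p (\<lambda>\<omega>. (rvS \<omega>, rvT C \<omega>, rvW \<omega>))"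
      by (rule HH_eqI[OF fin, where g = "\<lambda>(s, t, w). (t, s, w)" and h = "\<lambda>(t, s, w). (s, t, w)"]) auto
    then show ?thesis unfolding pmf_cond_mutual_info_HH[OF fin] ITS_W_def cH_def by simp
  qed
  show ?thesis
    unfolding in_rate_region_def Let_def I pmf_entropy_HH pmf_cond_entropy_HH[OF fin]
      HY1_WS_def HYZ_TW_def HY2_def HYZ_W_def HY1_WTS_def cH_def ..
qed

lemma finite_joint_pmf:
  fixes ps :: "'s::finite pmf" and px2 :: "nat \<Rightarrow> 'x2::finite pmf" and px1 :: "nat \<Rightarrow> 's \<Rightarrow> 'x1::finite pmf"
  assumes "finite (set_pmf pw)"
  shows "finite (set_pmf (joint_pmf ps pw px2 px1))"
  unfolding joint_pmf_def using assms by auto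

section \<open>Achievability\<close>

context single_letter
begin

lemma J_joint:
  "J = map_pmf (\<lambda>(w, s, x1, x2). (w, s, (interf C x1 s, out1 C x1 s), x2)) (joint_pmf ps pw px2 px1)"
  unfolding J_def joint_pmf_def k1_def
  by (subst (2) bind_commute_pmf, subst (3) bind_commute_pmf)
    (simp add: map_pmf_def bind_assoc_pmf bind_return_pmf)

lemma h_eq:
  defines "p \<equiv> joint_pmf ps pw px2 px1"
  shows "hYS = HY1_WS C p" "hVZT = HYZ_TW C p" "hV = HY2 C p" "hVZW = HYZ_W C p" "hT - hTS = ITS_W C p" "hU -
      hTS = HY1_WTS C p"
proof -
  have fin: "finite (set_pmf p)" unfolding p_def by (rule finite_joint_pmf[OF fin_pw])
  have J: "HH J X = HH p (\<lambda>\<omega>. X (case \<omega> of (w, s, x1, x2) \<Rightarrow> (w, s, (interf C x1 s, out1 C x1 s), x2)))" for X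
      :: "_ \<Rightarrow> 'c"
    unfolding J_joint p_def map_pmf_comp ..
  note sim = HH_eqI[OF fin]
  have 1: "HH p (\<lambda>\<omega>. ((rvW \<omega>, rvS \<omega>), rvY1 C \<omega>)) = HH p (\<lambda>\<omega>. (rvY1 C \<omega>, rvW \<omega>, rvS \<omega>))"
    by (rule sim[where g = "\<lambda>(y, w, s). ((w, s), y)" and h = "\<lambda>((w, s), y). (y, w, s)"]) auto
  have 2: "HH p (\<lambda>\<omega>. ((rvW \<omega>, rvT C \<omega>), (rvY2 C \<omega>, rvZ C \<omega>))) = HH p (\<lambda>\<omega>. ((rvY2 C \<omega>, rvZ C \<omega>), rvT C \<omega>, rvW
      \<omega>))"
    by (rule sim[where g = "\<lambda>(y, t, w). ((w, t), y)" and h = "\<lambda>((w, t), y). (y, t, w)"]) auto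
  have 3: "HH p (\<lambda>\<omega>. (rvW \<omega>, rvT C \<omega>)) = HH p (\<lambda>\<omega>. (rvT C \<omega>, rvW \<omega>))"
    by (rule sim[where g = "\<lambda>(t, w). (w, t)" and h = "\<lambda>(w, t). (t, w)"]) auto
  have 4: "HH p (\<lambda>\<omega>. (rvW \<omega>, (rvY2 C \<omega>, rvZ C \<omega>))) = HH p (\<lambda>\<omega>. ((rvY2 C \<omega>, rvZ C \<omega>), rvW \<omega>))"
    by (rule sim[where g = "\<lambda>(y, w). (w, y)" and h = "\<lambda>(w, y). (y, w)"]) auto
  have 5: "HH p (\<lambda>\<omega>. (rvW \<omega>, rvS \<omega>)) = HH p (\<lambda>\<omega>. (rvS \<omega>, rvW \<omega>))"
    by (rule sim[where g = "\<lambda>(t, w). (w, t)" and h = "\<lambda>(w, t). (t, w)"]) auto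
  have 6: "HH p (\<lambda>\<omega>. ((rvW \<omega>, rvS \<omega>), rvT C \<omega>)) = HH p (\<lambda>\<omega>. (rvS \<omega>, rvT C \<omega>, rvW \<omega>))"
    by (rule sim[where g = "\<lambda>(s, t, w). ((w, s), t)" and h = "\<lambda>((w, s), t). (s, t, w)"]) auto
  have 7: "HH p (\<lambda>\<omega>. ((rvW \<omega>, rvS \<omega>), rvT C \<omega>)) = HH p (\<lambda>\<omega>. (rvW \<omega>, rvT C \<omega>, rvS \<omega>))"
    by (rule sim[where g = "\<lambda>(w, t, s). ((w, s), t)" and h = "\<lambda>((w, s), t). (w, t, s)"]) auto
  have 8: "HH p (\<lambda>\<omega>. ((rvW \<omega>, rvS \<omega>), (rvT C \<omega>, rvY1 C \<omega>))) = HH p (\<lambda>\<omega>. (rvY1 C \<omega>, rvW \<omega>, rvT C \<omega>, rvS \<omega>))"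
    by (rule sim[where g = "\<lambda>(y, w, t, s). ((w, s), (t, y))" and h = "\<lambda>((w, s), (t, y)). (y, w, t, s)"]) auto
  note d = hYS_def hVZT_def hV_def hVZW_def hT_def hTS_def hU_def HY1_WS_def HYZ_TW_def HY2_def HYZ_W_def
      ITS_W_def HY1_WTS_def cH_def
  note nf = J case_prod_unfold fst_conv snd_conv
  show "hYS = HY1_WS C p" using 1 unfolding d nf by simp
  show "hVZT = HYZ_TW C p" using 2 3 unfolding d nf by simp
  show "hV = HY2 C p" unfolding d nf by simp
  show "hVZW = HYZ_W C p" using 4 unfolding d nf by simp
  show "hT - hTS = ITS_W C p" using 3 5 6 unfolding d nf by simp
  show "hU - hTS = HY1_WTS C p" using 7 8 unfolding d nf by simp
qed

theorem region_point_in_closure: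
  assumes R: "in_rate_region C (joint_pmf ps pw px2 px1) R1 R2"
  shows "(R1, R2) \<in> closure {(R1, R2). achievable C R1 R2}"
  unfolding closure_approachable
proof (intro allI impI)
  fix e :: real assume e: "0 < e"
  \<comment> \<open>The block codes run at rates reduced by \<delta>, strictly inside the region;
    concatenation loses up to another \<delta>. The two coordinates together move by at most 4 *
    \<delta> = e / 2.\<close>
  define \<delta> where "\<delta> = e / 8"
  have \<delta>: "0 < \<delta>" using e by (simp add: \<delta>_def)
  \<comment> \<open>A rate that would become negative is replaced by 0, which blocks with a single
    message support.\<close>
  let ?R1 = "max 0 (R1 - 2 * \<delta>)" and ?R2 = "max 0 (R2 - 2 * \<delta>)"
  note reg = R[unfolded in_rate_region_iff[OF finite_joint_pmf[OF fin_pw]], folded h_eq]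
  have r: "R1 - \<delta> < hYS" "R2 - \<delta> < hVZT" "R2 - \<delta> < min hV hVZW - (hT - hTS)"
    "(R1 - \<delta>) + (R2 - \<delta>) < hU - hTS + min hV hVZW - (hT - hTS)"
    using reg \<delta> by linarith+
  obtain Rl where blocks: "\<And>\<epsilon>. 0 < \<epsilon> \<Longrightarrow> \<forall>\<^sub>F n in sequentially. \<forall>\<mu>. set_pmf \<mu> \<subseteq> {..<msgs n Rl} \<times> {..<msgs n (R1
      - \<delta>)} \<times> {..<msgs n (R2 - \<delta>)} \<longrightarrow>
    (\<exists>b. block_wf n (msgs n Rl) b \<and>
      (\<integral>\<^sup>+x. \<integral>\<^sup>+s. of_bool (\<not> block_ok C b (fst x) (fst (snd x)) (snd (snd x)) s) \<partial>measure_pmf (lprod n (\<lambda>_.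
          ps)) \<partial>measure_pmf \<mu>) \<le> ennreal \<epsilon>)"
    using block_codes[OF r] by blast
  have "achievable C ?R1 ?R2"
    by (rule achievable_of_blocks[where ?r1.0 = "R1 - \<delta>" and ?r2.0 = "R2 - \<delta>" and Rl = Rl])
      (use \<delta> blocks in \<open>auto simp: block_err_def replicate_pmf_lprod\<close>)
  moreover have "dist (?R1, ?R2) (R1, R2) < e"
  proof -
    have "dist (?R1, ?R2) (R1, R2) \<le> \<bar>?R1 - R1\<bar> + \<bar>?R2 - R2\<bar>"
      unfolding dist_prod_def dist_real_def by (rule order_trans[OF sqrt_sum_squares_le_sum]) auto
    also have "\<dots> \<le> 2 * \<delta> + 2 * \<delta>" using reg \<delta> by (intro add_mono) auto
    also have "\<dots> < e" using e by (simp add: \<delta>_def)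
    finally show ?thesis .
  qed
  ultimately show "\<exists>y\<in>{(R1, R2). achievable C R1 R2}. dist y (R1, R2) < e" by blast
qed

end

section \<open>Time sharing\<close>

text \<open>The index is kept as a component, so its entropy splits off exactly and later cancels in
  every conditional quantity.\<close>

lemma HH_mixture:
  assumes q: "finite (set_pmf q)" and p: "\<And>i. i \<in> set_pmf q \<Longrightarrow> finite (set_pmf (p i))"
  shows "HH (bind_pmf q (\<lambda>i. map_pmf (Pair i) (p i))) (\<lambda>x. (fst x, X (snd x))) =
    ent q + measure_pmf.expectation q (\<lambda>i. HH (p i) X)"
proof -
  let ?P = "bind_pmf q (\<lambda>i. map_pmf (Pair i) (p i))"
  let ?L = "map_pmf (\<lambda>x. (fst x, X (snd x))) ?P"
  have L: "?L = bind_pmf q (\<lambda>i. map_pmf (Pair i) (map_pmf X (p i)))"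
    by (simp add: map_bind_pmf map_pmf_comp)
  have "HH ?P (\<lambda>x. (fst x, X (snd x))) = - measure_pmf.expectation q (\<lambda>i. measure_pmf.expectation (p i) (\<lambda>\<omega>.
      log 2 (pmf ?L (i, X \<omega>))))"
    unfolding HH_eq by (subst expectation_bind_finite) (use q p in auto)
  also have "measure_pmf.expectation q (\<lambda>i. measure_pmf.expectation (p i) (\<lambda>\<omega>. log 2 (pmf ?L (i, X \<omega>)))) =
    measure_pmf.expectation q (\<lambda>i. log 2 (pmf q i) - HH (p i) X)"
  proof (rule expectation_cong_finite)
    fix i assume i: "i \<in> set_pmf q"
    have "measure_pmf.expectation (p i) (\<lambda>\<omega>. log 2 (pmf ?L (i, X \<omega>))) =
      measure_pmf.expectation (p i) (\<lambda>\<omega>. log 2 (pmf q i) + log 2 (pmf (map_pmf X (p i)) (X \<omega>)))"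
    proof (rule expectation_cong_finite)
      fix \<omega> assume "\<omega> \<in> set_pmf (p i)"
      then have "0 < pmf (map_pmf X (p i)) (X \<omega>)" "0 < pmf q i" using i by (auto simp: pmf_positive_iff)
      then show "log 2 (pmf ?L (i, X \<omega>)) = log 2 (pmf q i) + log 2 (pmf (map_pmf X (p i)) (X \<omega>))"
        unfolding L pmf_bind_Pair by (simp add: log_mult)
    qed
    also have "\<dots> = log 2 (pmf q i) - HH (p i) X"
      unfolding HH_eq by (subst expectation_add_finite[OF p[OF i]]) simp
    finally show "measure_pmf.expectation (p i) (\<lambda>\<omega>. log 2 (pmf ?L (i, X \<omega>))) = log 2 (pmf q i) - HH (p i) X"
        .
  qed
  finally show ?thesis unfolding ent_def[of q] by (simp add: expectation_diff_finite q)
qed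

lemma HH_subadditive:
  assumes "finite (set_pmf p)"
  shows "HH p (\<lambda>\<omega>. (X \<omega>, Y \<omega>)) \<le> HH p X + HH p Y"
proof -
  have "HH p (\<lambda>\<omega>. (X \<omega>, Y \<omega>, ())) + HH p (\<lambda>_. ()) \<le> HH p (\<lambda>\<omega>. (X \<omega>, ())) + HH p (\<lambda>\<omega>. (Y \<omega>, ()))"
    by (rule HH_submodular[OF assms])
  moreover have "HH p (\<lambda>\<omega>. (X \<omega>, Y \<omega>, ())) = HH p (\<lambda>\<omega>. (X \<omega>, Y \<omega>))"
    by (rule HH_eqI[OF assms, where g = "\<lambda>(x, y). (x, y, ())" and h = "\<lambda>(x, y, _). (x, y)"]) auto
  moreover have "HH p (\<lambda>\<omega>. (X \<omega>, ())) = HH p X" "HH p (\<lambda>\<omega>. (Y \<omega>, ())) = HH p Y"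
    by (rule HH_eqI[OF assms, where g = "\<lambda>x. (x, ())" and h = fst]; simp)+
  moreover have "0 \<le> HH p (\<lambda>_. ())" by (rule HH_nonneg)
  ultimately show ?thesis by simp
qed

text \<open>The hypotheses concern averaged quantities instead of an average of points of the
  region. The converse needs this generality: it bounds only sums over time, and the law at a single
  time need not satisfy the inequalities.\<close>

lemma rate_region_mixture:
  fixes C :: "('s::finite, 'x1::finite, 'x2::finite, 't1::finite, 'y1::finite, 'y2::finite, 'z2::finite) zic"
    and pw :: "nat \<Rightarrow> nat pmf" and px2 :: "nat \<Rightarrow> nat \<Rightarrow> 'x2 pmf" and px1 :: "nat \<Rightarrow> nat \<Rightarrow> 's \<Rightarrow> 'x1 pmf"
  assumes q: "finite (set_pmf q)" and pw: "\<And>i. i \<in> set_pmf q \<Longrightarrow> finite (set_pmf (pw i))"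
  defines "p \<equiv> \<lambda>i. joint_pmf (state_pmf C) (pw i) (px2 i) (px1 i)"
  defines "E \<equiv> measure_pmf.expectation q"
  assumes R: "0 \<le> R1" "0 \<le> R2" "R1 \<le> E (\<lambda>i. HY1_WS C (p i))" "R2 \<le> E (\<lambda>i. HYZ_TW C (p i))"
    "R2 \<le> min (E (\<lambda>i. HY2 C (p i))) (E (\<lambda>i. HYZ_W C (p i))) - E (\<lambda>i. ITS_W C (p i))"
    "R1 + R2 \<le> E (\<lambda>i. HY1_WTS C (p i)) + min (E (\<lambda>i. HY2 C (p i))) (E (\<lambda>i. HYZ_W C (p i))) - E (\<lambda>i. ITS_W C
        (p i))"
  shows "(R1, R2) \<in> rate_region C"
proof -
  define pw' where "pw' = bind_pmf q (\<lambda>i. map_pmf (\<lambda>w. prod_encode (i, w)) (pw i))"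
  define px2' where "px2' v = px2 (fst (prod_decode v)) (snd (prod_decode v))" for v
  define px1' where "px1' v = px1 (fst (prod_decode v)) (snd (prod_decode v))" for v
  define P where "P = bind_pmf q (\<lambda>i. map_pmf (Pair i) (p i))"
  define p' where "p' = joint_pmf (state_pmf C) pw' px2' px1'"
  let ?g = "\<lambda>(i, w, s, x1, x2). (prod_encode (i, w), s, x1, x2)"
  have p': "p' = map_pmf ?g P"
    unfolding p'_def P_def p_def joint_pmf_def pw'_def px1'_def px2'_def
    by (simp add: map_pmf_def bind_assoc_pmf bind_return_pmf) (rule bind_commute_pmf)
  have finp: "finite (set_pmf (p i))" if "i \<in> set_pmf q" for i
    unfolding p_def by (rule finite_joint_pmf[OF pw[OF that]])
  have finP: "finite (set_pmf P)" unfolding P_def using q finp by auto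
  have finpw': "finite (set_pmf pw')" unfolding pw'_def using q pw by auto
  have finp': "finite (set_pmf p')" unfolding p'_def by (rule finite_joint_pmf[OF finpw'])
  \<comment> \<open>Any variable containing \<open>W\<close> determines the index, because
    \<open>prod_encode\<close> is injective. Hence its entropy under the merged law exceeds the
    average by exactly \<open>ent q\<close>.\<close>
  have mix: "HH p' (\<lambda>\<omega>. X' \<omega>) = ent q + E (\<lambda>i. HH (p i) X)"
    if X': "\<And>i \<omega>. X' (?g (i, \<omega>)) = f (i, X \<omega>)" "\<And>i \<omega>. (i, X \<omega>) = h (X' (?g (i, \<omega>)))" for X' :: "_ \<Rightarrow> 'c" and X
        :: "_ \<Rightarrow> 'd" and f h
  proof -
    have "HH p' (\<lambda>\<omega>. X' \<omega>) = HH P (\<lambda>x. X' (?g x))" unfolding p' map_pmf_comp ..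
    also have "\<dots> = HH P (\<lambda>x. (fst x, X (snd x)))"
      by (rule HH_eqI[OF finP, where g = f and h = h])
        (metis X' prod.collapse)+
    also have "\<dots> = ent q + E (\<lambda>i. HH (p i) X)"
      unfolding P_def E_def by (rule HH_mixture[OF q finp])
    finally show ?thesis .
  qed
  have Ediff: "E (\<lambda>i. f i - g i) = E f - E g" for f g
    unfolding E_def by (rule expectation_diff_finite[OF q])
  let ?dec = "\<lambda>v. prod_decode v"
  have mW: "HH p' rvW = ent q + E (\<lambda>i. HH (p i) rvW)"
    by (rule mix[of _ "\<lambda>(i, w). prod_encode (i, w)" _ "\<lambda>v. prod_decode v"]) auto
  have mY1WS: "HH p' (\<lambda>\<omega>. (rvY1 C \<omega>, rvW \<omega>, rvS \<omega>)) = ent q + E (\<lambda>i. HH (p i) (\<lambda>\<omega>. (rvY1 C \<omega>, rvW \<omega>, rvS \<omega>)))"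
    by (rule mix[of _ "\<lambda>(i, y, w, s). (y, prod_encode (i, w), s)" _ "\<lambda>(y, v, s). (fst (?dec v), y, snd (?dec
        v), s)"]) auto
  have mWS: "HH p' (\<lambda>\<omega>. (rvW \<omega>, rvS \<omega>)) = ent q + E (\<lambda>i. HH (p i) (\<lambda>\<omega>. (rvW \<omega>, rvS \<omega>)))"
    by (rule mix[of _ "\<lambda>(i, w, s). (prod_encode (i, w), s)" _ "\<lambda>(v, s). (fst (?dec v), snd (?dec v), s)"])
        auto
  have mYZTW: "HH p' (\<lambda>\<omega>. ((rvY2 C \<omega>, rvZ C \<omega>), rvT C \<omega>, rvW \<omega>)) = ent q + E (\<lambda>i. HH (p i) (\<lambda>\<omega>. ((rvY2 C \<omega>,
      rvZ C \<omega>), rvT C \<omega>, rvW \<omega>)))"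
    by (rule mix[of _ "\<lambda>(i, y, t, w). (y, t, prod_encode (i, w))" _ "\<lambda>(y, t, v). (fst (?dec v), y, t, snd
        (?dec v))"]) auto
  have mTW: "HH p' (\<lambda>\<omega>. (rvT C \<omega>, rvW \<omega>)) = ent q + E (\<lambda>i. HH (p i) (\<lambda>\<omega>. (rvT C \<omega>, rvW \<omega>)))"
    by (rule mix[of _ "\<lambda>(i, t, w). (t, prod_encode (i, w))" _ "\<lambda>(t, v). (fst (?dec v), t, snd (?dec v))"])
        auto
  have mYZW: "HH p' (\<lambda>\<omega>. ((rvY2 C \<omega>, rvZ C \<omega>), rvW \<omega>)) = ent q + E (\<lambda>i. HH (p i) (\<lambda>\<omega>. ((rvY2 C \<omega>, rvZ C \<omega>),
      rvW \<omega>)))"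
    by (rule mix[of _ "\<lambda>(i, t, w). (t, prod_encode (i, w))" _ "\<lambda>(t, v). (fst (?dec v), t, snd (?dec v))"])
        auto
  have mSW: "HH p' (\<lambda>\<omega>. (rvS \<omega>, rvW \<omega>)) = ent q + E (\<lambda>i. HH (p i) (\<lambda>\<omega>. (rvS \<omega>, rvW \<omega>)))"
    by (rule mix[of _ "\<lambda>(i, t, w). (t, prod_encode (i, w))" _ "\<lambda>(t, v). (fst (?dec v), t, snd (?dec v))"])
        auto
  have mSTW: "HH p' (\<lambda>\<omega>. (rvS \<omega>, rvT C \<omega>, rvW \<omega>)) = ent q + E (\<lambda>i. HH (p i) (\<lambda>\<omega>. (rvS \<omega>, rvT C \<omega>, rvW \<omega>)))"
    by (rule mix[of _ "\<lambda>(i, y, t, w). (y, t, prod_encode (i, w))" _ "\<lambda>(y, t, v). (fst (?dec v), y, t, snd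
        (?dec v))"]) auto
  have mY1WTS: "HH p' (\<lambda>\<omega>. (rvY1 C \<omega>, rvW \<omega>, rvT C \<omega>, rvS \<omega>)) = ent q + E (\<lambda>i. HH (p i) (\<lambda>\<omega>. (rvY1 C \<omega>, rvW
      \<omega>, rvT C \<omega>, rvS \<omega>)))"
    by (rule mix[of _ "\<lambda>(i, y, w, s). (y, prod_encode (i, w), s)" _ "\<lambda>(y, v, s). (fst (?dec v), y, snd (?dec
        v), s)"]) auto
  have mWTS: "HH p' (\<lambda>\<omega>. (rvW \<omega>, rvT C \<omega>, rvS \<omega>)) = ent q + E (\<lambda>i. HH (p i) (\<lambda>\<omega>. (rvW \<omega>, rvT C \<omega>, rvS \<omega>)))"
    by (rule mix[of _ "\<lambda>(i, w, s). (prod_encode (i, w), s)" _ "\<lambda>(v, s). (fst (?dec v), snd (?dec v), s)"])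
        auto
  have A: "HY1_WS C p' = E (\<lambda>i. HY1_WS C (p i))" unfolding HY1_WS_def cH_def Ediff mY1WS mWS by simp
  have B: "HYZ_TW C p' = E (\<lambda>i. HYZ_TW C (p i))" unfolding HYZ_TW_def cH_def Ediff mYZTW mTW by simp
  have VZ: "HYZ_W C p' = E (\<lambda>i. HYZ_W C (p i))" unfolding HYZ_W_def cH_def Ediff mYZW mW by simp
  have I: "ITS_W C p' = E (\<lambda>i. ITS_W C (p i))" unfolding ITS_W_def cH_def Ediff mSW mW mSTW mTW by simp
  have D: "HY1_WTS C p' = E (\<lambda>i. HY1_WTS C (p i))" unfolding HY1_WTS_def cH_def Ediff mY1WTS mWTS by simp
  \<comment> \<open>Here the index cannot be recovered from the variable; subadditivity together
    with the cancellation of \<open>ent q\<close> gives concavity.\<close>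
  have V: "E (\<lambda>i. HY2 C (p i)) \<le> HY2 C p'"
  proof -
    have "ent q + E (\<lambda>i. HH (p i) (rvY2 C)) = HH P (\<lambda>x. (fst x, rvY2 C (snd x)))"
      unfolding P_def E_def by (rule HH_mixture[OF q finp, symmetric])
    also have "\<dots> \<le> HH P fst + HH P (\<lambda>x. rvY2 C (snd x))" by (rule HH_subadditive[OF finP])
    also have "map_pmf fst P = q" unfolding P_def by (simp add: map_bind_pmf map_pmf_comp bind_return_pmf')
    also have "HH P (\<lambda>x. rvY2 C (snd x)) = HH p' (rvY2 C)"
      unfolding p' map_pmf_comp by (simp add: case_prod_unfold)
    finally show ?thesis by (simp add: HY2_def)
  qed
  have "in_rate_region C p' R1 R2"
    unfolding in_rate_region_iff[OF finp'] A B VZ I D using R V by auto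
  then show ?thesis unfolding rate_region_def p'_def using finpw' by blast
qed

lemma convex_rate_region:
  fixes C :: "('s::finite, 'x1::finite, 'x2::finite, 't1::finite, 'y1::finite, 'y2::finite, 'z2::finite) zic"
  shows "convex (rate_region C)"
proof (rule convexI)
  fix x y :: "real \<times> real" and u v :: real
  assume x: "x \<in> rate_region C" and y: "y \<in> rate_region C" and uv: "0 \<le> u" "0 \<le> v" "u + v = 1"
  obtain pw0 px20 px10 where 0: "finite (set_pmf pw0)" "in_rate_region C (joint_pmf (state_pmf C) pw0 px20
      px10) (fst x) (snd x)"
    using x by (auto simp: rate_region_def)
  obtain pw1 px21 px11 where 1: "finite (set_pmf pw1)" "in_rate_region C (joint_pmf (state_pmf C) pw1 px21
      px11) (fst y) (snd y)"
    using y by (auto simp: rate_region_def)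
  define q where "q = map_pmf (\<lambda>b. if b then 0 else (1::nat)) (bernoulli_pmf u)"
  have E: "measure_pmf.expectation q f = u * f 0 + v * f 1" for f :: "nat \<Rightarrow> real"
  proof -
    have "1 - u = v" using uv by simp
    then show ?thesis unfolding q_def using uv by simp
  qed
  let ?pw = "\<lambda>i. if i = 0 then pw0 else pw1" and ?px2 = "\<lambda>i. if i = 0 then px20 else px21" and ?px1 = "\<lambda>i. if
      i = 0 then px10 else px11"
  note r0 = 0(2)[unfolded in_rate_region_iff[OF finite_joint_pmf[OF 0(1)]]]
  note r1 = 1(2)[unfolded in_rate_region_iff[OF finite_joint_pmf[OF 1(1)]]]
  have comb: "u * a + v * b \<le> u * a' + v * b'" if "a \<le> a'" "b \<le> b'" for a b a' b' :: real
    using uv that by (intro add_mono mult_left_mono) auto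
  let ?p0 = "joint_pmf (state_pmf C) pw0 px20 px10" and ?p1 = "joint_pmf (state_pmf C) pw1 px21 px11"
  \<comment> \<open>Concavity of the minimum: it may be taken after averaging, at no loss.\<close>
  have minc: "u * min a b + v * min a' b' \<le> min (u * a + v * a') (u * b + v * b')" for a b a' b' :: real
    using comb[of "min a b" a "min a' b'" a'] comb[of "min a b" b "min a' b'" b'] by simp
  have ar3: "u * x2 + v * y2 \<le> M - (u * i0 + v * i1)"
    if "u * x2 + v * y2 \<le> u * (m0 - i0) + v * (m1 - i1)" "u * m0 + v * m1 \<le> M" for x2 y2 m0 m1 i0 i1 M :: real
    using that by (simp add: algebra_simps)
  have ar4: "(u * x1 + v * y1) + (u * x2 + v * y2) \<le> (u * d0 + v * d1) + M - (u * i0 + v * i1)"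
    if "u * (x1 + x2) + v * (y1 + y2) \<le> u * (d0 + m0 - i0) + v * (d1 + m1 - i1)" "u * m0 + v * m1 \<le> M"
    for x1 x2 y1 y2 d0 d1 m0 m1 i0 i1 M :: real
    using that by (simp add: algebra_simps)
  have "(fst (u *\<^sub>R x + v *\<^sub>R y), snd (u *\<^sub>R x + v *\<^sub>R y)) \<in> rate_region C"
  proof (rule rate_region_mixture[where q = q and pw = ?pw and ?px2.0 = ?px2 and ?px1.0 = ?px1])
    show "finite (set_pmf q)" by (simp add: q_def)
    show "finite (set_pmf (?pw i))" for i using 0 1 by simp
    have e3: "u * snd x + v * snd y \<le> u * (min (HY2 C ?p0) (HYZ_W C ?p0) - ITS_W C ?p0) + v * (min (HY2 C
        ?p1) (HYZ_W C ?p1) - ITS_W C ?p1)"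
      by (rule comb) (use r0 r1 in auto)
    have e4: "u * (fst x + snd x) + v * (fst y + snd y) \<le> u * (HY1_WTS C ?p0 + min (HY2 C ?p0) (HYZ_W C ?p0)
        - ITS_W C ?p0) + v * (HY1_WTS C ?p1 + min (HY2 C ?p1) (HYZ_W C ?p1) - ITS_W C ?p1)"
      by (rule comb) (use r0 r1 in auto)
    show "snd (u *\<^sub>R x + v *\<^sub>R y) \<le> min (measure_pmf.expectation q (\<lambda>i. HY2 C (joint_pmf (state_pmf C) (?pw
        i) (?px2 i) (?px1 i))))
        (measure_pmf.expectation q (\<lambda>i. HYZ_W C (joint_pmf (state_pmf C) (?pw i) (?px2 i) (?px1 i)))) -
        measure_pmf.expectation q (\<lambda>i. ITS_W C (joint_pmf (state_pmf C) (?pw i) (?px2 i) (?px1 i)))"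
      unfolding E using ar3[OF e3 minc] by simp
    show "fst (u *\<^sub>R x + v *\<^sub>R y) + snd (u *\<^sub>R x + v *\<^sub>R y) \<le> measure_pmf.expectation q (\<lambda>i. HY1_WTS C
        (joint_pmf (state_pmf C) (?pw i) (?px2 i) (?px1 i))) +
        min (measure_pmf.expectation q (\<lambda>i. HY2 C (joint_pmf (state_pmf C) (?pw i) (?px2 i) (?px1 i))))
        (measure_pmf.expectation q (\<lambda>i. HYZ_W C (joint_pmf (state_pmf C) (?pw i) (?px2 i) (?px1 i)))) -
        measure_pmf.expectation q (\<lambda>i. ITS_W C (joint_pmf (state_pmf C) (?pw i) (?px2 i) (?px1 i)))"
      unfolding E using ar4[OF e4 minc] by simp
    show "fst (u *\<^sub>R x + v *\<^sub>R y) \<le> measure_pmf.expectation q (\<lambda>i. HY1_WS C (joint_pmf (state_pmf C) (?pw i)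
        (?px2 i) (?px1 i)))"
      unfolding E using comb[of "fst x" "HY1_WS C ?p0" "fst y" "HY1_WS C ?p1"] r0 r1 by simp
    show "snd (u *\<^sub>R x + v *\<^sub>R y) \<le> measure_pmf.expectation q (\<lambda>i. HYZ_TW C (joint_pmf (state_pmf C) (?pw i)
        (?px2 i) (?px1 i)))"
      unfolding E using comb[of "snd x" "HYZ_TW C ?p0" "snd y" "HYZ_TW C ?p1"] r0 r1 by simp
    show "0 \<le> fst (u *\<^sub>R x + v *\<^sub>R y)" "0 \<le> snd (u *\<^sub>R x + v *\<^sub>R y)"
      using r0 r1 uv by simp_all
  qed
  then show "u *\<^sub>R x + v *\<^sub>R y \<in> rate_region C" by (simp only: prod.collapse)
qed

section \<open>Converse\<close>

text \<open>The chain rule, followed by a coarsening of the condition. The coarser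
  \<open>D i\<close> must be computable from the earlier letters and \<open>B\<close>; causality of
  the code enters through this hypothesis.\<close>

lemma HH_chain_le:
  assumes fin: "finite (set_pmf p)"
    and D: "\<And>i \<omega>. i < n \<Longrightarrow> \<omega> \<in> set_pmf p \<Longrightarrow> D i \<omega> = h i (map (\<lambda>j. v j \<omega>) [0..<i]) (B \<omega>)"
  shows "cH p (\<lambda>\<omega>. map (\<lambda>i. v i \<omega>) [0..<n]) B \<le> (\<Sum>i<n. cH p (v i) (D i))"
  using D
proof (induction n)
  case 0
  have "HH p (\<lambda>\<omega>. ([] :: 'c list, B \<omega>)) = HH p B"
    by (rule HH_eqI[OF fin, where g = "\<lambda>b. ([], b)" and h = snd]) auto
  then show ?case by (simp add: cH_def)
next
  case (Suc n)
  let ?V = "\<lambda>\<omega>. map (\<lambda>i. v i \<omega>) [0..<n]"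
  have "HH p (\<lambda>\<omega>. (map (\<lambda>i. v i \<omega>) [0..<Suc n], B \<omega>)) = HH p (\<lambda>\<omega>. (v n \<omega>, (?V \<omega>, B \<omega>)))"
    by (rule HH_eqI[OF fin, where g = "\<lambda>(x, (l, b)). (l @ [x], b)" and h = "\<lambda>(l, b). (last l, (butlast l,
        b))"]) auto
  moreover have "HH p (\<lambda>\<omega>. (v n \<omega>, (?V \<omega>, B \<omega>))) \<le> HH p (\<lambda>\<omega>. (v n \<omega>, (?V \<omega>, B \<omega>), D n \<omega>))"
    by (rule HH_mono[OF fin, where g = "\<lambda>(x, vb, d). (x, vb)"]) auto
  moreover have "HH p (\<lambda>\<omega>. (v n \<omega>, (?V \<omega>, B \<omega>), D n \<omega>)) + HH p (D n) \<le> HH p (\<lambda>\<omega>. (v n \<omega>, D n \<omega>)) + HH p (\<lambda>\<omega>.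
      ((?V \<omega>, B \<omega>), D n \<omega>))"
    by (rule HH_submodular[OF fin])
  moreover have "HH p (\<lambda>\<omega>. ((?V \<omega>, B \<omega>), D n \<omega>)) \<le> HH p (\<lambda>\<omega>. (?V \<omega>, B \<omega>))"
    by (rule HH_mono[OF fin, where g = "\<lambda>(l, b). ((l, b), h n l b)"]) (use Suc.prems[of n] in auto)
  moreover have "cH p ?V B \<le> (\<Sum>i<n. cH p (v i) (D i))"
    by (rule Suc.IH) (use Suc.prems in auto)
  ultimately show ?case by (simp add: cH_def)
qed

text \<open>I(X;Y) \<le> I(X;Y,B) = I(X;Y|B) \<le> H(Y|B), where the equality is the independence of
  \<open>X\<close> and \<open>B\<close>.\<close>

lemma mutual_info_le_of_indep:
  assumes fin: "finite (set_pmf p)" and ind: "HH p (\<lambda>\<omega>. (X \<omega>, B \<omega>)) = HH p X + HH p B"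
  shows "HH p X + HH p Y - HH p (\<lambda>\<omega>. (X \<omega>, Y \<omega>)) \<le> cH p Y B"
proof -
  have "HH p (\<lambda>\<omega>. (X \<omega>, B \<omega>, Y \<omega>)) + HH p Y \<le> HH p (\<lambda>\<omega>. (X \<omega>, Y \<omega>)) + HH p (\<lambda>\<omega>. (B \<omega>, Y \<omega>))"
    by (rule HH_submodular[OF fin])
  moreover have "HH p (\<lambda>\<omega>. (X \<omega>, B \<omega>)) \<le> HH p (\<lambda>\<omega>. (X \<omega>, B \<omega>, Y \<omega>))"
    by (rule HH_mono[OF fin, where g = "\<lambda>(x, b, y). (x, b)"]) auto
  moreover have "HH p (\<lambda>\<omega>. (B \<omega>, Y \<omega>)) = HH p (\<lambda>\<omega>. (Y \<omega>, B \<omega>))"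
    by (rule HH_eqI[OF fin, where g = "\<lambda>(x, y). (y, x)" and h = "\<lambda>(x, y). (y, x)"]) auto
  ultimately show ?thesis using ind by (simp add: cH_def)
qed

text \<open>Gibbs' inequality against the law that makes the guess \<open>d y\<close> right with probability one half.\<close>

lemma fano:
  assumes fin: "finite (set_pmf p)" and S: "finite S" "X ` set_pmf p \<subseteq> S"
  shows "cH p X Y \<le> 1 + measure_pmf.prob p {\<omega>. d (Y \<omega>) \<noteq> X \<omega>} * log 2 (card S)"
proof -
  define q where "q = map_pmf (\<lambda>\<omega>. (X \<omega>, Y \<omega>)) p"
  define b where "b = map_pmf Y p"
  define N where "N = real (card S)"
  have "S \<noteq> {}" using S set_pmf_not_empty[of p] by auto
  then have N: "1 \<le> N" using S by (simp add: N_def card_gt_0_iff Suc_leI)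
  define k where "k x y = (if x = d y then 1 / 2 else 1 / (2 * N))" for x y
  define g where "g = (\<lambda>(x, y). pmf b y * k x y)"
  have k: "0 < k x y" for x y using N by (simp add: k_def)
  have finq: "finite (set_pmf q)" using fin by (simp add: q_def)
  have "measure_pmf.expectation q (\<lambda>x. log 2 (g x)) \<le> measure_pmf.expectation q (\<lambda>x. log 2 (pmf q x))"
  proof (rule gibbs[OF finq])
    show "0 < g x" if "x \<in> set_pmf q" for x using that k by (auto simp: q_def g_def b_def pmf_positive)
    let ?B = "Y ` set_pmf p"
    have ks: "(\<Sum>x\<in>S. k x y) \<le> 1" for y
    proof -
      have "(\<Sum>x\<in>S. k x y) \<le> (\<Sum>x\<in>S. (if x = d y then 1 / 2 else 0) + 1 / (2 * N))"
        using N by (intro sum_mono) (auto simp: k_def)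
      also have "\<dots> = (if d y \<in> S then 1 / 2 else 0) + N * (1 / (2 * N))"
        using S by (simp add: sum.distrib N_def)
      also have "\<dots> \<le> 1" using N by simp
      finally show ?thesis .
    qed
    have "(\<Sum>x\<in>set_pmf q. g x) \<le> (\<Sum>x\<in>S \<times> ?B. g x)"
    proof (rule sum_mono2)
      show "finite (S \<times> ?B)" using fin S by simp
      show "set_pmf q \<subseteq> S \<times> ?B" using S by (auto simp: q_def)
      show "0 \<le> g x" for x by (cases x) (simp add: g_def less_imp_le[OF k])
    qed
    also have "\<dots> = (\<Sum>x\<in>S. \<Sum>y\<in>?B. pmf b y * k x y)"
      unfolding g_def by (simp add: sum.cartesian_product)
    also have "\<dots> = (\<Sum>y\<in>?B. pmf b y * (\<Sum>x\<in>S. k x y))"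
      unfolding sum_distrib_left by (rule sum.swap)
    also have "\<dots> \<le> (\<Sum>y\<in>?B. pmf b y * 1)"
      by (intro sum_mono mult_left_mono ks) simp
    also have "\<dots> = (\<Sum>y\<in>?B. pmf b y)" by simp
    also have "\<dots> = 1" by (rule sum_pmf_eq_1) (use fin in \<open>auto simp: b_def\<close>)
    finally show "(\<Sum>x\<in>set_pmf q. g x) \<le> 1" .
  qed
  moreover have "measure_pmf.expectation q (\<lambda>x. log 2 (g x)) =
    measure_pmf.expectation p (\<lambda>\<omega>. log 2 (pmf b (Y \<omega>)) - (1 + indicator {\<omega>. d (Y \<omega>) \<noteq> X \<omega>} \<omega> * log 2 N))"
    unfolding q_def integral_map_pmf
  proof (rule expectation_cong_finite)
    fix \<omega> assume "\<omega> \<in> set_pmf p"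
    then have b: "0 < pmf b (Y \<omega>)" by (simp add: b_def pmf_positive)
    have "log 2 (k (X \<omega>) (Y \<omega>)) = - (1 + indicator {\<omega>. d (Y \<omega>) \<noteq> X \<omega>} \<omega> * log 2 N)"
      using N by (auto simp: k_def log_divide log_mult)
    then show "log 2 (g (X \<omega>, Y \<omega>)) = log 2 (pmf b (Y \<omega>)) - (1 + indicator {\<omega>. d (Y \<omega>) \<noteq> X \<omega>} \<omega> * log 2 N)"
      using b k[of "X \<omega>" "Y \<omega>"] by (simp add: g_def log_mult)
  qed
  moreover have "\<dots> = - HH p Y - (1 + measure_pmf.prob p {\<omega>. d (Y \<omega>) \<noteq> X \<omega>} * log 2 N)"
    unfolding HH_eq b_def by (simp add: expectation_diff_finite expectation_add_finite fin)
  ultimately show ?thesis unfolding cH_def q_def[symmetric] ent_def[of q] N_def by simp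
qed

lemma ent_pmf_of_set:
  assumes "finite S" "S \<noteq> {}"
  shows "ent (pmf_of_set S) = log 2 (card S)"
proof -
  have "measure_pmf.expectation (pmf_of_set S) (\<lambda>x. log 2 (pmf (pmf_of_set S) x)) =
    measure_pmf.expectation (pmf_of_set S) (\<lambda>x. - log 2 (card S))"
    by (rule expectation_cong_finite) (use assms in \<open>simp add: log_divide card_gt_0_iff\<close>)
  then show ?thesis by (simp add: ent_def)
qed

lemma ent_replicate_pmf:
  assumes fin: "finite (set_pmf p)"
  shows "ent (replicate_pmf n p) = real n * ent p"
proof (induction n)
  case 0
  show ?case by (simp add: ent_def)
next
  case (Suc n)
  let ?P = "pair_pmf p (replicate_pmf n p)"
  have finr: "finite (set_pmf (replicate_pmf n p))"
    unfolding replicate_pmf_lprod by (rule finite_lprod[OF fin])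
  have finP: "finite (set_pmf ?P)" using fin finr by simp
  have "replicate_pmf (Suc n) p = map_pmf (\<lambda>x. fst x # snd x) ?P"
    by (simp add: pair_pmf_def map_bind_pmf)
  then have "ent (replicate_pmf (Suc n) p) = HH ?P (\<lambda>x. fst x # snd x)" by simp
  also have "\<dots> = HH ?P (\<lambda>x. (fst x, snd x))"
    by (rule HH_eqI[OF finP, where g = "\<lambda>(x, xs). x # xs" and h = "\<lambda>l. (hd l, tl l)"]) auto
  also have "\<dots> = HH ?P fst + HH ?P snd"
    by (rule HH_indep[OF finP]) (simp add: map_fst_pair_pmf map_snd_pair_pmf)
  also have "\<dots> = real (Suc n) * ent p"
    by (simp add: map_fst_pair_pmf map_snd_pair_pmf Suc.IH algebra_simps)
  finally show ?case .
qed

lemma map_nth_replicate_pmf: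
  assumes "i < n"
  shows "map_pmf (\<lambda>xs. xs ! i) (replicate_pmf n p) = p"
proof -
  have "map_pmf (\<lambda>xs. xs ! i) (replicate_pmf n p) = map_pmf hd (map_pmf (blk 1 i) (replicate_pmf n p))"
    unfolding map_pmf_comp
    by (rule map_pmf_cong) (use assms in \<open>auto simp: set_replicate_pmf blk_def hd_drop_conv_nth take_Suc\<close>)
  also have "\<dots> = p"
    by (subst map_blk_replicate_pmf) (use assms in \<open>auto simp: map_bind_pmf bind_return_pmf bind_return_pmf'\<close>)
  finally show ?thesis .
qed

text \<open>Disintegration along \<open>f\<close>. It turns functions of the full messages and
  states into kernels that depend on a single letter or prefix.\<close>

lemma bind_cond_pmf_fibre:
  "bind_pmf (map_pmf f r) (\<lambda>s. cond_pmf r {x. f x = s}) = r"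
proof -
  have "bind_pmf r (\<lambda>x. cond_pmf r {y. f x = f y}) = r"
    by (rule bind_cond_pmf_cancel) (auto simp: eq_commute intro!: arg_cong[where f = "measure_pmf.prob r"])
  then show ?thesis by (simp add: bind_map_pmf eq_commute)
qed

lemma cH_map: "cH (map_pmf f p) X Y = cH p (\<lambda>\<omega>. X (f \<omega>)) (\<lambda>\<omega>. Y (f \<omega>))"
  by (simp add: cH_def map_pmf_comp)

section \<open>Entropy bounds for a given code\<close>

locale coding =
  fixes C :: "('s::finite, 'x1::finite, 'x2::finite, 't1::finite, 'y1::finite, 'y2::finite, 'z2::finite) zic"
    and c :: "('s, 'x1, 'x2, 'y1, 'y2, 'z2) zic_code" and n :: nat and R1 R2 :: real
  assumes inj: "injective_zic C" and n: "0 < n"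
begin

abbreviation "P \<equiv> source_pmf C n R1 R2"
abbreviation "Sn \<equiv> replicate_pmf n (state_pmf C)"
abbreviation "U1 \<equiv> pmf_of_set (messages n R1)"
abbreviation "U2 \<equiv> pmf_of_set (messages n R2)"

abbreviation oM1 :: "nat \<times> nat \<times> 's list \<Rightarrow> nat" where "oM1 \<equiv> fst"
definition oM2 :: "nat \<times> nat \<times> 's list \<Rightarrow> nat" where "oM2 \<omega> = fst (snd \<omega>)"
definition oS :: "nat \<times> nat \<times> 's list \<Rightarrow> 's list" where "oS \<omega> = snd (snd \<omega>)"
definition zpre :: "nat \<Rightarrow> nat \<Rightarrow> 'z2 list" where "zpre i m = map (\<lambda>j. crib C (enc2 c j m)) [0..<i]"
definition "oX1 i \<omega> = enc1 c i (oM1 \<omega>) (oS \<omega>) (zpre i (oM2 \<omega>))"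
definition "oX2 i \<omega> = enc2 c i (oM2 \<omega>)"
definition "oT i \<omega> = interf C (oX1 i \<omega>) (oS \<omega> ! i)"
definition "oY1 i \<omega> = out1 C (oX1 i \<omega>) (oS \<omega> ! i)"
definition "oY2 i \<omega> = out2 C (oX2 i \<omega>) (oT i \<omega>)"
definition "oZ i \<omega> = crib C (oX2 i \<omega>)"
text \<open>Encoder 2 sees nothing but its message, so the prefix is a function of that message. The
  encoding \<open>to_nat\<close> is injective, hence \<open>W\<close> still contains the whole
  prefix.\<close>

definition oW :: "nat \<Rightarrow> nat \<times> nat \<times> 's list \<Rightarrow> nat" where "oW i \<omega> = to_nat (zpre i (oM2 \<omega>))"

definition "listT \<omega> = map (\<lambda>i. oT i \<omega>) [0..<n]"
definition "listY1 \<omega> = map (\<lambda>i. oY1 i \<omega>) [0..<n]"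
definition "listY2 \<omega> = map (\<lambda>i. oY2 i \<omega>) [0..<n]"
definition "listYZ \<omega> = map (\<lambda>i. (oY2 i \<omega>, oZ i \<omega>)) [0..<n]"

lemma fin_msgs: "finite (messages n R)" "messages n R \<noteq> {}"
  by (rule messages_finite_nonempty)+

lemma finP: "finite (set_pmf P)"
proof -
  have "finite (set_pmf Sn)" unfolding replicate_pmf_lprod by (rule finite_lprod) simp
  then show ?thesis unfolding source_pmf_def using fin_msgs by simp
qed

lemma length_oS: "\<omega> \<in> set_pmf P \<Longrightarrow> length (oS \<omega>) = n"
  by (auto simp: source_pmf_def oS_def set_replicate_pmf)

lemma take_seq_z2: "i \<le> n \<Longrightarrow> take i (seq_z2 C c n m) = zpre i m"
  by (simp add: seq_z2_def seq_x2_def zpre_def take_map)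

lemma seq_eqs:
  assumes "length ss = n"
  shows "seq_y1 C c n m1 m2 ss = listY1 (m1, m2, ss)" "seq_y2 C c n m1 m2 ss = listY2 (m1, m2, ss)"
proof -
  have x1: "seq_x1 C c n m1 m2 ss = map (\<lambda>i. oX1 i (m1, m2, ss)) [0..<n]"
    by (auto simp: seq_x1_def oX1_def oM2_def oS_def take_seq_z2)
  have x2: "seq_x2 c n m2 = map (\<lambda>i. oX2 i (m1, m2, ss)) [0..<n]"
    by (auto simp: seq_x2_def oX2_def oM2_def)
  show "seq_y1 C c n m1 m2 ss = listY1 (m1, m2, ss)"
    unfolding seq_y1_def x1 listY1_def using assms by (auto simp: list_eq_iff_nth_eq oY1_def oS_def)
  have "seq_t1 C c n m1 m2 ss = map (\<lambda>i. oT i (m1, m2, ss)) [0..<n]"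
    unfolding seq_t1_def x1 using assms by (auto simp: list_eq_iff_nth_eq oT_def oS_def)
  then show "seq_y2 C c n m1 m2 ss = listY2 (m1, m2, ss)"
    unfolding seq_y2_def x2 listY2_def using assms by (auto simp: list_eq_iff_nth_eq oY2_def)
qed

lemma map_snd_P: "map_pmf (\<lambda>\<omega>. F (snd \<omega>)) P = map_pmf F (pair_pmf U2 Sn)"
proof -
  have "map_pmf (\<lambda>\<omega>. F (snd \<omega>)) P = map_pmf F (map_pmf snd P)" by (simp add: map_pmf_comp)
  then show ?thesis by (simp add: source_pmf_def map_snd_pair_pmf)
qed

lemma map_M1: "map_pmf oM1 P = U1"
  by (simp add: source_pmf_def map_fst_pair_pmf)

lemma map_M2: "map_pmf oM2 P = U2"
  using map_snd_P[of fst] by (simp add: oM2_def[abs_def] map_fst_pair_pmf)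

lemma map_S: "map_pmf oS P = Sn"
  using map_snd_P[of snd] by (simp add: oS_def[abs_def] map_snd_pair_pmf)

lemma map_M2S: "map_pmf (\<lambda>\<omega>. (oM2 \<omega>, oS \<omega>)) P = pair_pmf U2 Sn"
  using map_snd_P[of "\<lambda>x. x"] by (simp add: oM2_def oS_def)

lemma map_M1S: "map_pmf (\<lambda>\<omega>. (oM1 \<omega>, oS \<omega>)) P = pair_pmf U1 Sn"
  by (simp add: source_pmf_def pair_pmf_def oS_def map_pmf_def bind_assoc_pmf bind_return_pmf)

lemma indep:
  "HH P (\<lambda>\<omega>. (oM1 \<omega>, (oM2 \<omega>, oS \<omega>))) = HH P oM1 + HH P (\<lambda>\<omega>. (oM2 \<omega>, oS \<omega>))"
  "HH P (\<lambda>\<omega>. (oM2 \<omega>, (oM1 \<omega>, oS \<omega>))) = HH P oM2 + HH P (\<lambda>\<omega>. (oM1 \<omega>, oS \<omega>))"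
  "HH P (\<lambda>\<omega>. (oM2 \<omega>, oS \<omega>)) = HH P oM2 + HH P oS"
proof -
  show "HH P (\<lambda>\<omega>. (oM1 \<omega>, (oM2 \<omega>, oS \<omega>))) = HH P oM1 + HH P (\<lambda>\<omega>. (oM2 \<omega>, oS \<omega>))"
    by (rule HH_indep[OF finP], unfold map_M1 map_M2S)
      (simp add: source_pmf_def oM2_def oS_def)
  show "HH P (\<lambda>\<omega>. (oM2 \<omega>, (oM1 \<omega>, oS \<omega>))) = HH P oM2 + HH P (\<lambda>\<omega>. (oM1 \<omega>, oS \<omega>))"
  proof (rule HH_indep[OF finP], unfold map_M2 map_M1S)
    show "map_pmf (\<lambda>\<omega>. (oM2 \<omega>, (oM1 \<omega>, oS \<omega>))) P = pair_pmf U2 (pair_pmf U1 Sn)"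
      by (simp add: source_pmf_def pair_pmf_def oM2_def oS_def map_bind_pmf bind_assoc_pmf bind_return_pmf)
        (rule bind_commute_pmf)
  qed
  show "HH P (\<lambda>\<omega>. (oM2 \<omega>, oS \<omega>)) = HH P oM2 + HH P oS"
    by (rule HH_indep[OF finP], unfold map_M2 map_M2S map_S) simp
qed

definition "I1 = HH P oM1 + HH P listY1 - HH P (\<lambda>\<omega>. (oM1 \<omega>, listY1 \<omega>))"
definition "I2 = HH P oM2 + HH P listY2 - HH P (\<lambda>\<omega>. (oM2 \<omega>, listY2 \<omega>))"

lemma I_nonneg: "0 \<le> I1" "0 \<le> I2"
  using HH_subadditive[OF finP, of oM1 listY1] HH_subadditive[OF finP, of oM2 listY2] by (auto simp: I1_def
      I2_def)

lemma log_card_messages: "real n * R \<le> log 2 (card (messages n R))" "0 \<le> log 2 (card (messages n R))"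
proof -
  have card: "card (messages n R) = nat \<lceil>2 powr (real n * R)\<rceil>" by (simp add: messages_def)
  have b: "2 powr (real n * R) \<le> real (card (messages n R))" unfolding card by (rule ceil_bounds(2)) simp
  have "log 2 (2 powr (real n * R)) \<le> log 2 (card (messages n R))"
    using b by (intro log_mono) auto
  then show "real n * R \<le> log 2 (card (messages n R))" by simp
  have "1 \<le> card (messages n R)" using fin_msgs by (simp add: Suc_le_eq card_gt_0_iff)
  then show "0 \<le> log 2 (card (messages n R))" by simp
qed

text \<open>Rounding up makes the logarithm of the number of messages at least \<open>n * R\<close>.
  Since the factor 1 - e is nonnegative, the entropy of the message may be lowered to
  \<open>n * R\<close> after Fano's inequality, but not before.\<close>

lemma fano_messages:
  assumes \<epsilon>: "e \<le> \<epsilon>" "\<epsilon> \<le> 1" and R: "0 \<le> R"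
  shows "real n * R * (1 - \<epsilon>) - 1 \<le> log 2 (card (messages n R)) - (1 + e * log 2 (card (messages n R)))"
proof -
  have "real n * R * (1 - \<epsilon>) \<le> log 2 (card (messages n R)) * (1 - \<epsilon>)"
    using log_card_messages(1) \<epsilon> by (intro mult_right_mono) auto
  also have "\<dots> \<le> log 2 (card (messages n R)) * (1 - e)"
    using log_card_messages(2) \<epsilon> by (intro mult_left_mono) auto
  finally show ?thesis by (simp add: algebra_simps)
qed

lemma I1_lower:
  assumes e: "error_prob1 C n R1 R2 c \<le> \<epsilon>" "\<epsilon> \<le> 1" "0 \<le> R1"
  shows "real n * R1 * (1 - \<epsilon>) - 1 \<le> I1"
proof -
  have "measure_pmf.prob P {\<omega>. dec1 c (listY1 \<omega>) \<noteq> oM1 \<omega>} = error_prob1 C n R1 R2 c"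
    unfolding error_prob1_def
  proof (rule measure_pmf.finite_measure_eq_AE, unfold AE_measure_pmf_iff, rule ballI)
    fix x assume "x \<in> set_pmf P"
    from length_oS[OF this] have "seq_y1 C c n (fst x) (fst (snd x)) (snd (snd x)) = listY1 x"
      using seq_eqs(1)[of "snd (snd x)" "fst x" "fst (snd x)"] by (simp add: oS_def)
    then show "x \<in> {\<omega>. dec1 c (listY1 \<omega>) \<noteq> oM1 \<omega>} \<longleftrightarrow> x \<in> {(m1, m2, ss). dec1 c (seq_y1 C c n m1 m2 ss) \<noteq> m1}"
      by (simp add: case_prod_unfold)
  qed simp_all
  moreover have "cH P oM1 listY1 \<le> 1 + measure_pmf.prob P {\<omega>. dec1 c (listY1 \<omega>) \<noteq> oM1 \<omega>} * log 2 (card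
      (messages n R1))"
    by (rule fano[OF finP fin_msgs(1)]) (use fin_msgs in \<open>auto simp: source_pmf_def\<close>)
  moreover have "HH P oM1 = log 2 (card (messages n R1))"
    unfolding map_M1 by (rule ent_pmf_of_set[OF fin_msgs])
  ultimately show ?thesis
    using fano_messages[OF e] unfolding I1_def cH_def by simp
qed

lemma I2_lower:
  assumes e: "error_prob2 C n R1 R2 c \<le> \<epsilon>" "\<epsilon> \<le> 1" "0 \<le> R2"
  shows "real n * R2 * (1 - \<epsilon>) - 1 \<le> I2"
proof -
  have "measure_pmf.prob P {\<omega>. dec2 c (listY2 \<omega>) \<noteq> oM2 \<omega>} = error_prob2 C n R1 R2 c"
    unfolding error_prob2_def
  proof (rule measure_pmf.finite_measure_eq_AE, unfold AE_measure_pmf_iff, rule ballI)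
    fix x assume "x \<in> set_pmf P"
    from length_oS[OF this] have "seq_y2 C c n (fst x) (fst (snd x)) (snd (snd x)) = listY2 x"
      using seq_eqs(2)[of "snd (snd x)" "fst x" "fst (snd x)"] by (simp add: oS_def)
    then show "x \<in> {\<omega>. dec2 c (listY2 \<omega>) \<noteq> oM2 \<omega>} \<longleftrightarrow> x \<in> {(m1, m2, ss). dec2 c (seq_y2 C c n m1 m2 ss) \<noteq> m2}"
      by (simp add: case_prod_unfold oM2_def)
  qed simp_all
  moreover have "cH P oM2 listY2 \<le> 1 + measure_pmf.prob P {\<omega>. dec2 c (listY2 \<omega>) \<noteq> oM2 \<omega>} * log 2 (card
      (messages n R2))"
    by (rule fano[OF finP fin_msgs(1)]) (use fin_msgs in \<open>auto simp: source_pmf_def oM2_def\<close>)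
  moreover have "HH P oM2 = log 2 (card (messages n R2))"
    unfolding map_M2 by (rule ent_pmf_of_set[OF fin_msgs])
  ultimately show ?thesis
    using fano_messages[OF e] unfolding I2_def cH_def by simp
qed

definition "sA = (\<Sum>i<n. cH P (oY1 i) (\<lambda>\<omega>. (oW i \<omega>, oS \<omega> ! i)))"
definition "sB = (\<Sum>i<n. cH P (\<lambda>\<omega>. (oY2 i \<omega>, oZ i \<omega>)) (\<lambda>\<omega>. (oT i \<omega>, oW i \<omega>)))"
definition "sV = (\<Sum>i<n. HH P (oY2 i))"
definition "sVZ = (\<Sum>i<n. cH P (\<lambda>\<omega>. (oY2 i \<omega>, oZ i \<omega>)) (oW i))"
definition "sI = (\<Sum>i<n. cH P (\<lambda>\<omega>. oS \<omega> ! i) (oW i) - cH P (\<lambda>\<omega>. oS \<omega> ! i) (\<lambda>\<omega>. (oT i \<omega>, oW i \<omega>)))"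
definition "sD = (\<Sum>i<n. cH P (oY1 i) (\<lambda>\<omega>. (oW i \<omega>, oT i \<omega>, oS \<omega> ! i)))"

text \<open>Given both messages and the states the interference is determined, so this entropy
  measures what encoder 1 reveals of its own message through the interference. It is a cost for
  receiver 2 and a credit for receiver 1.\<close>

definition "gap = cH P listT (\<lambda>\<omega>. (oM2 \<omega>, oS \<omega>))"

lemma gap_nonneg: "0 \<le> gap"
proof -
  have "HH P (\<lambda>\<omega>. (oM2 \<omega>, oS \<omega>)) \<le> HH P (\<lambda>\<omega>. (listT \<omega>, (oM2 \<omega>, oS \<omega>)))"
    by (rule HH_mono[OF finP, where g = snd]) auto
  then show ?thesis by (simp add: gap_def cH_def)
qed

lemma I1_le_sA: "I1 \<le> sA"
proof -
  have "I1 \<le> cH P listY1 (\<lambda>\<omega>. (oM2 \<omega>, oS \<omega>))"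
    unfolding I1_def by (rule mutual_info_le_of_indep[OF finP indep(1)])
  also have "\<dots> \<le> sA"
    unfolding sA_def listY1_def
    by (rule HH_chain_le[OF finP, where h = "\<lambda>i l (m, s). (to_nat (zpre i m), s ! i)"]) (auto simp: oW_def)
  finally show ?thesis .
qed

text \<open>The cribbing signals are added to the output so that the past of the chain contains the
  prefix. Together with the first message and the states, the prefix determines both
  \<open>W\<close> and the current interference letter.\<close>

lemma I2_le_sB: "I2 \<le> sB"
proof -
  have "I2 \<le> cH P listY2 (\<lambda>\<omega>. (oM1 \<omega>, oS \<omega>))"
    unfolding I2_def by (rule mutual_info_le_of_indep[OF finP indep(2)])
  also have "\<dots> \<le> cH P listYZ (\<lambda>\<omega>. (oM1 \<omega>, oS \<omega>))"
  proof -
    have "HH P (\<lambda>\<omega>. (listY2 \<omega>, (oM1 \<omega>, oS \<omega>))) \<le> HH P (\<lambda>\<omega>. (listYZ \<omega>, (oM1 \<omega>, oS \<omega>)))"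
      by (rule HH_mono[OF finP, where g = "\<lambda>(l, b). (map fst l, b)"]) (auto simp: listY2_def listYZ_def)
    then show ?thesis by (simp add: cH_def)
  qed
  also have "\<dots> \<le> sB"
    unfolding sB_def listYZ_def
    by (rule HH_chain_le[OF finP, where h = "\<lambda>i l (m, s). (interf C (enc1 c i m s (map snd l)) (s ! i),
        to_nat (map snd l))"])
      (auto simp: oT_def oX1_def oW_def zpre_def oZ_def oX2_def comp_def)
  finally show ?thesis .
qed

text \<open>The message fixes the inputs of encoder 2, and for a fixed input the output map can be
  inverted letter by letter.\<close>

lemma HH_M2_listY2: "HH P (\<lambda>\<omega>. (oM2 \<omega>, listY2 \<omega>)) = HH P (\<lambda>\<omega>. (oM2 \<omega>, listT \<omega>))"
proof (rule HH_eqI[OF finP, where g = "\<lambda>(m, t). (m, map (\<lambda>i. out2 C (enc2 c i m) (t ! i)) [0..<n])"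
      and h = "\<lambda>(m, y). (m, map (\<lambda>i. inv (out2 C (enc2 c i m)) (y ! i)) [0..<n])"])
  have "inj (out2 C x)" for x using inj by (simp add: injective_zic_def)
  then show "(oM2 \<omega>, listT \<omega>) = (case (oM2 \<omega>, listY2 \<omega>) of (m, y) \<Rightarrow> (m, map (\<lambda>i. inv (out2 C (enc2 c i m)) (y
      ! i)) [0..<n]))" for \<omega>
    by (auto simp: listT_def listY2_def oY2_def oX2_def)
qed (auto simp: listT_def listY2_def oY2_def oX2_def)

lemma HH_oS: "HH P oS = (\<Sum>i<n. HH P (\<lambda>\<omega>. oS \<omega> ! i))"
proof -
  have "HH P (\<lambda>\<omega>. oS \<omega> ! i) = ent (state_pmf C)" if "i < n" for i
  proof -
    have "map_pmf (\<lambda>\<omega>. oS \<omega> ! i) P = map_pmf (\<lambda>s. s ! i) (map_pmf oS P)" by (simp add: map_pmf_comp)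
    then show ?thesis unfolding map_S map_nth_replicate_pmf[OF that] by simp
  qed
  then show ?thesis unfolding map_S by (simp add: ent_replicate_pmf)
qed

text \<open>H(T|M2) = H(S|M2) - H(S|T,M2) + H(T|M2,S) for the sequences. The first term equals the
  sum of the H(S_i), as the states are i.i.d. and independent of M2, and conditioning on
  \<open>W\<close> only lowers it; the second is bounded through the chain rule.\<close>

lemma HH_M2_listT: "sI + gap \<le> HH P (\<lambda>\<omega>. (oM2 \<omega>, listT \<omega>)) - HH P oM2"
proof -
  let ?B = "\<lambda>\<omega>. (listT \<omega>, oM2 \<omega>)"
  have ch: "cH P (\<lambda>\<omega>. map (\<lambda>i. oS \<omega> ! i) [0..<n]) ?B \<le> (\<Sum>i<n. cH P (\<lambda>\<omega>. oS \<omega> ! i) (\<lambda>\<omega>. (oT i \<omega>, oW i \<omega>)))"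
    by (rule HH_chain_le[OF finP, where h = "\<lambda>i l (t, m). (t ! i, to_nat (zpre i m))"]) (auto simp: listT_def
        oW_def)
  have "HH P (\<lambda>\<omega>. (map (\<lambda>i. oS \<omega> ! i) [0..<n], ?B \<omega>)) = HH P (\<lambda>\<omega>. (listT \<omega>, (oM2 \<omega>, oS \<omega>)))"
  proof (rule HH_eqI[OF finP, where g = "\<lambda>(t, m, s). (s, t, m)" and h = "\<lambda>(s, t, m). (t, m, s)"])
    fix \<omega> assume "\<omega> \<in> set_pmf P"
    then have "map (\<lambda>i. oS \<omega> ! i) [0..<n] = oS \<omega>" using length_oS by (metis map_nth)
    then show "(map (\<lambda>i. oS \<omega> ! i) [0..<n], ?B \<omega>) = (case (listT \<omega>, oM2 \<omega>, oS \<omega>) of (t, m, s) \<Rightarrow> (s, t, m))"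
      "(listT \<omega>, oM2 \<omega>, oS \<omega>) = (case (map (\<lambda>i. oS \<omega> ! i) [0..<n], ?B \<omega>) of (s, t, m) \<Rightarrow> (t, m, s))" by auto
  qed
  moreover have "HH P ?B = HH P (\<lambda>\<omega>. (oM2 \<omega>, listT \<omega>))"
    by (rule HH_eqI[OF finP, where g = "\<lambda>(x, y). (y, x)" and h = "\<lambda>(x, y). (y, x)"]) auto
  moreover have "sI \<le> HH P oS - (\<Sum>i<n. cH P (\<lambda>\<omega>. oS \<omega> ! i) (\<lambda>\<omega>. (oT i \<omega>, oW i \<omega>)))"
    unfolding sI_def HH_oS sum_subtractf[symmetric]
  proof (intro sum_mono diff_right_mono)
    fix i
    show "cH P (\<lambda>\<omega>. oS \<omega> ! i) (oW i) \<le> HH P (\<lambda>\<omega>. oS \<omega> ! i)"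
      using HH_subadditive[OF finP, of "\<lambda>\<omega>. oS \<omega> ! i" "oW i"] by (simp add: cH_def)
  qed
  ultimately show ?thesis using ch indep(3) by (simp add: gap_def cH_def)
qed

text \<open>In the chain for the pairs, the earlier cribbing letters are themselves the prefix, so
  the condition \<open>W\<close> arises without any message. The unit condition recovers
  unconditional entropies.\<close>

lemma HH_listY2_le: "HH P listY2 \<le> sV" "HH P listYZ \<le> sVZ" "HH P listY2 \<le> HH P listYZ"
proof -
  have u: "HH P (\<lambda>\<omega>. (X \<omega>, ())) = HH P X" for X :: "_ \<Rightarrow> 'c"
    by (rule HH_eqI[OF finP, where g = "\<lambda>x. (x, ())" and h = fst]) auto
  have u0: "HH P (\<lambda>_. ()) = 0" by (simp add: ent_def)
  have "cH P listY2 (\<lambda>_. ()) \<le> (\<Sum>i<n. cH P (oY2 i) (\<lambda>_. ()))"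
    unfolding listY2_def by (rule HH_chain_le[OF finP, where h = "\<lambda>i l b. ()"]) auto
  then show "HH P listY2 \<le> sV" by (simp add: cH_def u u0 sV_def del: map_pmf_const)
  have "cH P listYZ (\<lambda>_. ()) \<le> sVZ"
    unfolding listYZ_def sVZ_def
    by (rule HH_chain_le[OF finP, where h = "\<lambda>i l b. to_nat (map snd l)"]) (auto simp: oW_def zpre_def oZ_def
        oX2_def comp_def)
  then show "HH P listYZ \<le> sVZ" by (simp add: cH_def u u0 del: map_pmf_const)
  show "HH P listY2 \<le> HH P listYZ"
    by (rule HH_mono[OF finP, where g = "map fst"]) (auto simp: listY2_def listYZ_def)
qed

lemma I2_le: "I2 + gap \<le> min sV sVZ - sI"
  using HH_M2_listT HH_listY2_le unfolding I2_def HH_M2_listY2 by linarith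

text \<open>The interference sequence is added to the output of receiver 1. The chain rule then
  separates \<open>gap\<close> from the output given the interference.\<close>

lemma I1_le_gap: "I1 \<le> gap + sD"
proof -
  let ?B = "\<lambda>\<omega>. (listT \<omega>, oM2 \<omega>, oS \<omega>)"
  have "I1 \<le> cH P listY1 (\<lambda>\<omega>. (oM2 \<omega>, oS \<omega>))"
    unfolding I1_def by (rule mutual_info_le_of_indep[OF finP indep(1)])
  moreover have "HH P (\<lambda>\<omega>. (listY1 \<omega>, (oM2 \<omega>, oS \<omega>))) \<le> HH P (\<lambda>\<omega>. (listY1 \<omega>, ?B \<omega>))"
    by (rule HH_mono[OF finP, where g = "\<lambda>(y, t, b). (y, b)"]) auto
  moreover have "cH P listY1 ?B \<le> sD"
    unfolding sD_def listY1_def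
    by (rule HH_chain_le[OF finP, where h = "\<lambda>i l (t, m, s). (to_nat (zpre i m), t ! i, s ! i)"]) (auto simp:
        oW_def listT_def)
  ultimately show ?thesis by (simp add: gap_def cH_def)
qed

definition "law i = map_pmf (\<lambda>\<omega>. (oW i \<omega>, oS \<omega> ! i, oX1 i \<omega>, oX2 i \<omega>)) P"

text \<open>M2 is disintegrated along the prefix, and the pair of M1 and the states along the
  current state letter. As these two sources are independent, and encoder 1 uses M2 only through the
  prefix, which \<open>from_nat\<close> recovers from \<open>w\<close>, the law factors as
  required.\<close>

lemma law_joint:
  assumes i: "i < n"
  shows "\<exists>pw px2 px1. finite (set_pmf pw) \<and> law i = joint_pmf (state_pmf C) pw px2 px1"
proof -
  define A where "A = pair_pmf U1 Sn"
  define f where "f = (\<lambda>(m1 :: nat, s :: 's list). s ! i)"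
  define g where "g m = to_nat (zpre i m)" for m
  define pw where "pw = map_pmf g U2"
  define px2 where "px2 w = map_pmf (\<lambda>m. enc2 c i m) (cond_pmf U2 {m. g m = w})" for w
  define px1 where "px1 w s = map_pmf (\<lambda>(m1, ss). enc1 c i m1 ss (from_nat w)) (cond_pmf A {x. f x = s})" for
      w s
  have fA: "map_pmf f A = state_pmf C"
  proof -
    have "map_pmf f A = map_pmf (\<lambda>s. s ! i) (map_pmf snd A)" by (simp add: f_def map_pmf_comp
        case_prod_unfold)
    then show ?thesis by (simp add: A_def map_snd_pair_pmf map_nth_replicate_pmf i)
  qed
  have cA: "x \<in> set_pmf (cond_pmf A {x. f x = s}) \<Longrightarrow> f x = s" if "s \<in> set_pmf (state_pmf C)" for x s
  proof -
    have "set_pmf A \<inter> {x. f x = s} \<noteq> {}" using that unfolding fA[symmetric] by auto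
    then show "x \<in> set_pmf (cond_pmf A {x. f x = s}) \<Longrightarrow> f x = s" by simp
  qed
  have cU: "m \<in> set_pmf (cond_pmf U2 {m. g m = w}) \<Longrightarrow> g m = w" if "w \<in> set_pmf pw" for m w
  proof -
    have "set_pmf U2 \<inter> {m. g m = w} \<noteq> {}" using that unfolding pw_def by auto
    then show "m \<in> set_pmf (cond_pmf U2 {m. g m = w}) \<Longrightarrow> g m = w" by simp
  qed
  let ?K = "\<lambda>x m. return_pmf (g m, f x, enc1 c i (fst x) (snd x) (zpre i m), enc2 c i m)"
  have "law i = bind_pmf A (\<lambda>x. bind_pmf U2 (\<lambda>m. ?K x m))"
    unfolding law_def source_pmf_def A_def pair_pmf_def
    by (simp add: map_bind_pmf bind_assoc_pmf bind_return_pmf oW_def g_def oX1_def oX2_def oM2_def oS_def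
        f_def)
      (rule bind_pmf_cong[OF refl], rule bind_commute_pmf)
  also have "\<dots> = bind_pmf (bind_pmf (map_pmf f A) (\<lambda>s. cond_pmf A {x. f x = s})) (\<lambda>x.
      bind_pmf (bind_pmf (map_pmf g U2) (\<lambda>w. cond_pmf U2 {m. g m = w})) (\<lambda>m. ?K x m))"
    unfolding bind_cond_pmf_fibre ..
  also have "\<dots> = bind_pmf (state_pmf C) (\<lambda>s. bind_pmf (cond_pmf A {x. f x = s}) (\<lambda>x. bind_pmf pw (\<lambda>w.
      bind_pmf (cond_pmf U2 {m. g m = w}) (\<lambda>m. ?K x m))))"
    unfolding fA pw_def[symmetric] by (simp add: bind_assoc_pmf)
  also have "\<dots> = bind_pmf (state_pmf C) (\<lambda>s. bind_pmf (cond_pmf A {x. f x = s}) (\<lambda>x. bind_pmf pw (\<lambda>w.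
      bind_pmf (cond_pmf U2 {m. g m = w}) (\<lambda>m. return_pmf (w, s, enc1 c i (fst x) (snd x) (from_nat w), enc2
          c i m)))))"
  proof (rule bind_pmf_cong[OF refl], rule bind_pmf_cong[OF refl], rule bind_pmf_cong[OF refl], rule
      bind_pmf_cong[OF refl])
    fix s x w m assume s: "s \<in> set_pmf (state_pmf C)" and x: "x \<in> set_pmf (cond_pmf A {x. f x = s})"
      and w: "w \<in> set_pmf pw" and m: "m \<in> set_pmf (cond_pmf U2 {m. g m = w})"
    have "from_nat (g m) = zpre i m" by (simp add: g_def)
    then show "?K x m = return_pmf (w, s, enc1 c i (fst x) (snd x) (from_nat w), enc2 c i m)"
      using cA[OF s x] cU[OF w m] by simp
  qed
  also have "\<dots> = bind_pmf (state_pmf C) (\<lambda>s. bind_pmf pw (\<lambda>w. bind_pmf (cond_pmf A {x. f x = s}) (\<lambda>x.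
      bind_pmf (cond_pmf U2 {m. g m = w}) (\<lambda>m. return_pmf (w, s, enc1 c i (fst x) (snd x) (from_nat w), enc2
          c i m)))))"
    by (rule bind_pmf_cong[OF refl]) (rule bind_commute_pmf)
  also have "\<dots> = bind_pmf (state_pmf C) (\<lambda>s. bind_pmf pw (\<lambda>w. bind_pmf (cond_pmf U2 {m. g m = w}) (\<lambda>m.
      bind_pmf (cond_pmf A {x. f x = s}) (\<lambda>x. return_pmf (w, s, enc1 c i (fst x) (snd x) (from_nat w), enc2 c
          i m)))))"
    by (rule bind_pmf_cong[OF refl], rule bind_pmf_cong[OF refl]) (rule bind_commute_pmf)
  also have "\<dots> = joint_pmf (state_pmf C) pw px2 px1"
    by (simp add: joint_pmf_def px2_def px1_def bind_map_pmf case_prod_unfold)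
  finally show ?thesis using fin_msgs by (intro exI conjI) (auto simp: pw_def)
qed

text \<open>A uniformly distributed time index, merged into \<open>W\<close>, turns the sums over
  time into the averages that \<open>rate_region_mixture\<close> accepts.\<close>

lemma in_region: "(I1 / real n, I2 / real n) \<in> rate_region C"
proof -
  obtain pw px2 px1 where law: "\<And>i. i < n \<Longrightarrow> finite (set_pmf (pw i))" "\<And>i. i < n \<Longrightarrow> law i = joint_pmf
      (state_pmf C) (pw i) (px2 i) (px1 i)"
    using law_joint by metis
  have n': "{..<n} \<noteq> {}" using n by auto
  let ?q = "pmf_of_set {..<n}"
  have E: "measure_pmf.expectation ?q (\<lambda>i. F (joint_pmf (state_pmf C) (pw i) (px2 i) (px1 i))) = (\<Sum>i<n. F
      (law i)) / real n" for F :: "_ \<Rightarrow> real"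
    using n' law by (subst integral_pmf_of_set) auto
  have s: "(\<Sum>i<n. HY1_WS C (law i)) = sA" "(\<Sum>i<n. HYZ_TW C (law i)) = sB" "(\<Sum>i<n. HY2 C (law i)) = sV"
    "(\<Sum>i<n. HYZ_W C (law i)) = sVZ" "(\<Sum>i<n. ITS_W C (law i)) = sI" "(\<Sum>i<n. HY1_WTS C (law i)) = sD"
    unfolding HY1_WS_def HYZ_TW_def HY2_def HYZ_W_def ITS_W_def HY1_WTS_def law_def cH_map map_pmf_comp
        sA_def sB_def sV_def sVZ_def sI_def sD_def
    by (simp_all add: oY1_def[abs_def] oT_def[abs_def] oY2_def[abs_def] oZ_def[abs_def])
  have mn: "min (sV / real n) (sVZ / real n) = min sV sVZ / real n"
    using n by (simp add: min_def divide_le_cancel)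
  show ?thesis
  proof (rule rate_region_mixture[where q = ?q and pw = pw and ?px2.0 = px2 and ?px1.0 = px1], unfold E s mn)
    show "finite (set_pmf ?q)" using n' by simp
    show "finite (set_pmf (pw i))" if "i \<in> set_pmf ?q" for i using that n' law by simp
    show "0 \<le> I1 / real n" "0 \<le> I2 / real n" using I_nonneg by simp_all
    show "I1 / real n \<le> sA / real n" by (rule divide_right_mono[OF I1_le_sA]) simp
    show "I2 / real n \<le> sB / real n" by (rule divide_right_mono[OF I2_le_sB]) simp
    have "I2 \<le> min sV sVZ - sI" using I2_le gap_nonneg by linarith
    then have "I2 / real n \<le> (min sV sVZ - sI) / real n" by (rule divide_right_mono) simp
    then show "I2 / real n \<le> min sV sVZ / real n - sI / real n" by (simp add: diff_divide_distrib)
    \<comment> \<open>Here \<open>gap\<close> cancels: it is subtracted in the bound for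
      \<open>I2\<close> and added in the one for \<open>I1\<close>.\<close>
    have "I1 + I2 \<le> sD + min sV sVZ - sI" using I2_le I1_le_gap by linarith
    then have "(I1 + I2) / real n \<le> (sD + min sV sVZ - sI) / real n" by (rule divide_right_mono) simp
    then show "I1 / real n + I2 / real n \<le> sD / real n + min sV sVZ / real n - sI / real n"
      by (simp add: diff_divide_distrib add_divide_distrib)
  qed
qed

end

lemma rate_region_antimono:
  fixes C :: "('s::finite, 'x1::finite, 'x2::finite, 't1::finite, 'y1::finite, 'y2::finite, 'z2::finite) zic"
  assumes "(a, b) \<in> rate_region C" "0 \<le> a'" "a' \<le> a" "0 \<le> b'" "b' \<le> b"
  shows "(a', b') \<in> rate_region C"
proof -
  obtain pw px2 px1 where f: "finite (set_pmf pw)" and r: "in_rate_region C (joint_pmf (state_pmf C) pw px2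
      px1) a b"
    using assms(1) by (auto simp: rate_region_def)
  have "in_rate_region C (joint_pmf (state_pmf C) pw px2 px1) a' b'"
    using r assms unfolding in_rate_region_iff[OF finite_joint_pmf[OF f]] by linarith
  with f show ?thesis by (auto simp: rate_region_def)
qed

theorem achievable_in_closure:
  fixes C :: "('s::finite, 'x1::finite, 'x2::finite, 't1::finite, 'y1::finite, 'y2::finite, 'z2::finite) zic"
  assumes inj: "injective_zic C" and ach: "achievable C R1 R2"
  shows "(R1, R2) \<in> closure (rate_region C)"
  unfolding closure_approachable
proof (intro allI impI)
  fix e :: real assume e: "0 < e"
  have R: "0 \<le> R1" "0 \<le> R2" using ach by (auto simp: achievable_def)
  \<comment> \<open>Chosen so that Fano's multiplicative loss is at most e / 4; the added 1 avoids a
    division by zero when both rates vanish.\<close>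
  define \<epsilon> where "\<epsilon> = min 1 (e / (4 * (R1 + R2 + 1)))"
  have \<epsilon>: "0 < \<epsilon>" "\<epsilon> \<le> 1" using e R by (auto simp: \<epsilon>_def)
  have \<epsilon>R: "(R1 + R2) * \<epsilon> \<le> e / 4"
  proof -
    have "(R1 + R2) * \<epsilon> \<le> (R1 + R2 + 1) * (e / (4 * (R1 + R2 + 1)))"
      using R \<epsilon> by (intro mult_mono) (auto simp: \<epsilon>_def)
    also have "\<dots> = e / 4" using R by (simp add: field_simps)
    finally show ?thesis .
  qed
  \<comment> \<open>Fano's additive loss is 1 / n in each coordinate, so that both together stay
    below e / 4.\<close>
  have "\<forall>\<^sub>F n in sequentially. 8 / e < real n"
    by (rule eventually_gt_at_top[THEN eventually_compose_filterlim[OF _ filterlim_real_sequentially]])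
  moreover have "\<forall>\<^sub>F n in sequentially. \<exists>c. is_code n R1 R2 c \<and> error_prob1 C n R1 R2 c \<le> \<epsilon> \<and> error_prob2 C n
      R1 R2 c \<le> \<epsilon>"
    using ach \<epsilon> by (auto simp: achievable_def)
  ultimately have "\<forall>\<^sub>F n in sequentially. 0 < n \<and> 8 / e < real n \<and> (\<exists>c. is_code n R1 R2 c \<and> error_prob1 C n
      R1 R2 c \<le> \<epsilon> \<and> error_prob2 C n R1 R2 c \<le> \<epsilon>)"
    using eventually_gt_at_top[of 0] by eventually_elim auto
  from eventually_happens'[OF sequentially_bot this]
  obtain n c where large: "0 < n" "8 / e < real n" and c: "error_prob1 C n R1 R2 c \<le> \<epsilon>" "error_prob2 C n R1
      R2 c \<le> \<epsilon>"
    by blast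
  interpret coding C c n R1 R2 by unfold_locales (use inj large in auto)
  \<comment> \<open>The lower bounds on \<open>I1 / n\<close> and \<open>I2 / n\<close> may be
    negative, whereas points of the region are not; clipping at 0 moves them no further from the
    target.\<close>
  let ?a = "max 0 (R1 * (1 - \<epsilon>) - 1 / real n)" and ?b = "max 0 (R2 * (1 - \<epsilon>) - 1 / real n)"
  have inv: "1 / real n < e / 8" using large e by (simp add: field_simps)
  have "R1 * (1 - \<epsilon>) - 1 / real n = (real n * R1 * (1 - \<epsilon>) - 1) / real n" using large by (simp add:
      field_simps)
  also have "\<dots> \<le> I1 / real n" by (rule divide_right_mono[OF I1_lower[OF c(1) \<epsilon>(2) R(1)]]) simp
  finally have a: "?a \<le> I1 / real n" using I_nonneg by simp
  have "R2 * (1 - \<epsilon>) - 1 / real n = (real n * R2 * (1 - \<epsilon>) - 1) / real n" using large by (simp add: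
      field_simps)
  also have "\<dots> \<le> I2 / real n" by (rule divide_right_mono[OF I2_lower[OF c(2) \<epsilon>(2) R(2)]]) simp
  finally have b: "?b \<le> I2 / real n" using I_nonneg by simp
  have mem: "(?a, ?b) \<in> rate_region C"
    by (rule rate_region_antimono[OF in_region _ a _ b]) simp_all
  have "dist (?a, ?b) (R1, R2) \<le> \<bar>?a - R1\<bar> + \<bar>?b - R2\<bar>"
    unfolding dist_prod_def dist_real_def by (rule order_trans[OF sqrt_sum_squares_le_sum]) auto
  also have "\<dots> \<le> (R1 * \<epsilon> + 1 / real n) + (R2 * \<epsilon> + 1 / real n)"
  proof -
    have *: "\<bar>max 0 (r * (1 - \<epsilon>) - d) - r\<bar> \<le> r * \<epsilon> + d" if "0 \<le> r" "0 \<le> d" for r d :: real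
    proof -
      have "0 \<le> r * \<epsilon>" using that \<epsilon> by simp
      then show ?thesis using that by (auto simp: max_def algebra_simps abs_if)
    qed
    show ?thesis by (intro add_mono * R) simp_all
  qed
  also have "\<dots> = (R1 + R2) * \<epsilon> + 2 * (1 / real n)" by (simp add: algebra_simps)
  also have "\<dots> < e" using \<epsilon>R inv e by linarith
  finally have "dist (?a, ?b) (R1, R2) < e" .
  with mem show "\<exists>y\<in>rate_region C. dist y (R1, R2) < e" by blast
qed

theorem theorem7:
  fixes C :: "('s::finite, 'x1::finite, 'x2::finite, 't1::finite, 'y1::finite, 'y2::finite,
               'z2::finite) zic"
  assumes "injective_zic C"
  shows "capacity_region C = closure (convex hull (rate_region C))"
proof
  have hull: "convex hull (rate_region C) = rate_region C"
    using convex_rate_region by (rule hull_same)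
  have "{(R1, R2). achievable C R1 R2} \<subseteq> closure (rate_region C)"
    using achievable_in_closure[OF assms] by auto
  then show "capacity_region C \<subseteq> closure (convex hull (rate_region C))"
    unfolding hull capacity_region_def by (rule closure_minimal) simp
  have "rate_region C \<subseteq> closure {(R1, R2). achievable C R1 R2}"
  proof
    fix x assume "x \<in> rate_region C"
    then obtain pw px2 px1 where f: "finite (set_pmf pw)" and r: "in_rate_region C (joint_pmf (state_pmf C)
        pw px2 px1) (fst x) (snd x)"
      by (auto simp: rate_region_def)
    interpret single_letter C pw px2 px1 by unfold_locales (rule f)
    show "x \<in> closure {(R1, R2). achievable C R1 R2}"
      using region_point_in_closure[OF r] by simp
  qed
  then show "closure (convex hull (rate_region C)) \<subseteq> capacity_region C"
    unfolding hull capacity_region_def by (rule closure_minimal) simp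
qed

end
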